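(* Let $f:(R,\mathfrak{m})\to (S,\mathfrak{n})$ be a local homomorphism of commutative Noetherian local rings, and let $N$ be a non-zero finitely generated $S$-module which is flat as an $R$-module (via $f$). Let $I$ be a proper ideal of $R$ and let $M$ be a non-zero finitely generated $R$-module such that $M\otimes_R N\neq I(M\otimes_R N)$. Then the following conditions are equivalent: (1) $M$ is $I$-Cohen Macaulay and $\dim_S N/\mathfrak{m}N=0$. (2) $M\otimes_R N$ is $IS$-Cohen Macaulay (as an $S$-module), $\operatorname{grade}(I,M)=\operatorname{grade}(IS,M\otimes_R N)$ and $\dim_R M/IM=\dim_S (M\otimes_R N)/I(M\otimes_R N)$. (3) $M\otimes_R N$ is $IS$-Cohen Macaulay (as an $S$-module), $\operatorname{grade}(I,M)=\operatorname{grade}(IS,M\otimes_R N)$ and $\dim_R M=\dim_S (M\otimes_R N)$.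
   Context: For a commutative Noetherian ring $A$, a proper ideal $J$ of $A$ and a finitely generated $A$-module $L$, $L$ is called $J$-Cohen Macaulay (over $A$) if $\operatorname{grade}(J,L)+\dim_A(L/JL)=\dim_A(L)$. Here $\operatorname{grade}(J,L)$ is the length of a maximal $L$-regular sequence contained in $J$, and $\dim$ denotes Krull dimension. *)

theory Defs
  imports "HOL-Algebra.Algebra" "HOL-Library.Extended_Real"
begin

section \<open>Submodules, quotients and homomorphisms\<close>

definition submodule_span ::
    "('a, 'r) ring_scheme \<Rightarrow> ('a, 'l, 'k) module_scheme \<Rightarrow> 'l set \<Rightarrow> 'l set" where
  "submodule_span A L Y = \<Inter>{K. submodule K A L \<and> Y \<subseteq> K}"

definition fin_gen_module :: "('a, 'r) ring_scheme \<Rightarrow> ('a, 'l, 'k) module_scheme \<Rightarrow> bool" where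
  "fin_gen_module A L \<longleftrightarrow>
     module A L \<and> (\<exists>Y. finite Y \<and> Y \<subseteq> carrier L \<and> submodule_span A L Y = carrier L)"

text \<open>The submodule \<open>J L\<close>. Here \<open>J\<close> may be any subset of the ring: the result is the same as for
  the ideal generated by \<open>J\<close>. In particular, for a ring homomorphism \<open>f\<close> from \<open>R\<close> to \<open>S\<close>, an ideal
  \<open>I\<close> of \<open>R\<close> and an \<open>S\<close>-module \<open>L\<close>, the submodule \<open>I L\<close> is \<open>set_smult S (f ` I) L\<close>.\<close>

definition set_smult ::
    "('a, 'r) ring_scheme \<Rightarrow> 'a set \<Rightarrow> ('a, 'l, 'k) module_scheme \<Rightarrow> 'l set" where
  "set_smult A J L = submodule_span A L {a \<odot>\<^bsub>L\<^esub> x | a x. a \<in> J \<and> x \<in> carrier L}"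

text \<open>The record type of modules extends that of rings; its fields \<open>mult\<close> and \<open>one\<close> have no meaning
  for a module and are left unspecified below.\<close>

definition quot_module ::
    "('a, 'l, 'k) module_scheme \<Rightarrow> 'l set \<Rightarrow> ('a, 'l set) module" where
  "quot_module L K =
     \<lparr>carrier = a_rcosets\<^bsub>L\<^esub> K, monoid.mult = undefined, one = undefined, ring.zero = K, add = set_add L,
      smult = (\<lambda>a Y. \<Union>x\<in>Y. K +>\<^bsub>L\<^esub> (a \<odot>\<^bsub>L\<^esub> x))\<rparr>"

definition module_homs ::
    "('a, 'r) ring_scheme \<Rightarrow> ('a, 'l, 'k) module_scheme \<Rightarrow> ('a, 'm, 'j) module_scheme
      \<Rightarrow> ('l \<Rightarrow> 'm) set" where
  "module_homs A L M =
     {g \<in> hom (add_monoid L) (add_monoid M).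
        \<forall>a\<in>carrier A. \<forall>x\<in>carrier L. g (a \<odot>\<^bsub>L\<^esub> x) = a \<odot>\<^bsub>M\<^esub> g x}"


section \<open>Noetherian local rings\<close>

locale noetherian_local_ring = cring R + noetherian_ring R for R (structure) and \<mm> +
  assumes maximal: "maximalideal \<mm> R"
    and maximal_unique: "maximalideal P R \<Longrightarrow> P = \<mm>"


section \<open>Krull dimension\<close>

text \<open>The value is \<open>-\<infinity>\<close> for the zero ring, which has no prime ideals, and hence also for the
  zero module.\<close>

definition krull_dim :: "('a, 'r) ring_scheme \<Rightarrow> ereal" where
  "krull_dim A =
     (SUP ps \<in> {ps. ps \<noteq> [] \<and> (\<forall>P\<in>set ps. primeideal P A) \<and> sorted_wrt (\<subset>) ps}.
        ereal (real (length ps - 1)))"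

definition annihilator :: "('a, 'r) ring_scheme \<Rightarrow> ('a, 'l, 'k) module_scheme \<Rightarrow> 'a set" where
  "annihilator A L = {a \<in> carrier A. \<forall>x\<in>carrier L. a \<odot>\<^bsub>L\<^esub> x = \<zero>\<^bsub>L\<^esub>}"

definition module_dim :: "('a, 'r) ring_scheme \<Rightarrow> ('a, 'l, 'k) module_scheme \<Rightarrow> ereal" where
  "module_dim A L = krull_dim (A Quot (annihilator A L))"


section \<open>Regular sequences, grade and relative Cohen-Macaulay modules\<close>

definition regular_seq ::
    "('a, 'r) ring_scheme \<Rightarrow> ('a, 'l, 'k) module_scheme \<Rightarrow> 'a list \<Rightarrow> bool" where
  "regular_seq A L xs \<longleftrightarrow>
     set xs \<subseteq> carrier A \<and>
     (\<forall>i < length xs. let Q = quot_module L (set_smult A (set (take i xs)) L) in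
        \<forall>y\<in>carrier Q. xs ! i \<odot>\<^bsub>Q\<^esub> y = \<zero>\<^bsub>Q\<^esub> \<longrightarrow> y = \<zero>\<^bsub>Q\<^esub>) \<and>
     set_smult A (set xs) L \<noteq> carrier L"

definition maximal_regular_seq ::
    "('a, 'r) ring_scheme \<Rightarrow> 'a set \<Rightarrow> ('a, 'l, 'k) module_scheme \<Rightarrow> 'a list \<Rightarrow> bool" where
  "maximal_regular_seq A J L xs \<longleftrightarrow>
     set xs \<subseteq> J \<and> regular_seq A L xs \<and> (\<forall>x\<in>J. \<not> regular_seq A L (xs @ [x]))"

text \<open>For a finitely generated module \<open>L\<close> over a commutative Noetherian ring with \<open>J L \<noteq> L\<close>, maximal
  regular sequences in \<open>J\<close> exist and all have the same length, so the description is proper.\<close>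

definition grade ::
    "('a, 'r) ring_scheme \<Rightarrow> 'a set \<Rightarrow> ('a, 'l, 'k) module_scheme \<Rightarrow> nat" where
  "grade A J L = (THE n. \<exists>xs. maximal_regular_seq A J L xs \<and> length xs = n)"

text \<open>\<open>L\<close> is \<open>J\<close>-Cohen-Macaulay over \<open>A\<close>; meant for \<open>A\<close> commutative Noetherian, \<open>J\<close> a proper ideal and
  \<open>L\<close> finitely generated.\<close>

definition relative_CM ::
    "('a, 'r) ring_scheme \<Rightarrow> 'a set \<Rightarrow> ('a, 'l, 'k) module_scheme \<Rightarrow> bool" where
  "relative_CM A J L \<longleftrightarrow>
     ereal (real (grade A J L)) + module_dim A (quot_module L (set_smult A J L)) = module_dim A L"


section \<open>Tensor products and flatness\<close>

text \<open>Throughout, \<open>M\<close> is an \<open>R\<close>-module and \<open>N\<close> is an \<open>S\<close>-module, regarded as an \<open>R\<close>-module via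
  \<open>f\<close>. The tensor product is the free abelian group on the pairs modulo the usual relations, and it
  carries the \<open>S\<close>-module structure with \<open>s (x \<otimes> y) = x \<otimes> s y\<close>. The tensor product of two
  \<open>R\<close>-modules is the case in which \<open>f\<close> is the identity.\<close>

definition tensor_relators ::
    "('a, 'r) ring_scheme \<Rightarrow> ('a \<Rightarrow> 'b) \<Rightarrow> ('a, 'm, 'k) module_scheme \<Rightarrow> ('b, 'n, 'j) module_scheme
      \<Rightarrow> ('m \<times> 'n \<Rightarrow>\<^sub>0 int) set" where
  "tensor_relators R f M N =
     {frag_of (x \<oplus>\<^bsub>M\<^esub> x', y) - frag_of (x, y) - frag_of (x', y) | x x' y.
        x \<in> carrier M \<and> x' \<in> carrier M \<and> y \<in> carrier N} \<union>
     {frag_of (x, y \<oplus>\<^bsub>N\<^esub> y') - frag_of (x, y) - frag_of (x, y') | x y y'.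
        x \<in> carrier M \<and> y \<in> carrier N \<and> y' \<in> carrier N} \<union>
     {frag_of (r \<odot>\<^bsub>M\<^esub> x, y) - frag_of (x, f r \<odot>\<^bsub>N\<^esub> y) | r x y.
        r \<in> carrier R \<and> x \<in> carrier M \<and> y \<in> carrier N}"

abbreviation tensor_free ::
    "('a, 'm, 'k) module_scheme \<Rightarrow> ('b, 'n, 'j) module_scheme \<Rightarrow> ('m \<times> 'n \<Rightarrow>\<^sub>0 int) monoid" where
  "tensor_free M N \<equiv> free_Abelian_group (carrier M \<times> carrier N)"

definition tensor_kernel ::
    "('a, 'r) ring_scheme \<Rightarrow> ('a \<Rightarrow> 'b) \<Rightarrow> ('a, 'm, 'k) module_scheme \<Rightarrow> ('b, 'n, 'j) module_scheme
      \<Rightarrow> ('m \<times> 'n \<Rightarrow>\<^sub>0 int) set" where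
  "tensor_kernel R f M N = generate (tensor_free M N) (tensor_relators R f M N)"

definition tensor ::
    "('a, 'r) ring_scheme \<Rightarrow> ('a \<Rightarrow> 'b) \<Rightarrow> ('a, 'm, 'k) module_scheme \<Rightarrow> ('b, 'n, 'j) module_scheme
      \<Rightarrow> ('b, ('m \<times> 'n \<Rightarrow>\<^sub>0 int) set) module" where
  "tensor R f M N = (let F = tensor_free M N; K = tensor_kernel R f M N in
     \<lparr>carrier = rcosets\<^bsub>F\<^esub> K, monoid.mult = undefined, one = undefined, ring.zero = K, add = set_mult F,
      smult = (\<lambda>s Y. \<Union>c\<in>Y. K #>\<^bsub>F\<^esub> frag_extend (\<lambda>(x, y). frag_of (x, s \<odot>\<^bsub>N\<^esub> y)) c)\<rparr>)"

text \<open>The map \<open>g \<otimes> N\<close> into \<open>M' \<otimes> N\<close> induced by an \<open>R\<close>-linear map \<open>g\<close> into \<open>M'\<close>.\<close>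

definition tensor_map ::
    "('a, 'r) ring_scheme \<Rightarrow> ('a \<Rightarrow> 'b) \<Rightarrow> ('a, 'm, 'k) module_scheme \<Rightarrow> ('b, 'n, 'j) module_scheme
      \<Rightarrow> ('l \<Rightarrow> 'm) \<Rightarrow> ('l \<times> 'n \<Rightarrow>\<^sub>0 int) set \<Rightarrow> ('m \<times> 'n \<Rightarrow>\<^sub>0 int) set" where
  "tensor_map R f M' N g Y =
     (\<Union>c\<in>Y. tensor_kernel R f M' N #>\<^bsub>tensor_free M' N\<^esub> frag_extend (\<lambda>(x, y). frag_of (g x, y)) c)"

text \<open>\<open>N\<close> is flat over \<open>R\<close> if tensoring with \<open>N\<close> preserves exactness of sequences of \<open>R\<close>-modules.
  A HOL formula cannot quantify over all types, so the modules in the sequence are those carried by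
  the type \<open>(nat \<Rightarrow> 'a) set\<close>. Up to isomorphism these include all countably generated \<open>R\<close>-modules
  (quotients of a submodule of the functions from \<open>nat\<close> to \<open>R\<close>), in particular all ideals of \<open>R\<close> and
  all finitely generated modules; as flatness can be tested on the inclusions of finitely generated
  ideals, nothing is lost.\<close>

definition flat_over ::
    "('a, 'r) ring_scheme \<Rightarrow> ('a \<Rightarrow> 'b) \<Rightarrow> ('b, 'n, 'j) module_scheme \<Rightarrow> bool" where
  "flat_over R f N \<longleftrightarrow>
     (\<forall>(A :: ('a, (nat \<Rightarrow> 'a) set) module) (B :: ('a, (nat \<Rightarrow> 'a) set) module)
        (C :: ('a, (nat \<Rightarrow> 'a) set) module) g h.
        module R A \<and> module R B \<and> module R C \<and>
        g \<in> module_homs R A B \<and> h \<in> module_homs R B C \<and>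
        g ` carrier A = a_kernel B C h \<longrightarrow>
        tensor_map R f B N g ` carrier (tensor R f A N) =
          a_kernel (tensor R f B N) (tensor R f C N) (tensor_map R f C N h))"

end

theory Submission
  imports Defs
begin

text \<open>
  Let \<open>T = M \<otimes> N\<close>. By flatness, a sequence in \<open>I\<close> that is \<open>M\<close>-regular is \<open>T\<close>-regular. If it is
  maximal, some \<open>u \<noteq> 0\<close> in the quotient \<open>M / (xs) M\<close> is killed by \<open>I\<close>, and the elements \<open>u \<otimes> z\<close> form a
  copy of \<open>N / (0 : u) N\<close>, which is nonzero by Nakayama's lemma; so the image is maximal as well and
  the two grades always agree.

  Put \<open>d = dim N / \<mm> N\<close>. For primes \<open>p \<subset> p'\<close> of \<open>R\<close>, an element of \<open>p' - p\<close> is regular on \<open>N / p N\<close>,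
  so \<open>dim N / p N \<ge> 1 + dim N / p' N\<close>. Starting from a prime \<open>(0 : u)\<close>, this gives
  \<open>dim M + d \<le> dim T\<close>. If \<open>d = 0\<close>, a system of parameters of \<open>M\<close> generates an ideal of \<open>S\<close> that is
  primary on \<open>T\<close>, and Krull's height theorem yields \<open>dim T \<le> dim M\<close>. The same holds for \<open>M / I M\<close> and
  \<open>T / I T\<close>. Together with \<open>grade(I, M) + dim M / I M \<le> dim M\<close> and the finiteness of the dimensions, the
  equivalences are linear arithmetic.

  Dimensions and regular sequences are treated without quotients and localizations: statements about
  \<open>L / K\<close> are made relative to a submodule \<open>K\<close> of \<open>L\<close>, those about \<open>A / J\<close> use the primes containing \<open>J\<close>, and those about
  a localization at \<open>P\<close> use \<open>P\<close>-saturated submodules.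
\<close>

section \<open>Submodules and quotients\<close>

text \<open>The hypothesis \<open>flat_over\<close> speaks only about modules carried by
  \<open>(nat \<Rightarrow> 'a) set\<close>, while \<open>M\<close>, its quotients and the ideals of
  \<open>R\<close> have other types. Flatness is therefore turned once into a statement about
  vectors: extension to \<open>N\<close> commutes with preimages under a linear map. Everything else
  is pulled back to vectors along generators, and only three consequences are used, each saying that
  a colon commutes with base change: for \<open>(U : r)\<close> in \<open>M\<close>, for the
  annihilator of one element of \<open>M / U\<close>, and for \<open>(p : r)\<close> in
  \<open>R\<close>. The way back from (2) or (3) to (1) rests on
  \<open>dim M + d \<le> dim T\<close> and its analogue for \<open>M / I M\<close>: equality of
  dimensions in either pair forces \<open>d = 0\<close>, and then both pairs agree. This cancels
  summands of extended reals, so the dimensions must first be known to be finite and nonnegative.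
  The grade is a definite description, so maximal regular sequences must be shown to exist and to
  have equal length; the latter is done by exchanging elements, without homological algebra.\<close>

definition add_cyclic ::
    "('a, 'r) ring_scheme \<Rightarrow> ('a, 'l, 'k) module_scheme \<Rightarrow> 'l set \<Rightarrow> 'l \<Rightarrow> 'l set" where
  "add_cyclic A L K x = {y \<in> carrier L. \<exists>a\<in>carrier A. y \<ominus>\<^bsub>L\<^esub> a \<odot>\<^bsub>L\<^esub> x \<in> K}"

text \<open>This is \<open>K + a L\<close>. Membership is a congruence modulo \<open>K\<close>, so a
  single witness has to be unpacked.\<close>

definition add_mult :: "('a, 'l, 'k) module_scheme \<Rightarrow> 'l set \<Rightarrow> 'a \<Rightarrow> 'l set" where
  "add_mult L K a = {y \<in> carrier L. \<exists>z\<in>carrier L. y \<ominus>\<^bsub>L\<^esub> a \<odot>\<^bsub>L\<^esub> z \<in> K}"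

text \<open>The preimage in \<open>L\<close> of the localization of \<open>K\<close> at
  \<open>P\<close>. Submodules equal to their saturation stand for the submodules of the localized
  module.\<close>

definition saturation ::
    "('a, 'r) ring_scheme \<Rightarrow> ('a, 'l, 'k) module_scheme \<Rightarrow> 'a set \<Rightarrow> 'l set \<Rightarrow> 'l set" where
  "saturation A L P K = {x \<in> carrier L. \<exists>s\<in>carrier A - P. s \<odot>\<^bsub>L\<^esub> x \<in> K}"

definition colon ::
    "('a, 'r) ring_scheme \<Rightarrow> ('a, 'l, 'k) module_scheme \<Rightarrow> 'l set \<Rightarrow> 'l set \<Rightarrow> 'a set" where
  "colon A L K U = {a \<in> carrier A. \<forall>x\<in>U. a \<odot>\<^bsub>L\<^esub> x \<in> K}"

context module
begin

lemma module_self: "module R M" ..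

lemma sub_carr: "submodule K R M \<Longrightarrow> x \<in> K \<Longrightarrow> x \<in> carrier M"
  using submoduleE(1) by blast

lemma sub_zero: "submodule K R M \<Longrightarrow> \<zero>\<^bsub>M\<^esub> \<in> K"
  using subgroup.one_closed[of K "add_monoid M"] submodule.axioms(1) by fastforce

lemmas sub_minus = submoduleE(3) and sub_smult = submoduleE(4) and sub_add = submoduleE(5)

lemma sub_diff: "submodule K R M \<Longrightarrow> x \<in> K \<Longrightarrow> y \<in> K \<Longrightarrow> x \<ominus>\<^bsub>M\<^esub> y \<in> K"
  by (simp add: a_minus_def sub_add sub_minus)

lemma sub_add_cancel:
  assumes "submodule K R M" "x \<in> K" "y \<in> carrier M"
  shows "x \<oplus>\<^bsub>M\<^esub> y \<in> K \<longleftrightarrow> y \<in> K" "y \<oplus>\<^bsub>M\<^esub> x \<in> K \<longleftrightarrow> y \<in> K"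
proof -
  have x: "x \<in> carrier M" using assms sub_carr by blast
  show "x \<oplus>\<^bsub>M\<^esub> y \<in> K \<longleftrightarrow> y \<in> K"
  proof
    assume "x \<oplus>\<^bsub>M\<^esub> y \<in> K"
    then have "\<ominus>\<^bsub>M\<^esub> x \<oplus>\<^bsub>M\<^esub> (x \<oplus>\<^bsub>M\<^esub> y) \<in> K" using assms sub_add sub_minus by blast
    then show "y \<in> K" using x assms by (simp add: M.r_neg1)
  qed (use assms sub_add in blast)
  then show "y \<oplus>\<^bsub>M\<^esub> x \<in> K \<longleftrightarrow> y \<in> K" using x assms by (simp add: M.a_comm)
qed

lemma sub_diff_cancel:
  assumes "submodule K R M" "x \<in> carrier M" "y \<in> carrier M" "x \<ominus>\<^bsub>M\<^esub> y \<in> K"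
  shows "x \<in> K \<longleftrightarrow> y \<in> K"
proof -
  have "x = (x \<ominus>\<^bsub>M\<^esub> y) \<oplus>\<^bsub>M\<^esub> y" using assms(2,3) by (simp add: a_minus_def M.a_assoc M.l_neg)
  then show ?thesis using sub_add_cancel[OF assms(1,4,3)] by simp
qed

lemma smult_diff_distr:
  assumes "a \<in> carrier R" "x \<in> carrier M" "y \<in> carrier M"
  shows "a \<odot>\<^bsub>M\<^esub> (x \<ominus>\<^bsub>M\<^esub> y) = a \<odot>\<^bsub>M\<^esub> x \<ominus>\<^bsub>M\<^esub> a \<odot>\<^bsub>M\<^esub> y"
  using assms by (simp add: a_minus_def smult_r_distr smult_r_minus)

lemma smult_diff_distr_left:
  assumes "a \<in> carrier R" "b \<in> carrier R" "x \<in> carrier M"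
  shows "(a \<ominus> b) \<odot>\<^bsub>M\<^esub> x = a \<odot>\<^bsub>M\<^esub> x \<ominus>\<^bsub>M\<^esub> b \<odot>\<^bsub>M\<^esub> x"
  using assms by (simp add: a_minus_def smult_l_distr smult_l_minus)

lemma smult_commute:
  assumes "a \<in> carrier R" "b \<in> carrier R" "x \<in> carrier M"
  shows "a \<odot>\<^bsub>M\<^esub> (b \<odot>\<^bsub>M\<^esub> x) = b \<odot>\<^bsub>M\<^esub> (a \<odot>\<^bsub>M\<^esub> x)"
  using assms by (metis R.m_comm smult_assoc1)

lemma diff_zero [simp]: "x \<in> carrier M \<Longrightarrow> x \<ominus>\<^bsub>M\<^esub> \<zero>\<^bsub>M\<^esub> = x"
  by (metis M.minus_eq M.r_neg M.r_zero M.l_zero M.zero_closed M.a_inv_closed)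

lemma diff_self [simp]: "x \<in> carrier M \<Longrightarrow> x \<ominus>\<^bsub>M\<^esub> x = \<zero>\<^bsub>M\<^esub>"
  by (simp add: M.minus_eq M.r_neg)

lemma submodule_zero: "submodule {\<zero>\<^bsub>M\<^esub>} R M"
  by (rule submoduleI) auto

lemma submodule_Inter:
  assumes "C \<noteq> {}" "\<And>K. K \<in> C \<Longrightarrow> submodule K R M"
  shows "submodule (\<Inter>C) R M"
proof (rule submoduleI)
  show "\<Inter>C \<subseteq> carrier M" using assms sub_carr by fastforce
qed (simp_all add: assms sub_zero sub_minus sub_add sub_smult)

lemma submodule_Int: "submodule K R M \<Longrightarrow> submodule U R M \<Longrightarrow> submodule (K \<inter> U) R M"
  using submodule_Inter[of "{K, U}"] by auto

lemma submodule_span_submodule: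
  "Y \<subseteq> carrier M \<Longrightarrow> submodule (submodule_span R M Y) R M"
  unfolding submodule_span_def using carrier_is_submodule by (intro submodule_Inter) auto

lemma submodule_span_minimal: "submodule K R M \<Longrightarrow> Y \<subseteq> K \<Longrightarrow> submodule_span R M Y \<subseteq> K"
  unfolding submodule_span_def by auto

lemma submodule_span_superset: "Y \<subseteq> submodule_span R M Y"
  unfolding submodule_span_def by auto

lemma submodule_add_image:
  assumes K: "submodule K R M" and U: "submodule U R M"
  shows "submodule {y \<in> carrier M. \<exists>u\<in>U. y \<ominus>\<^bsub>M\<^esub> u \<in> K} R M" (is "submodule ?V R M")
proof (rule submoduleI)
  show "\<zero>\<^bsub>M\<^esub> \<in> ?V" using sub_zero[OF K] sub_zero[OF U] by (auto intro!: bexI[of _ "\<zero>\<^bsub>M\<^esub>"])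
next
  fix y assume "y \<in> ?V"
  then obtain u where u: "y \<in> carrier M" "u \<in> U" "y \<ominus>\<^bsub>M\<^esub> u \<in> K" by auto
  have "\<ominus>\<^bsub>M\<^esub> (y \<ominus>\<^bsub>M\<^esub> u) \<in> K" using u K sub_minus by blast
  moreover have "\<ominus>\<^bsub>M\<^esub> (y \<ominus>\<^bsub>M\<^esub> u) = \<ominus>\<^bsub>M\<^esub> y \<ominus>\<^bsub>M\<^esub> \<ominus>\<^bsub>M\<^esub> u"
    using u sub_carr[OF U] by (simp add: a_minus_def M.minus_add M.a_comm)
  ultimately show "\<ominus>\<^bsub>M\<^esub> y \<in> ?V" using u U sub_minus by auto
next
  fix y z assume "y \<in> ?V" "z \<in> ?V"
  then obtain u v where u: "y \<in> carrier M" "u \<in> U" "y \<ominus>\<^bsub>M\<^esub> u \<in> K" "z \<in> carrier M" "v \<in> U" "z \<ominus>\<^bsub>M\<^esub> v \<in> K" by auto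
  have "(y \<ominus>\<^bsub>M\<^esub> u) \<oplus>\<^bsub>M\<^esub> (z \<ominus>\<^bsub>M\<^esub> v) \<in> K" using u K sub_add by blast
  moreover have "(y \<ominus>\<^bsub>M\<^esub> u) \<oplus>\<^bsub>M\<^esub> (z \<ominus>\<^bsub>M\<^esub> v) = (y \<oplus>\<^bsub>M\<^esub> z) \<ominus>\<^bsub>M\<^esub> (u \<oplus>\<^bsub>M\<^esub> v)"
    using u sub_carr[OF U] by (simp add: a_minus_def M.minus_add M.a_ac)
  ultimately show "y \<oplus>\<^bsub>M\<^esub> z \<in> ?V" using u U sub_add by auto
next
  fix a y assume "a \<in> carrier R" "y \<in> ?V"
  then obtain u where u: "a \<in> carrier R" "y \<in> carrier M" "u \<in> U" "y \<ominus>\<^bsub>M\<^esub> u \<in> K" by auto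
  have "a \<odot>\<^bsub>M\<^esub> (y \<ominus>\<^bsub>M\<^esub> u) \<in> K" using u K sub_smult by blast
  then have "a \<odot>\<^bsub>M\<^esub> y \<ominus>\<^bsub>M\<^esub> a \<odot>\<^bsub>M\<^esub> u \<in> K" using u sub_carr[OF U] by (simp add: smult_diff_distr)
  then show "a \<odot>\<^bsub>M\<^esub> y \<in> ?V" using u U sub_smult by auto
qed auto

lemma submodule_cyclic:
  assumes "x \<in> carrier M" shows "submodule ((\<lambda>a. a \<odot>\<^bsub>M\<^esub> x) ` carrier R) R M"
proof (rule submoduleI)
  show "\<zero>\<^bsub>M\<^esub> \<in> (\<lambda>a. a \<odot>\<^bsub>M\<^esub> x) ` carrier R"
    using assms by (auto intro!: image_eqI[of _ _ \<zero>])
next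
  fix y assume "y \<in> (\<lambda>a. a \<odot>\<^bsub>M\<^esub> x) ` carrier R"
  then show "\<ominus>\<^bsub>M\<^esub> y \<in> (\<lambda>a. a \<odot>\<^bsub>M\<^esub> x) ` carrier R"
    using assms by (auto simp: smult_l_minus[symmetric])
qed (use assms in \<open>auto simp: smult_l_distr[symmetric] smult_assoc1[symmetric]\<close>)

lemma submodule_mult:
  assumes "a \<in> carrier R" shows "submodule ((\<lambda>x. a \<odot>\<^bsub>M\<^esub> x) ` carrier M) R M"
proof (rule submoduleI)
  show "\<zero>\<^bsub>M\<^esub> \<in> (\<lambda>x. a \<odot>\<^bsub>M\<^esub> x) ` carrier M"
    using assms by (auto intro!: image_eqI[of _ _ "\<zero>\<^bsub>M\<^esub>"])
next
  fix y assume "y \<in> (\<lambda>x. a \<odot>\<^bsub>M\<^esub> x) ` carrier M"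
  then show "\<ominus>\<^bsub>M\<^esub> y \<in> (\<lambda>x. a \<odot>\<^bsub>M\<^esub> x) ` carrier M"
    using assms by (auto simp: smult_r_minus[symmetric])
qed (use assms in \<open>auto simp: smult_r_distr[symmetric] smult_commute[of _ a]\<close>)

lemma submodule_add_cyclic:
  assumes "submodule K R M" "x \<in> carrier M"
  shows "submodule (add_cyclic R M K x) R M"
  using submodule_add_image[OF assms(1) submodule_cyclic[OF assms(2)]] by (simp add: add_cyclic_def)

lemma submodule_add_mult:
  assumes "submodule K R M" "a \<in> carrier R"
  shows "submodule (add_mult M K a) R M"
  using submodule_add_image[OF assms(1) submodule_mult[OF assms(2)]] by (simp add: add_mult_def)

lemma add_cyclic_superset:
  assumes K: "submodule K R M" and x: "x \<in> carrier M"
  shows "K \<subseteq> add_cyclic R M K x"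
  using assms sub_carr[OF K]
  by (auto simp: add_cyclic_def intro!: bexI[of _ \<zero>])

lemma add_cyclic_self:
  assumes K: "submodule K R M" and x: "x \<in> carrier M"
  shows "x \<in> add_cyclic R M K x"
  using assms sub_zero[OF K]
  by (auto simp: add_cyclic_def intro!: bexI[of _ \<one>])

lemma add_cyclic_minimal:
  assumes "submodule U R M" "K \<subseteq> U" "x \<in> U"
  shows "add_cyclic R M K x \<subseteq> U"
proof
  fix y assume "y \<in> add_cyclic R M K x"
  then obtain a where a: "y \<in> carrier M" "a \<in> carrier R" "y \<ominus>\<^bsub>M\<^esub> a \<odot>\<^bsub>M\<^esub> x \<in> K" by (auto simp: add_cyclic_def)
  then show "y \<in> U" using assms sub_diff_cancel[OF assms(1), of y "a \<odot>\<^bsub>M\<^esub> x"] sub_smult sub_carr by blast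
qed

lemma add_mult_superset:
  assumes K: "submodule K R M" and "a \<in> carrier R"
  shows "K \<subseteq> add_mult M K a"
  using assms sub_carr[OF K]
  by (auto simp: add_mult_def intro!: bexI[of _ "\<zero>\<^bsub>M\<^esub>"])

lemma add_mult_self:
  assumes K: "submodule K R M" and "a \<in> carrier R" and x: "x \<in> carrier M"
  shows "a \<odot>\<^bsub>M\<^esub> x \<in> add_mult M K a"
  using assms sub_zero[OF K]
  by (auto simp: add_mult_def intro!: bexI[of _ x])

lemma add_mult_minimal:
  assumes "submodule U R M" "K \<subseteq> U" "\<And>x. x \<in> carrier M \<Longrightarrow> a \<odot>\<^bsub>M\<^esub> x \<in> U"
  shows "add_mult M K a \<subseteq> U"
proof
  fix y assume "y \<in> add_mult M K a"
  then obtain z where a: "y \<in> carrier M" "z \<in> carrier M" "y \<ominus>\<^bsub>M\<^esub> a \<odot>\<^bsub>M\<^esub> z \<in> K" by (auto simp: add_mult_def)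
  then show "y \<in> U" using assms sub_diff_cancel[OF assms(1), of y "a \<odot>\<^bsub>M\<^esub> z"] sub_smult sub_carr by blast
qed

lemma add_mult_mono: "K \<subseteq> U \<Longrightarrow> add_mult M K a \<subseteq> add_mult M U a"
  by (auto simp: add_mult_def)

text \<open>Both sides are \<open>K + a M + b M\<close>. This is what allows an entry of a sequence
  to be moved to its front.\<close>

lemma add_mult_commute:
  assumes "submodule K R M" "a \<in> carrier R" "b \<in> carrier R"
  shows "add_mult M (add_mult M K a) b = add_mult M (add_mult M K b) a"
proof -
  have "add_mult M (add_mult M K a) b \<subseteq> add_mult M (add_mult M K b) a"
    if ab: "a \<in> carrier R" "b \<in> carrier R" for a b
  proof -
    note s = submodule_add_mult[OF assms(1)]
    show ?thesis
    proof (rule add_mult_minimal[OF submodule_add_mult[OF s[OF ab(2)] ab(1)]])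
      show "add_mult M K a \<subseteq> add_mult M (add_mult M K b) a"
        using add_mult_superset[OF assms(1) ab(2)] by (rule add_mult_mono)
      show "b \<odot>\<^bsub>M\<^esub> x \<in> add_mult M (add_mult M K b) a" if "x \<in> carrier M" for x
        using add_mult_superset[OF s[OF ab(2)] ab(1)] add_mult_self[OF assms(1) ab(2) that] by blast
    qed
  qed
  then show ?thesis using assms by blast
qed

lemma submodule_saturation:
  assumes P: "primeideal P R" and K: "submodule K R M"
  shows "submodule (saturation R M P K) R M"
proof (rule submoduleI)
  interpret P: primeideal P R by fact
  have one: "\<one> \<notin> P" using P.I_notcarr P.one_imp_carrier by blast
  have mult: "s \<otimes> t \<in> carrier R - P" if "s \<in> carrier R - P" "t \<in> carrier R - P" for s t
    using that P.I_prime[of s t] by auto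
  show "\<zero>\<^bsub>M\<^esub> \<in> saturation R M P K" using one sub_zero[OF K] by (auto simp: saturation_def intro!: bexI[of _ \<one>])
  fix x assume "x \<in> saturation R M P K"
  then obtain s where s: "x \<in> carrier M" "s \<in> carrier R - P" "s \<odot>\<^bsub>M\<^esub> x \<in> K" by (auto simp: saturation_def)
  then show "\<ominus>\<^bsub>M\<^esub> x \<in> saturation R M P K"
    using sub_minus[OF K s(3)] by (auto simp: saturation_def smult_r_minus[symmetric] intro!: bexI[of _ s])
  { fix a assume a: "a \<in> carrier R"
    have "s \<odot>\<^bsub>M\<^esub> (a \<odot>\<^bsub>M\<^esub> x) \<in> K" using s a sub_smult[OF K a s(3)] smult_commute[of s a x] by auto
    then show "a \<odot>\<^bsub>M\<^esub> x \<in> saturation R M P K" using s a by (auto simp: saturation_def) }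
  fix y assume "y \<in> saturation R M P K"
  then obtain t where t: "y \<in> carrier M" "t \<in> carrier R - P" "t \<odot>\<^bsub>M\<^esub> y \<in> K" by (auto simp: saturation_def)
  \<comment> \<open>A common denominator: \<open>s\<close> works for \<open>x\<close>,
    \<open>t\<close> for \<open>y\<close>, and the product stays outside the prime
    \<open>P\<close>.\<close>
  have "(s \<otimes> t) \<odot>\<^bsub>M\<^esub> (x \<oplus>\<^bsub>M\<^esub> y) = t \<odot>\<^bsub>M\<^esub> (s \<odot>\<^bsub>M\<^esub> x) \<oplus>\<^bsub>M\<^esub> s \<odot>\<^bsub>M\<^esub> (t \<odot>\<^bsub>M\<^esub> y)"
    using s t by (simp add: smult_r_distr smult_assoc1 smult_commute[of s t x])
  moreover have "\<dots> \<in> K" using s t by (intro sub_add[OF K]) (auto intro!: sub_smult[OF K, of t "s \<odot>\<^bsub>M\<^esub> x"] sub_smult[OF K, of s "t \<odot>\<^bsub>M\<^esub> y"])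
  ultimately show "x \<oplus>\<^bsub>M\<^esub> y \<in> saturation R M P K" using s t mult[of s t] by (auto simp: saturation_def intro!: bexI[of _ "s \<otimes> t"])
qed (auto simp: saturation_def)

lemma saturation_superset:
  assumes P: "primeideal P R" and K: "submodule K R M"
  shows "K \<subseteq> saturation R M P K"
proof -
  interpret P: primeideal P R by fact
  have "\<one> \<notin> P" using P.I_notcarr P.one_imp_carrier by blast
  then show ?thesis using sub_carr[OF K] by (auto simp: saturation_def intro!: bexI[of _ \<one>])
qed

lemma saturation_mono: "K \<subseteq> U \<Longrightarrow> saturation R M P K \<subseteq> saturation R M P U"
  by (auto simp: saturation_def)

lemma saturation_idem:
  assumes P: "primeideal P R"
  shows "saturation R M P (saturation R M P K) \<subseteq> saturation R M P K"
proof
  interpret P: primeideal P R by fact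
  fix x assume "x \<in> saturation R M P (saturation R M P K)"
  then obtain s t where s: "x \<in> carrier M" "s \<in> carrier R - P" "t \<in> carrier R - P" "t \<odot>\<^bsub>M\<^esub> (s \<odot>\<^bsub>M\<^esub> x) \<in> K"
    by (auto simp: saturation_def)
  then show "x \<in> saturation R M P K"
    using P.I_prime[of t s] by (auto simp: saturation_def smult_assoc1[symmetric] intro!: bexI[of _ "t \<otimes> s"])
qed

lemma ideal_colon:
  assumes K: "submodule K R M" and U: "U \<subseteq> carrier M"
  shows "ideal (colon R M K U) R"
proof (rule idealI)
  show "subgroup (colon R M K U) (add_monoid R)"
    using U sub_zero[OF K] sub_minus[OF K] sub_add[OF K]
    by (intro R.add.subgroupI)
       (auto simp: colon_def smult_l_distr smult_l_minus subset_iff a_inv_def[symmetric] intro!: exI[of _ \<zero>])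
next
  fix a x assume "a \<in> colon R M K U" "x \<in> carrier R"
  then show "x \<otimes> a \<in> colon R M K U" "a \<otimes> x \<in> colon R M K U"
    using U sub_smult[OF K, of x] by (auto simp: colon_def smult_assoc1 subset_iff R.m_comm[of a x])
qed (rule R.ring_axioms)

section \<open>Quotient modules\<close>

lemma abelian_subgroup_submodule: "submodule K R M \<Longrightarrow> abelian_subgroup K M"
  by (intro abelian_subgroupI3 additive_subgroup.intro submodule.axioms(1)) (auto intro: M.abelian_group_axioms)

lemma coset_eq_iff:
  assumes K: "submodule K R M" and "x \<in> carrier M" "y \<in> carrier M"
  shows "K +>\<^bsub>M\<^esub> x = K +>\<^bsub>M\<^esub> y \<longleftrightarrow> x \<ominus>\<^bsub>M\<^esub> y \<in> K"
proof -
  interpret K: abelian_subgroup K M using K by (rule abelian_subgroup_submodule)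
  show ?thesis
    using K.a_rcos_module[OF assms(3,2)] K.a_repr_independence'[OF _ assms(3), of x] K.a_rcos_self[OF assms(2)]
    by (auto simp: M.minus_eq)
qed

lemma coset_eq_zero_iff:
  assumes K: "submodule K R M" and "x \<in> carrier M"
  shows "K +>\<^bsub>M\<^esub> x = K \<longleftrightarrow> x \<in> K"
proof -
  interpret K: abelian_subgroup K M using K by (rule abelian_subgroup_submodule)
  have "K +>\<^bsub>M\<^esub> \<zero>\<^bsub>M\<^esub> = K" using sub_zero[OF K] K.a_rcos_const by blast
  then show ?thesis using coset_eq_iff[OF assms M.zero_closed] assms(2) by simp
qed

lemma quot_carrier: "carrier (quot_module M K) = (\<lambda>x. K +>\<^bsub>M\<^esub> x) ` carrier M"
  by (auto simp: quot_module_def A_RCOSETS_def')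

lemma quot_zero: "\<zero>\<^bsub>quot_module M K\<^esub> = K"
  by (simp add: quot_module_def)

lemma quot_add:
  assumes K: "submodule K R M" and "x \<in> carrier M" "y \<in> carrier M"
  shows "(K +>\<^bsub>M\<^esub> x) \<oplus>\<^bsub>quot_module M K\<^esub> (K +>\<^bsub>M\<^esub> y) = K +>\<^bsub>M\<^esub> (x \<oplus>\<^bsub>M\<^esub> y)"
proof -
  interpret K: abelian_subgroup K M using K by (rule abelian_subgroup_submodule)
  show ?thesis using assms K.a_rcos_sum by (simp add: quot_module_def)
qed

lemma quot_smult:
  assumes K: "submodule K R M" and a: "a \<in> carrier R" and x: "x \<in> carrier M"
  shows "a \<odot>\<^bsub>quot_module M K\<^esub> (K +>\<^bsub>M\<^esub> x) = K +>\<^bsub>M\<^esub> (a \<odot>\<^bsub>M\<^esub> x)"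
proof -
  interpret K: abelian_subgroup K M using K by (rule abelian_subgroup_submodule)
  have "K +>\<^bsub>M\<^esub> (a \<odot>\<^bsub>M\<^esub> y) = K +>\<^bsub>M\<^esub> (a \<odot>\<^bsub>M\<^esub> x)" if y: "y \<in> K +>\<^bsub>M\<^esub> x" for y
  proof -
    have yc: "y \<in> carrier M" using K.a_elemrcos_carrier x y by blast
    have "y \<ominus>\<^bsub>M\<^esub> x \<in> K" using K.a_rcos_module[OF x yc] y by (simp add: M.minus_eq)
    then show ?thesis using sub_smult[OF K a] a x yc by (auto simp: coset_eq_iff[OF K] smult_diff_distr[symmetric])
  qed
  moreover have "x \<in> K +>\<^bsub>M\<^esub> x" using K.a_rcos_self x by blast
  ultimately have "(\<Union>y\<in>K +>\<^bsub>M\<^esub> x. K +>\<^bsub>M\<^esub> (a \<odot>\<^bsub>M\<^esub> y)) = K +>\<^bsub>M\<^esub> (a \<odot>\<^bsub>M\<^esub> x)" by blast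
  then show ?thesis by (simp add: quot_module_def)
qed

lemma module_quot:
  assumes K: "submodule K R M" shows "module R (quot_module M K)"
proof (rule moduleI)
  note simps = quot_carrier quot_zero quot_add[OF K] quot_smult[OF K]
  have z: "\<zero>\<^bsub>quot_module M K\<^esub> = K +>\<^bsub>M\<^esub> \<zero>\<^bsub>M\<^esub>"
    using coset_eq_zero_iff[OF K, of "\<zero>\<^bsub>M\<^esub>"] sub_zero[OF K] by (simp add: quot_zero)
  show "abelian_group (quot_module M K)"
  proof (rule abelian_groupI)
    fix Y assume "Y \<in> carrier (quot_module M K)"
    then obtain x where x: "x \<in> carrier M" "Y = K +>\<^bsub>M\<^esub> x" by (auto simp: simps)
    then show "\<exists>Z\<in>carrier (quot_module M K). Z \<oplus>\<^bsub>quot_module M K\<^esub> Y = \<zero>\<^bsub>quot_module M K\<^esub>"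
      unfolding z by (intro bexI[of _ "K +>\<^bsub>M\<^esub> (\<ominus>\<^bsub>M\<^esub> x)"]) (auto simp: simps M.l_neg)
  qed (unfold z, auto simp: simps M.a_ac)
qed (use R.is_cring in \<open>auto simp: quot_carrier quot_add[OF K] quot_smult[OF K] smult_r_distr smult_l_distr smult_assoc1\<close>)

lemma annihilator_eq: "annihilator R M = colon R M {\<zero>\<^bsub>M\<^esub>} (carrier M)"
  by (auto simp: annihilator_def colon_def)

lemma annihilator_quot:
  assumes K: "submodule K R M"
  shows "annihilator R (quot_module M K) = colon R M K (carrier M)"
  unfolding annihilator_def colon_def quot_carrier quot_zero
  by (simp add: quot_smult[OF K] coset_eq_zero_iff[OF K] cong: conj_cong)

text \<open>Reads nonzero-divisors on \<open>M / K\<close> on representatives in \<open>M\<close>;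
  through \<open>regular_seq_iff\<close> it frees the study of regular sequences from quotient
  modules.\<close>

lemma quot_regular_iff:
  assumes K: "submodule K R M" and a: "a \<in> carrier R"
  shows "(\<forall>y\<in>carrier (quot_module M K). a \<odot>\<^bsub>quot_module M K\<^esub> y = \<zero>\<^bsub>quot_module M K\<^esub> \<longrightarrow> y = \<zero>\<^bsub>quot_module M K\<^esub>)
    \<longleftrightarrow> (\<forall>x\<in>carrier M. a \<odot>\<^bsub>M\<^esub> x \<in> K \<longrightarrow> x \<in> K)"
proof -
  have "(a \<odot>\<^bsub>quot_module M K\<^esub> (K +>\<^bsub>M\<^esub> x) = K \<longrightarrow> K +>\<^bsub>M\<^esub> x = K) \<longleftrightarrow> (a \<odot>\<^bsub>M\<^esub> x \<in> K \<longrightarrow> x \<in> K)"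
    if "x \<in> carrier M" for x
    unfolding quot_smult[OF K a that] coset_eq_zero_iff[OF K that] coset_eq_zero_iff[OF K smult_closed[OF a that]] ..
  then show ?thesis unfolding quot_carrier quot_zero ball_simps(9) by (intro ball_cong refl)
qed

section \<open>The submodule J M\<close>

lemma set_smult_submodule: "J \<subseteq> carrier R \<Longrightarrow> submodule (set_smult R J M) R M"
  unfolding set_smult_def by (rule submodule_span_submodule) auto

lemma set_smult_mem: "a \<in> J \<Longrightarrow> x \<in> carrier M \<Longrightarrow> a \<odot>\<^bsub>M\<^esub> x \<in> set_smult R J M"
  unfolding set_smult_def by (rule subsetD[OF submodule_span_superset]) auto

lemma set_smult_minimal:
  assumes "submodule K R M" "\<And>a x. a \<in> J \<Longrightarrow> x \<in> carrier M \<Longrightarrow> a \<odot>\<^bsub>M\<^esub> x \<in> K"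
  shows "set_smult R J M \<subseteq> K"
  unfolding set_smult_def using assms by (intro submodule_span_minimal) auto

lemma set_smult_mono: "J \<subseteq> J' \<Longrightarrow> J' \<subseteq> carrier R \<Longrightarrow> set_smult R J M \<subseteq> set_smult R J' M"
  by (intro set_smult_minimal set_smult_submodule set_smult_mem) auto

lemma set_smult_empty: "set_smult R {} M = {\<zero>\<^bsub>M\<^esub>}"
  using set_smult_minimal[OF submodule_zero, of "{}"] sub_zero[OF set_smult_submodule[of "{}"]] by auto

lemma set_smult_insert:
  assumes "J \<subseteq> carrier R" "a \<in> carrier R"
  shows "set_smult R (insert a J) M = add_mult M (set_smult R J M) a"
proof
  note J = set_smult_submodule[OF assms(1)]
  show "set_smult R (insert a J) M \<subseteq> add_mult M (set_smult R J M) a"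
    using add_mult_superset[OF J assms(2)] add_mult_self[OF J assms(2)] set_smult_mem
    by (intro set_smult_minimal submodule_add_mult J assms) blast
  show "add_mult M (set_smult R J M) a \<subseteq> set_smult R (insert a J) M"
    using assms by (intro add_mult_minimal set_smult_submodule set_smult_mono) (auto intro: set_smult_mem)
qed

text \<open>Replaces the span over an unordered set by successive additions of \<open>x M\<close>,
  the form suited to induction along a sequence.\<close>

lemma set_smult_list:
  "set xs \<subseteq> carrier R \<Longrightarrow> set_smult R (set xs) M = foldl (add_mult M) {\<zero>\<^bsub>M\<^esub>} xs"
  by (induction xs rule: rev_induct) (auto simp: set_smult_empty set_smult_insert)

text \<open>The ring elements that carry \<open>M\<close> into \<open>J M\<close> form an ideal
  containing \<open>J\<close>, hence also the ideal generated by \<open>J\<close>.\<close>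

lemma set_smult_genideal:
  assumes J: "J \<subseteq> carrier R"
  shows "set_smult R (Idl J) M = set_smult R J M"
proof
  note S = set_smult_submodule[OF J]
  have "ideal (colon R M (set_smult R J M) (carrier M)) R" using ideal_colon[OF S] by blast
  moreover have "J \<subseteq> colon R M (set_smult R J M) (carrier M)" using J set_smult_mem by (auto simp: colon_def)
  ultimately have "Idl J \<subseteq> colon R M (set_smult R J M) (carrier M)" by (rule R.genideal_minimal)
  then show "set_smult R (Idl J) M \<subseteq> set_smult R J M"
    by (intro set_smult_minimal S) (auto simp: colon_def)
  show "set_smult R J M \<subseteq> set_smult R (Idl J) M"
    using R.genideal_self[OF J] R.genideal_ideal[OF J] by (intro set_smult_mono) (auto dest: ideal.Icarr)
qed

end

section \<open>Ideals and chains of primes\<close>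

text \<open>Ideals become the submodules of this module, so sums, saturations and maximality
  arguments are proved once for both.\<close>

definition ring_module :: "('a, 'r) ring_scheme \<Rightarrow> ('a, 'a) module" where
  "ring_module A = \<lparr>carrier = carrier A, monoid.mult = undefined, one = undefined,
     ring.zero = \<zero>\<^bsub>A\<^esub>, add = (\<oplus>\<^bsub>A\<^esub>), smult = (\<otimes>\<^bsub>A\<^esub>)\<rparr>"

abbreviation ideal_plus :: "('a, 'r) ring_scheme \<Rightarrow> 'a set \<Rightarrow> 'a \<Rightarrow> 'a set" where
  "ideal_plus A J x \<equiv> add_cyclic A (ring_module A) J x"

definition prime_chains :: "('a, 'r) ring_scheme \<Rightarrow> 'a set \<Rightarrow> 'a set list set" where
  "prime_chains A J = {ps. ps \<noteq> [] \<and> (\<forall>P\<in>set ps. primeideal P A \<and> J \<subseteq> P) \<and> sorted_wrt (\<subset>) ps}"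

text \<open>If no prime contains \<open>J\<close>, the supremum is over the empty set and equals
  \<open>- \<infinity>\<close>, in agreement with \<open>krull_dim\<close> of the zero ring.\<close>

definition dim_over :: "('a, 'r) ring_scheme \<Rightarrow> 'a set \<Rightarrow> ereal" where
  "dim_over A J = (SUP ps\<in>prime_chains A J. ereal (real (length ps - 1)))"

lemma dim_over_antimono: "J \<subseteq> J' \<Longrightarrow> dim_over A J' \<le> dim_over A J"
  unfolding dim_over_def by (rule SUP_subset_mono) (auto simp: prime_chains_def)

lemma dim_over_upper: "ps \<in> prime_chains A J \<Longrightarrow> ereal (real (length ps - 1)) \<le> dim_over A J"
  unfolding dim_over_def by (rule SUP_upper)

lemma sorted_psubset_Cons:
  fixes ps :: "'a set list"
  assumes "ps \<noteq> []" shows "sorted_wrt (\<subset>) (Q # ps) \<longleftrightarrow> Q \<subset> hd ps \<and> sorted_wrt (\<subset>) ps"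
proof -
  have "transp ((\<subset>) :: 'a set \<Rightarrow> 'a set \<Rightarrow> bool)" by (auto intro!: transpI)
  then show ?thesis using assms by (cases ps) (auto simp: sorted_wrt2_simps transp_def)
qed

lemma prime_chains_Cons:
  assumes "ps \<in> prime_chains A J'" "J \<subseteq> J'" "primeideal Q A" "J \<subseteq> Q" "Q \<subset> hd ps"
  shows "Q # ps \<in> prime_chains A J"
proof -
  have ps: "ps \<noteq> []" "sorted_wrt (\<subset>) ps" "\<And>P. P \<in> set ps \<Longrightarrow> primeideal P A" "\<And>P. P \<in> set ps \<Longrightarrow> J' \<subseteq> P"
    using assms(1) unfolding prime_chains_def by auto
  have "sorted_wrt (\<subset>) (Q # ps)" using sorted_psubset_Cons[OF ps(1)] ps(2) assms(5) by blast
  moreover have "\<And>P. P \<in> set ps \<Longrightarrow> J \<subseteq> P" using ps(4) assms(2) by (rule order_trans[rotated])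
  ultimately show ?thesis using ps(3) assms(3,4) unfolding prime_chains_def by (simp del: sorted_wrt.simps)
qed

lemma primeideal_one: "primeideal P A \<Longrightarrow> \<one>\<^bsub>A\<^esub> \<notin> P"
  using primeideal.I_notcarr ideal.one_imp_carrier primeideal.axioms(1) by metis

lemma primeideal_carr: "primeideal P A \<Longrightarrow> x \<in> P \<Longrightarrow> x \<in> carrier A"
  using ideal.Icarr primeideal.axioms(1) by metis

context cring
begin

lemma ring_module_simps [simp]:
  "carrier (ring_module R) = carrier R" "\<zero>\<^bsub>ring_module R\<^esub> = \<zero>" "(\<oplus>\<^bsub>ring_module R\<^esub>) = (\<oplus>)"
  "(\<odot>\<^bsub>ring_module R\<^esub>) = (\<otimes>)" "a_inv (ring_module R) = a_inv R"
  "a_minus (ring_module R) = a_minus R"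
  by (auto simp: ring_module_def a_inv_def a_minus_def m_inv_def fun_eq_iff)

lemma module_ring_module: "module R (ring_module R)"
proof (rule moduleI)
  show "abelian_group (ring_module R)"
    by (rule abelian_groupI) (auto simp: a_ac intro!: bexI[of _ "\<ominus> _"] l_neg)
qed (auto simp: is_cring l_distr r_distr m_assoc)

sublocale self: module R "ring_module R"
  by (rule module_ring_module)

lemma submodule_iff_ideal: "submodule J R (ring_module R) \<longleftrightarrow> ideal J R"
proof
  assume J: "submodule J R (ring_module R)"
  show "ideal J R"
  proof (rule idealI)
    show "subgroup J (add_monoid R)"
      using self.sub_carr[OF J] self.sub_zero[OF J] self.sub_add[OF J] self.sub_minus[OF J]
      by (intro add.subgroupI) (auto simp: a_inv_def[symmetric])
    fix a x assume "a \<in> J" "x \<in> carrier R"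
    then show "x \<otimes> a \<in> J" "a \<otimes> x \<in> J"
      using self.sub_smult[OF J, of x a] self.sub_carr[OF J, of a] by (auto simp: m_comm[of a x])
  qed (rule ring_axioms)
next
  assume "ideal J R"
  then interpret ideal J R .
  show "submodule J R (ring_module R)"
    by (rule self.submoduleI) (use a_subset zero_closed I_l_closed in auto)
qed

lemma ideal_plus_iff: "y \<in> ideal_plus R J x \<longleftrightarrow> y \<in> carrier R \<and> (\<exists>a\<in>carrier R. y \<ominus> a \<otimes> x \<in> J)"
  by (simp add: add_cyclic_def)

lemmas ideal_plus_ideal = self.submodule_add_cyclic[unfolded submodule_iff_ideal, simplified]
  and ideal_plus_superset = self.add_cyclic_superset[unfolded submodule_iff_ideal, simplified]
  and ideal_plus_self = self.add_cyclic_self[unfolded submodule_iff_ideal, simplified]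
  and ideal_plus_minimal = self.add_cyclic_minimal[unfolded submodule_iff_ideal, simplified]
  and ideal_diff_cancel = self.sub_diff_cancel[unfolded submodule_iff_ideal, simplified]
  and ideal_add_cancel = self.sub_add_cancel[unfolded submodule_iff_ideal, simplified]

lemma prime_mult_not_in:
  "primeideal P R \<Longrightarrow> a \<in> carrier R - P \<Longrightarrow> b \<in> carrier R - P \<Longrightarrow> a \<otimes> b \<in> carrier R - P"
  using primeideal.I_prime by fastforce

section \<open>Primes of a quotient ring\<close>

lemma primeideal_image_quot:
  assumes J: "ideal J R" and P: "primeideal P R" and sub: "J \<subseteq> P"
  shows "primeideal ((+>) J ` P) (R Quot J)" "\<Union>((+>) J ` P) = P"
proof -
  interpret J: ideal J R by fact
  interpret P: primeideal P R by fact
  show U: "\<Union>((+>) J ` P) = P" using ideal_incl_iff[OF J P.is_ideal] sub by simp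
  have I: "ideal ((+>) J ` P) (R Quot J)" using ring_ideal_imp_quot_ideal[OF J P.is_ideal] .
  have car: "(+>) J ` P \<subseteq> carrier (R Quot J)" using I by (simp add: additive_subgroup.a_subset ideal.axioms(1))
  note mem = canonical_proj_vimage_mem_iff[OF J car, unfolded U, symmetric]
  show "primeideal ((+>) J ` P) (R Quot J)"
  proof (rule primeidealI)
    show "carrier (R Quot J) \<noteq> (+>) J ` P"
    proof
      assume "carrier (R Quot J) = (+>) J ` P"
      then have "J +> \<one> \<in> (+>) J ` P" by (metis one_closed J.rcos_ring_hom ring_hom_closed)
      then show False using mem P.I_notcarr P.one_imp_carrier by auto
    qed
    fix a b assume ab: "a \<in> carrier (R Quot J)" "b \<in> carrier (R Quot J)" "a \<otimes>\<^bsub>R Quot J\<^esub> b \<in> (+>) J ` P"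
    then obtain x y where x: "x \<in> carrier R" "a = J +> x" "y \<in> carrier R" "b = J +> y"
      by (auto simp: FactRing_def A_RCOSETS_def')
    then have "J +> (x \<otimes> y) \<in> (+>) J ` P" using ab by (simp add: FactRing_def J.rcoset_mult_add)
    then show "a \<in> (+>) J ` P \<or> b \<in> (+>) J ` P" using mem x P.I_prime by auto
  qed (use I J.quotient_is_cring is_cring in auto)
qed

text \<open>Elements of the quotient ring are cosets, so the union of \<open>Q\<close> is its
  preimage in \<open>R\<close>.\<close>

lemma primeideal_Union_quot:
  assumes J: "ideal J R" and Q: "primeideal Q (R Quot J)"
  shows "primeideal (\<Union>Q) R" "J \<subseteq> \<Union>Q" "(+>) J ` (\<Union>Q) = Q"
proof -
  interpret J: ideal J R by fact
  interpret Q: primeideal Q "R Quot J" by fact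
  have car: "Q \<subseteq> carrier (R Quot J)" by (rule Q.a_subset)
  note mem = canonical_proj_vimage_mem_iff[OF J car]
  have inc: "J +> x \<in> carrier (R Quot J)" if "x \<in> carrier R" for x
    using that by (metis J.rcos_ring_hom ring_hom_closed)
  have "bij_betw (\<lambda>J'. (+>) J ` J') { J'. ideal J' R \<and> J \<subseteq> J' } { J' . ideal J' (R Quot J) }"
    by (rule quot_ideal_correspondence[OF J])
  then have "Q \<in> (\<lambda>J'. (+>) J ` J') ` { J'. ideal J' R \<and> J \<subseteq> J' }"
    using Q.is_ideal by (simp add: bij_betw_imp_surj_on)
  then obtain P where P: "ideal P R" "J \<subseteq> P" "(+>) J ` P = Q"
    by auto
  have U: "\<Union>Q = P" using ideal_incl_iff[OF J P(1)] P by auto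
  show "J \<subseteq> \<Union>Q" "(+>) J ` (\<Union>Q) = Q" using U P by auto
  show "primeideal (\<Union>Q) R"
  proof (rule primeidealI)
    show "ideal (\<Union>Q) R" using U P by simp
    show "carrier R \<noteq> \<Union>Q"
    proof
      assume eq: "carrier R = \<Union>Q"
      have "J +> \<one> \<in> Q" using eq mem[of \<one>] by auto
      moreover have "J +> \<one> = \<one>\<^bsub>R Quot J\<^esub>" by (simp add: FactRing_def)
      ultimately show False using Q.I_notcarr Q.one_imp_carrier by auto
    qed
    fix a b assume ab: "a \<in> carrier R" "b \<in> carrier R" "a \<otimes> b \<in> \<Union>Q"
    then have "J +> (a \<otimes> b) \<in> Q" using mem by blast
    then have "(J +> a) \<otimes>\<^bsub>R Quot J\<^esub> (J +> b) \<in> Q" using ab by (simp add: FactRing_def J.rcoset_mult_add)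
    from Q.I_prime[OF inc[OF ab(1)] inc[OF ab(2)] this]
    show "a \<in> \<Union>Q \<or> b \<in> \<Union>Q" using mem[OF ab(1)] mem[OF ab(2)] by simp
  qed (rule is_cring)
qed

text \<open>Image and union are mutually inverse between the primes over \<open>J\<close> and the
  primes of the quotient; being monotone, they carry strict chains to strict chains of the same
  length.\<close>

lemma krull_dim_quot:
  assumes J: "ideal J R"
  shows "krull_dim (R Quot J) = dim_over R J"
proof (rule antisym)
  let ?\<phi> = "\<lambda>P. (+>) J ` P"
  show "krull_dim (R Quot J) \<le> dim_over R J"
    unfolding krull_dim_def
  proof (rule SUP_least, elim CollectE conjE)
    fix ps assume ps: "ps \<noteq> []" "\<forall>P\<in>set ps. primeideal P (R Quot J)" "sorted_wrt (\<subset>) ps"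
    have "sorted_wrt (\<subset>) (map Union ps)"
      unfolding sorted_wrt_map
    proof (rule sorted_wrt_mono_rel[OF _ ps(3)])
      fix P Q assume "P \<in> set ps" "Q \<in> set ps" "P \<subset> Q"
      then have "(+>) J ` (\<Union>P) = P" "(+>) J ` (\<Union>Q) = Q" using primeideal_Union_quot(3)[OF J] ps(2) by auto
      then show "\<Union>P \<subset> \<Union>Q" using \<open>P \<subset> Q\<close> by (metis Union_mono psubsetE psubsetI)
    qed
    then have "map Union ps \<in> prime_chains R J"
      using ps primeideal_Union_quot(1,2)[OF J] unfolding prime_chains_def by simp
    then show "ereal (real (length ps - 1)) \<le> dim_over R J" using dim_over_upper[of "map Union ps"] by simp
  qed
  show "dim_over R J \<le> krull_dim (R Quot J)"
    unfolding dim_over_def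
  proof (rule SUP_least)
    fix ps assume ps: "ps \<in> prime_chains R J"
    then have ps: "ps \<noteq> []" "\<forall>P\<in>set ps. primeideal P R \<and> J \<subseteq> P" "sorted_wrt (\<subset>) ps"
      by (auto simp: prime_chains_def)
    have "sorted_wrt (\<subset>) (map ?\<phi> ps)"
      unfolding sorted_wrt_map
    proof (rule sorted_wrt_mono_rel[OF _ ps(3)])
      fix P Q assume PQ: "P \<in> set ps" "Q \<in> set ps" "P \<subset> Q"
      then have "\<Union>(?\<phi> P) = P" "\<Union>(?\<phi> Q) = Q" using primeideal_image_quot(2)[OF J] ps(2) by blast+
      then show "?\<phi> P \<subset> ?\<phi> Q" using PQ(3) by (metis image_mono psubsetE psubsetI)
    qed
    moreover have "\<forall>P\<in>set (map ?\<phi> ps). primeideal P (R Quot J)"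
      using ps(2) primeideal_image_quot(1)[OF J] by simp
    ultimately have "map ?\<phi> ps \<in> {ps. ps \<noteq> [] \<and> (\<forall>P\<in>set ps. primeideal P (R Quot J)) \<and> sorted_wrt (\<subset>) ps}"
      using ps(1) by simp
    from SUP_upper[OF this, of "\<lambda>ps. ereal (real (length ps - 1))"]
    show "ereal (real (length ps - 1)) \<le> krull_dim (R Quot J)" by (simp add: krull_dim_def)
  qed
qed

lemma prime_avoidance:
  assumes "finite F" "\<And>P. P \<in> F \<Longrightarrow> primeideal P R" and J: "ideal J R" and "\<And>P. P \<in> F \<Longrightarrow> \<not> J \<subseteq> P"
  shows "\<exists>x\<in>J. \<forall>P\<in>F. x \<notin> P"
  using assms(1,2,4)
proof (induction "card F" arbitrary: F)
  case 0
  then show ?case using self.sub_zero J by (auto simp: submodule_iff_ideal)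
next
  case (Suc n)
  interpret J: ideal J R by fact
  show ?case
  proof (cases "\<exists>P\<in>F. \<exists>Q\<in>F. P \<subset> Q")
    case True
    then obtain P Q where P: "P \<in> F" "Q \<in> F" "P \<subset> Q" by blast
    have "\<exists>x\<in>J. \<forall>P\<in>F - {P}. x \<notin> P"
      by (rule Suc.hyps(1)) (use Suc P in auto)
    then show ?thesis using P by blast
  next
    case False
    obtain P where P: "P \<in> F" using Suc(2) by (metis card.empty ex_in_conv nat.distinct(1))
    have "n = card (F - {P})" using Suc.hyps(2) P by (metis card_Diff_singleton diff_Suc_1)
    then have "\<exists>x\<in>J. \<forall>Q\<in>F - {P}. x \<notin> Q" by (rule Suc.hyps(1)) (use Suc.prems in auto)
    then obtain x where x: "x \<in> J" "\<forall>Q\<in>F - {P}. x \<notin> Q" by blast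
    interpret P: primeideal P R using Suc P by blast
    show ?thesis
    proof (cases "x \<in> P")
      case True
      \<comment> \<open>The correction is a product of an element of \<open>J\<close> outside
        \<open>P\<close> with elements of the other primes outside \<open>P\<close>; such factors
        exist because no prime of \<open>F\<close> contains another.\<close>
      have "\<exists>z. z \<in> J \<and> (\<forall>Q\<in>G. z \<in> Q) \<and> z \<notin> P" if "finite G" "G \<subseteq> F - {P}" for G
        using that
      proof (induction G rule: finite_induct)
        case empty
        then show ?case using Suc.prems(3)[OF P] by auto
      next
        case (insert Q G)
        then obtain z where z: "z \<in> J" "\<forall>Q\<in>G. z \<in> Q" "z \<notin> P" by auto
        have QF: "Q \<in> F" "Q \<noteq> P" using insert.prems by auto
        interpret Q: primeideal Q R using Suc.prems(2)[OF QF(1)] .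
        have "\<not> Q \<subseteq> P" using False QF P by (meson psubsetI)
        then obtain q where q: "q \<in> Q" "q \<notin> P" by auto
        have c: "z \<in> carrier R" "q \<in> carrier R" using z q J.Icarr Q.Icarr by auto
        have "z \<otimes> q \<in> Q'" if "Q' \<in> G" for Q'
        proof -
          have "Q' \<in> F" using that insert.prems by auto
          then have "ideal Q' R" using Suc.prems(2) primeideal.axioms(1) by metis
          then show ?thesis using ideal.I_r_closed z(2) that c by metis
        qed
        moreover have "z \<otimes> q \<notin> P" using P.I_prime[OF c] z(3) q(2) by blast
        ultimately show ?case using J.I_r_closed[OF z(1) c(2)] Q.I_l_closed[OF q(1) c(1)] by auto
      qed
      from this[of "F - {P}"] obtain z where z: "z \<in> J" "\<forall>Q\<in>F - {P}. z \<in> Q" "z \<notin> P" using Suc by auto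
      have c: "z \<in> carrier R" "x \<in> carrier R" using z x J.Icarr by auto
      \<comment> \<open>Exactly one of the two summands lies in \<open>Q\<close>: it is
        \<open>x\<close> for \<open>Q = P\<close>, and \<open>z\<close> for all the others.\<close>
      have "x \<oplus> z \<notin> Q" if Q: "Q \<in> F" for Q
      proof -
        have i: "ideal Q R" by (rule primeideal.axioms(1)[OF Suc.prems(2)[OF Q]])
        show ?thesis
          using ideal_add_cancel[OF i, of x z] ideal_add_cancel[OF i, of z x] c z x True Q by (cases "Q = P") auto
      qed
      then show ?thesis using z x by blast
    qed (use x in auto)
  qed
qed

text \<open>A descending intersection of primes is prime, so Zorn's lemma applies to complements.\<close>

lemma minimal_prime_exists:
  assumes P: "primeideal P R" and J: "J \<subseteq> P"
  shows "\<exists>Q. primeideal Q R \<and> J \<subseteq> Q \<and> Q \<subseteq> P \<and> (\<forall>Q'. primeideal Q' R \<longrightarrow> J \<subseteq> Q' \<longrightarrow> Q' \<subseteq> Q \<longrightarrow> Q' = Q)"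
proof -
  define A where "A = {carrier R - Q | Q. primeideal Q R \<and> J \<subseteq> Q \<and> Q \<subseteq> P}"
  have "\<exists>M\<in>A. \<forall>Y\<in>A. M \<subseteq> Y \<longrightarrow> Y = M"
  proof (rule subset_Zorn_nonempty)
    show "A \<noteq> {}" using assms by (auto simp: A_def)
    fix C assume C: "C \<noteq> {}" "subset.chain A C"
    define B where "B = {Q. primeideal Q R \<and> J \<subseteq> Q \<and> Q \<subseteq> P \<and> carrier R - Q \<in> C}"
    have CB: "\<exists>Q\<in>B. Y = carrier R - Q" if "Y \<in> C" for Y
      using that C(2) by (auto simp: subset.chain_def A_def B_def)
    have B: "B \<noteq> {}" using C(1) CB by blast
    have sub: "Q \<subseteq> carrier R" if "Q \<in> B" for Q using that primeideal_carr by (auto simp: B_def)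
    have chain: "Q \<subseteq> Q' \<or> Q' \<subseteq> Q" if "Q \<in> B" "Q' \<in> B" for Q Q'
    proof -
      have "carrier R - Q \<subseteq> carrier R - Q' \<or> carrier R - Q' \<subseteq> carrier R - Q"
        using that C(2) unfolding subset_chain_def B_def by simp
      then show ?thesis using sub[OF that(1)] sub[OF that(2)] by (meson Diff_iff subset_iff)
    qed
    have "primeideal (\<Inter>B) R"
    proof (rule primeidealI)
      show "ideal (\<Inter>B) R" using B by (intro i_Intersect) (auto simp: B_def primeideal.axioms(1))
      obtain Q where "Q \<in> B" using B by blast
      then have "\<one> \<notin> \<Inter>B" using primeideal_one[of Q R] by (auto simp: B_def)
      then show "carrier R \<noteq> \<Inter>B" by auto
      fix a b assume ab: "a \<in> carrier R" "b \<in> carrier R" "a \<otimes> b \<in> \<Inter>B"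
      show "a \<in> \<Inter>B \<or> b \<in> \<Inter>B"
      proof (rule ccontr)
        assume "\<not> ?thesis"
        then obtain Q Q' where "Q \<in> B" "a \<notin> Q" "Q' \<in> B" "b \<notin> Q'" by blast
        moreover from this chain obtain Q'' where "Q'' \<in> B" "Q'' \<subseteq> Q" "Q'' \<subseteq> Q'" by blast
        ultimately show False using ab primeideal.I_prime[of Q'' R a b] by (auto simp: B_def)
      qed
    qed (rule is_cring)
    moreover have "\<Union>C = carrier R - \<Inter>B"
    proof
      show "\<Union>C \<subseteq> carrier R - \<Inter>B" using CB by blast
      show "carrier R - \<Inter>B \<subseteq> \<Union>C" by (auto simp: B_def)
    qed
    moreover have "J \<subseteq> \<Inter>B" "\<Inter>B \<subseteq> P" using B by (auto simp: B_def)
    ultimately show "\<Union>C \<in> A" by (auto simp: A_def)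
  qed
  then obtain M where M: "M \<in> A" "\<forall>Y\<in>A. M \<subseteq> Y \<longrightarrow> Y = M" by blast
  from M(1) obtain Q where Q: "primeideal Q R" "J \<subseteq> Q" "Q \<subseteq> P" and MQ: "M = carrier R - Q"
    unfolding A_def by blast
  moreover have "Q' = Q" if "primeideal Q' R" "J \<subseteq> Q'" "Q' \<subseteq> Q" for Q'
  proof -
    have "carrier R - Q' \<in> A" using that Q unfolding A_def by blast
    then have "carrier R - Q' = carrier R - Q" using M(2) MQ that(3) by (metis Diff_mono order_refl)
    then show ?thesis using primeideal_carr[OF that(1)] primeideal_carr[OF Q(1)] by blast
  qed
  ultimately show ?thesis by blast
qed

end

section \<open>Noetherian rings: finitely many minimal primes, primes disjoint from a multiplicative
  set\<close>

locale noetherian_cring = cring R + noetherian_ring R for R (structure)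
begin

text \<open>A nonempty chain of ideals contains its union, so Zorn's lemma yields the maximum
  condition for an arbitrary property. It serves as noetherian induction.\<close>

lemma maximal_ideal_with:
  assumes "ideal J R" "\<Phi> J"
  shows "\<exists>K. ideal K R \<and> \<Phi> K \<and> (\<forall>K'. ideal K' R \<longrightarrow> \<Phi> K' \<longrightarrow> K \<subseteq> K' \<longrightarrow> K' = K)"
proof -
  let ?C = "{K. ideal K R \<and> \<Phi> K}"
  have "\<exists>M\<in>?C. \<forall>Y\<in>?C. M \<subseteq> Y \<longrightarrow> Y = M"
  proof (rule subset_Zorn_nonempty)
    fix D assume D: "D \<noteq> {}" "subset.chain ?C D"
    then have "subset.chain {I. ideal I R} D" by (auto simp: subset.chain_def)
    from ideal_chain_is_trivial[OF D(1) this] show "\<Union>D \<in> ?C" using D(2) by (auto simp: subset.chain_def)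
  qed (use assms in auto)
  then show ?thesis by blast
qed

text \<open>A maximal counterexample \<open>J\<close> is proper and not prime, so it contains some
  \<open>a b\<close> with \<open>a\<close> and \<open>b\<close> outside. A prime over
  \<open>J\<close> contains \<open>J + R a\<close> or \<open>J + R b\<close>, and the finite sets
  belonging to these two ideals together serve for \<open>J\<close>.\<close>

lemma ideal_finite_primes:
  assumes "ideal J R"
  shows "\<exists>F. finite F \<and> (\<forall>P\<in>F. primeideal P R \<and> J \<subseteq> P) \<and> (\<forall>Q. primeideal Q R \<longrightarrow> J \<subseteq> Q \<longrightarrow> (\<exists>P\<in>F. P \<subseteq> Q))"
proof (rule ccontr)
  define g where "g J \<longleftrightarrow> (\<exists>F. finite F \<and> (\<forall>P\<in>F. primeideal P R \<and> J \<subseteq> P) \<and> (\<forall>Q. primeideal Q R \<longrightarrow> J \<subseteq> Q \<longrightarrow> (\<exists>P\<in>F. P \<subseteq> Q)))" for J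
  assume "\<not> ?thesis"
  then have "\<not> g J" by (simp add: g_def)
  from maximal_ideal_with[of J "\<lambda>J. \<not> g J", OF assms this] obtain J where J: "ideal J R" "\<not> g J"
    and max: "\<And>J'. ideal J' R \<Longrightarrow> \<not> g J' \<Longrightarrow> J \<subseteq> J' \<Longrightarrow> J' = J" by blast
  have np: "\<not> primeideal J R" using J(2) unfolding g_def by (auto intro: exI[of _ "{J}"])
  have "carrier R \<noteq> J"
  proof
    assume "carrier R = J"
    then have "\<not> (primeideal Q R \<and> J \<subseteq> Q)" for Q using primeideal_one by auto
    then have "g J" unfolding g_def by (intro exI[of _ "{}"]) auto
    then show False using J by blast
  qed
  then obtain a b where ab: "a \<in> carrier R" "b \<in> carrier R" "a \<otimes> b \<in> J" "a \<notin> J" "b \<notin> J"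
    using ideal.primeidealCD[OF J(1) is_cring np] by blast
  have "g (ideal_plus R J x)" if "x \<in> carrier R" "x \<notin> J" for x
    using max[OF ideal_plus_ideal[OF J(1) that(1)]] ideal_plus_superset[OF J(1) that(1)] ideal_plus_self[OF J(1) that(1)] that
    by blast
  note gab = this[OF ab(1,4)] this[OF ab(2,5)]
  from gab(1) obtain F where
    F: "finite F" "\<forall>P\<in>F. primeideal P R \<and> ideal_plus R J a \<subseteq> P"
      "\<forall>Q. primeideal Q R \<longrightarrow> ideal_plus R J a \<subseteq> Q \<longrightarrow> (\<exists>P\<in>F. P \<subseteq> Q)"
    unfolding g_def by blast
  from gab(2) obtain G where
    G: "finite G" "\<forall>P\<in>G. primeideal P R \<and> ideal_plus R J b \<subseteq> P"
      "\<forall>Q. primeideal Q R \<longrightarrow> ideal_plus R J b \<subseteq> Q \<longrightarrow> (\<exists>P\<in>G. P \<subseteq> Q)" unfolding g_def by blast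
  have "g J"
    unfolding g_def
  proof (intro exI[of _ "F \<union> G"] conjI ballI allI impI)
    fix Q assume Q: "primeideal Q R" "J \<subseteq> Q"
    then have "a \<in> Q \<or> b \<in> Q" using primeideal.I_prime[OF Q(1) ab(1,2)] ab(3) by auto
    then have "ideal_plus R J a \<subseteq> Q \<or> ideal_plus R J b \<subseteq> Q"
      using ideal_plus_minimal[OF primeideal.axioms(1)[OF Q(1)] Q(2)] by auto
    then show "\<exists>P\<in>F \<union> G. P \<subseteq> Q" using F(3) G(3) Q(1) by (meson UnI1 UnI2)
  next
    show "finite (F \<union> G)" using F(1) G(1) by simp
  next
    fix P assume "P \<in> F \<union> G"
    then show "primeideal P R" using F(2) G(2) by auto
  next
    fix P assume "P \<in> F \<union> G"
    then show "J \<subseteq> P"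
      using F(2) G(2) ideal_plus_superset[OF J(1) ab(1)] ideal_plus_superset[OF J(1) ab(2)] by (metis UnE order_trans)
  qed
  then show False using J by blast
qed

text \<open>An ideal \<open>P\<close> maximal among those over \<open>J\<close> and disjoint from
  \<open>W\<close> is prime: for \<open>a\<close> and \<open>b\<close> outside \<open>P\<close>,
  both \<open>P + R a\<close> and \<open>P + R b\<close> meet \<open>W\<close>.\<close>

lemma prime_disjoint_exists:
  assumes J: "ideal J R" and W: "W \<subseteq> carrier R" "\<one> \<in> W" "\<And>a b. a \<in> W \<Longrightarrow> b \<in> W \<Longrightarrow> a \<otimes> b \<in> W"
    and d: "J \<inter> W = {}"
  shows "\<exists>P. primeideal P R \<and> J \<subseteq> P \<and> P \<inter> W = {}"
proof -
  from maximal_ideal_with[of J "\<lambda>K. J \<subseteq> K \<and> K \<inter> W = {}"] J d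
  obtain P where P: "ideal P R" "J \<subseteq> P" "P \<inter> W = {}"
    and max: "\<And>K. ideal K R \<Longrightarrow> J \<subseteq> K \<and> K \<inter> W = {} \<Longrightarrow> P \<subseteq> K \<Longrightarrow> K = P" by blast
  interpret P: ideal P R by fact
  have ex: "\<exists>w\<in>W. \<exists>r\<in>carrier R. w \<ominus> r \<otimes> a \<in> P" if a: "a \<in> carrier R" "a \<notin> P" for a
  proof (rule ccontr)
    assume "\<not> ?thesis"
    then have "ideal_plus R P a \<inter> W = {}" by (auto simp: ideal_plus_iff)
    then have "ideal_plus R P a = P"
      using max[OF ideal_plus_ideal[OF P(1) a(1)]] ideal_plus_superset[OF P(1) a(1)] P(2) by blast
    then show False using ideal_plus_self[OF P(1) a(1)] a by blast
  qed
  have "primeideal P R"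
  proof (rule primeidealI)
    show "carrier R \<noteq> P" using P(3) W by blast
    fix a b assume ab: "a \<in> carrier R" "b \<in> carrier R" "a \<otimes> b \<in> P"
    show "a \<in> P \<or> b \<in> P"
    proof (rule ccontr)
      assume "\<not> ?thesis"
      then obtain w r v s where w: "w \<in> W" "r \<in> carrier R" "w \<ominus> r \<otimes> a \<in> P" "v \<in> W" "s \<in> carrier R" "v \<ominus> s \<otimes> b \<in> P"
        using ex ab by meson
      have c: "w \<in> carrier R" "v \<in> carrier R" using w W by auto
      have "w \<otimes> (v \<ominus> s \<otimes> b) \<in> P" "(s \<otimes> b) \<otimes> (w \<ominus> r \<otimes> a) \<in> P" "(r \<otimes> s) \<otimes> (a \<otimes> b) \<in> P"
        using w c ab P.I_l_closed by auto
      \<comment> \<open>This sum of three elements of \<open>P\<close> equals \<open>w v\<close>,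
        which would then lie in \<open>P\<close> and in \<open>W\<close>.\<close>
      then have "w \<otimes> (v \<ominus> s \<otimes> b) \<oplus> (s \<otimes> b) \<otimes> (w \<ominus> r \<otimes> a) \<oplus> (r \<otimes> s) \<otimes> (a \<otimes> b) \<in> P" by blast
      moreover have "w \<otimes> (v \<ominus> s \<otimes> b) \<oplus> (s \<otimes> b) \<otimes> (w \<ominus> r \<otimes> a) \<oplus> (r \<otimes> s) \<otimes> (a \<otimes> b) = w \<otimes> v"
        using w c ab by algebra
      ultimately show False using W(3)[OF w(1,4)] P(3) by auto
    qed
  qed (use P is_cring in auto)
  then show ?thesis using P by blast
qed

text \<open>A prime disjoint from the products \<open>x\<^sup>i s\<close> with \<open>s \<notin> P\<close> can be put below the least prime \<open>P\<close> of a chain.\<close>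

lemma dim_over_regular:
  assumes J: "ideal J R" and x: "x \<in> carrier R" "\<And>a. a \<in> carrier R \<Longrightarrow> x \<otimes> a \<in> J \<Longrightarrow> a \<in> J"
    and J': "J \<subseteq> J'" "x \<in> J'"
  shows "dim_over R J' + 1 \<le> dim_over R J"
proof -
  \<comment> \<open>Subtracting 1 on the right leaves the supremum alone on the left, where it is
    bounded chain by chain; an empty family is covered as well.\<close>
  have "dim_over R J' \<le> dim_over R J - 1"
    unfolding dim_over_def[of R J']
  proof (rule SUP_least)
    fix ps assume ps: "ps \<in> prime_chains R J'"
    then obtain P qs where P: "ps = P # qs" "primeideal P R" "J' \<subseteq> P" by (cases ps) (auto simp: prime_chains_def)
    \<comment> \<open>\<open>W\<close> contains \<open>x\<close> (take \<open>s = 1\<close>) and the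
      complement of \<open>P\<close> (take \<open>i = 0\<close>). A prime disjoint from it lies in
      \<open>P\<close> and misses \<open>x\<close>, so the inclusion is strict.\<close>
    define W where "W = {x [^] (i::nat) \<otimes> s | i s. s \<in> carrier R - P}"
    have pw: "a \<in> J" if "a \<in> carrier R" "x [^] (i::nat) \<otimes> a \<in> J" for i a
      using that
    proof (induction i)
      case (Suc i)
      then have "x \<otimes> (x [^] i \<otimes> a) \<in> J" using x(1) by (simp add: m_ac)
      then have "x [^] i \<otimes> a \<in> J" using x Suc.prems(1) by simp
      then show ?case using Suc by blast
    qed simp
    have "\<exists>Q. primeideal Q R \<and> J \<subseteq> Q \<and> Q \<inter> W = {}"
    proof (rule prime_disjoint_exists[OF J])
      show "W \<subseteq> carrier R" using x by (auto simp: W_def)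
      have one: "\<one> \<in> carrier R - P" using primeideal_one[OF P(2)] by auto
      then show "\<one> \<in> W" by (auto simp: W_def intro!: exI[of _ "0::nat"] exI[of _ \<one>])
      \<comment> \<open>If a power of \<open>x\<close> times \<open>s\<close> is in
        \<open>J\<close>, regularity cancels the power and puts \<open>s\<close> into
        \<open>J \<subseteq> P\<close>, against the choice of \<open>s\<close>.\<close>
      show "J \<inter> W = {}" using pw P(3) J'(1) by (auto simp: W_def)
      fix a b assume "a \<in> W" "b \<in> W"
      then obtain i j s t where *: "a = x [^] (i::nat) \<otimes> s" "b = x [^] (j::nat) \<otimes> t" "s \<in> carrier R - P" "t \<in> carrier R - P"
        by (auto simp: W_def)
      then have "a \<otimes> b = x [^] (i + j) \<otimes> (s \<otimes> t)" using x by (simp add: nat_pow_mult[symmetric] m_ac)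
      then show "a \<otimes> b \<in> W" using prime_mult_not_in[OF P(2) *(3,4)] by (auto simp: W_def)
    qed
    then obtain Q where Q: "primeideal Q R" "J \<subseteq> Q" "Q \<inter> W = {}" by blast
    have sW: "s \<in> W" if "s \<in> carrier R - P" for s using that by (auto simp: W_def intro!: exI[of _ "0::nat"] exI[of _ s])
    have "x = x [^] (1::nat) \<otimes> \<one>" using x(1) by simp
    then have xW: "x \<in> W" using primeideal_one[OF P(2)] unfolding W_def by blast
    have "y \<in> P" if "y \<in> Q" for y 
      using sW[of y] Q(3) that primeideal_carr[OF Q(1) that] by (meson DiffI disjoint_iff)
    moreover have "x \<in> P" "x \<notin> Q" using xW Q(3) J'(2) P(3) by (auto simp: disjoint_iff)
    ultimately have "Q \<subset> P" by auto
    then have "Q # ps \<in> prime_chains R J" using prime_chains_Cons[OF ps J'(1) Q(1,2)] P by simp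
    from dim_over_upper[OF this] have "ereal (real (length ps - 1)) + 1 \<le> dim_over R J"
      using P by (auto simp: one_ereal_def add.commute)
    then show "ereal (real (length ps - 1)) \<le> dim_over R J - 1" by (simp add: ereal_le_minus)
  qed
  then show ?thesis by (simp add: ereal_le_minus)
qed

end

sublocale noetherian_local_ring \<subseteq> noetherian_cring ..

lemma (in noetherian_local_ring) maximal_prime: "primeideal \<mm> R"
  using maximalideal_prime maximal by blast

lemma (in noetherian_local_ring) proper_ideal_subset:
  assumes J: "ideal J R" "J \<noteq> carrier R"
  shows "J \<subseteq> \<mm>"
proof -
  from maximal_ideal_with[of J "\<lambda>K. J \<subseteq> K \<and> K \<noteq> carrier R"] J
  obtain P where P: "ideal P R" "J \<subseteq> P" "P \<noteq> carrier R"
    and max: "\<And>K. ideal K R \<Longrightarrow> J \<subseteq> K \<and> K \<noteq> carrier R \<Longrightarrow> P \<subseteq> K \<Longrightarrow> K = P" by blast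
  have "maximalideal P R"
  proof (rule maximalidealI)
    fix K assume "ideal K R" "P \<subseteq> K" "K \<subseteq> carrier R"
    then show "K = P \<or> K = carrier R" using max[of K] P(2) by blast
  qed (use P in auto)
  then show ?thesis using maximal_unique P by blast
qed

lemma (in noetherian_local_ring) prime_subset_maximal: "primeideal P R \<Longrightarrow> P \<subseteq> \<mm>"
  using proper_ideal_subset primeideal.I_notcarr primeideal.axioms(1) by metis

section \<open>Noetherian modules\<close>

text \<open>\<open>a\<close> is a nonzero-divisor on \<open>L / K\<close>. The case
  \<open>K = L\<close> is allowed; properness, the last clause of \<open>regular_seq\<close>, is
  kept apart.\<close>

definition regular_mod :: "('a, 'l, 'k) module_scheme \<Rightarrow> 'l set \<Rightarrow> 'a \<Rightarrow> bool" where
  "regular_mod L K a \<longleftrightarrow> (\<forall>y\<in>carrier L. a \<odot>\<^bsub>L\<^esub> y \<in> K \<longrightarrow> y \<in> K)"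

definition assoc_primes ::
    "('a, 'r) ring_scheme \<Rightarrow> ('a, 'l, 'k) module_scheme \<Rightarrow> 'l set \<Rightarrow> 'a set set" where
  "assoc_primes A L K = {P. primeideal P A \<and> (\<exists>x\<in>carrier L. P = colon A L K {x})}"

text \<open>The maximum condition is taken as the assumption because it is applied to submodules of
  very different kinds: saturated ones, preimages of \<open>K\<close> under a multiplication, and
  those with infinitely many associated primes.\<close>

locale noetherian_module = module R M + noetherian_ring R for R (structure) and M (structure) +
  assumes maximal_submodule_with: "\<And>\<Phi> K. submodule K R M \<Longrightarrow> \<Phi> K \<Longrightarrow>
    \<exists>U. submodule U R M \<and> \<Phi> U \<and> (\<forall>U'. submodule U' R M \<longrightarrow> \<Phi> U' \<longrightarrow> U \<subseteq> U' \<longrightarrow> U' = U)"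

sublocale noetherian_module \<subseteq> noetherian_cring R
  by unfold_locales

context module
begin

lemma colon_elem_iff: "a \<in> colon R M K {x} \<longleftrightarrow> a \<in> carrier R \<and> a \<odot>\<^bsub>M\<^esub> x \<in> K"
  by (simp add: colon_def)

lemma ideal_colon_elem: "submodule K R M \<Longrightarrow> x \<in> carrier M \<Longrightarrow> ideal (colon R M K {x}) R"
  by (rule ideal_colon) auto

lemma submodule_preimage_mult:
  assumes K: "submodule K R M" and s: "s \<in> carrier R"
  shows "submodule {x \<in> carrier M. s \<odot>\<^bsub>M\<^esub> x \<in> K} R M"
proof (rule submoduleI)
  fix a x assume ax: "a \<in> carrier R" "x \<in> {x \<in> carrier M. s \<odot>\<^bsub>M\<^esub> x \<in> K}"
  then have "a \<odot>\<^bsub>M\<^esub> (s \<odot>\<^bsub>M\<^esub> x) \<in> K" using sub_smult[OF K] by simp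
  then show "a \<odot>\<^bsub>M\<^esub> x \<in> {x \<in> carrier M. s \<odot>\<^bsub>M\<^esub> x \<in> K}" using ax s by (simp add: smult_commute[of s a])
qed (use s sub_zero[OF K] sub_minus[OF K] sub_add[OF K] in \<open>simp_all add: subset_iff smult_r_distr smult_r_minus\<close>)

text \<open>The maximum condition for the submodules of \<open>U\<close>, phrased inside
  \<open>M\<close> so that the induction over generators never changes the ambient module.\<close>

definition acc_below :: "'c set \<Rightarrow> bool" where
  "acc_below U \<longleftrightarrow> (\<forall>\<Phi> K. submodule K R M \<longrightarrow> K \<subseteq> U \<longrightarrow> \<Phi> K \<longrightarrow>
    (\<exists>V. submodule V R M \<and> V \<subseteq> U \<and> \<Phi> V \<and> (\<forall>V'. submodule V' R M \<longrightarrow> V' \<subseteq> U \<longrightarrow> \<Phi> V' \<longrightarrow> V \<subseteq> V' \<longrightarrow> V' = V)))"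

lemma acc_below_zero: "acc_below {\<zero>\<^bsub>M\<^esub>}"
  unfolding acc_below_def
proof (intro allI impI)
  fix \<Phi> K assume K: "submodule K R M" "K \<subseteq> {\<zero>\<^bsub>M\<^esub>}" "\<Phi> K"
  have "V' = K" if "submodule V' R M" "V' \<subseteq> {\<zero>\<^bsub>M\<^esub>}" for V'
    using sub_zero[OF that(1)] sub_zero[OF K(1)] that(2) K(2) by auto
  then show "\<exists>V. submodule V R M \<and> V \<subseteq> {\<zero>\<^bsub>M\<^esub>} \<and> \<Phi> V \<and>
    (\<forall>V'. submodule V' R M \<longrightarrow> V' \<subseteq> {\<zero>\<^bsub>M\<^esub>} \<longrightarrow> \<Phi> V' \<longrightarrow> V \<subseteq> V' \<longrightarrow> V' = V)"
    using K by blast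
qed

text \<open>A submodule \<open>K\<close> of \<open>U + R x\<close> is compared through the pair formed by \<open>K \<inter> U\<close> and the ideal of
  the \<open>a\<close> with \<open>a x \<in> K + U\<close>.\<close>

lemma acc_below_add_cyclic:
  assumes noeth: "noetherian_ring R" and good: "acc_below U" and U: "submodule U R M" and x: "x \<in> carrier M"
  shows "acc_below (add_cyclic R M U x)"
  unfolding acc_below_def
proof (intro allI impI)
  interpret N: noetherian_cring R using noeth R.is_cring by (simp add: noetherian_cring_def)
  let ?U' = "add_cyclic R M U x"
  let ?co = "\<lambda>K. colon R M {y \<in> carrier M. \<exists>u\<in>U. y \<ominus>\<^bsub>M\<^esub> u \<in> K} {x}"
  fix \<Phi> K assume K: "submodule K R M" "K \<subseteq> ?U'" "\<Phi> K"
  define \<Psi> where "\<Psi> V \<longleftrightarrow> submodule V R M \<and> V \<subseteq> ?U' \<and> \<Phi> V" for V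
  have id: "ideal (?co V) R" if "submodule V R M" for V
    by (rule ideal_colon_elem[OF submodule_add_image[OF that U] x])
  have "\<Psi> K" using K by (simp add: \<Psi>_def)
  then have "\<exists>V. \<Psi> V \<and> K \<inter> U = V \<inter> U" by blast
  \<comment> \<open>The maximizations are nested: first the trace on \<open>U\<close>, then the
    ideal among the submodules having that trace.\<close>
  with good[unfolded acc_below_def, rule_format, of "K \<inter> U" "\<lambda>W. \<exists>V. \<Psi> V \<and> W = V \<inter> U", OF submodule_Int[OF K(1) U]]
  obtain W where W: "\<exists>V. \<Psi> V \<and> W = V \<inter> U"
    "\<forall>V'. submodule V' R M \<longrightarrow> V' \<subseteq> U \<longrightarrow> (\<exists>V. \<Psi> V \<and> V' = V \<inter> U) \<longrightarrow> W \<subseteq> V' \<longrightarrow> V' = W"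
    by blast
  then obtain K1 where K1: "\<Psi> K1" "W = K1 \<inter> U" by blast
  have "ideal (?co K1) R" using K1 id by (simp add: \<Psi>_def)
  from N.maximal_ideal_with[OF this, of "\<lambda>J. \<exists>V. \<Psi> V \<and> V \<inter> U = W \<and> J = ?co V"] K1
  obtain J where J: "\<exists>V. \<Psi> V \<and> V \<inter> U = W \<and> J = ?co V"
    "\<forall>J'. ideal J' R \<longrightarrow> (\<exists>V. \<Psi> V \<and> V \<inter> U = W \<and> J' = ?co V) \<longrightarrow> J \<subseteq> J' \<longrightarrow> J' = J" by blast
  then obtain V where V: "\<Psi> V" "V \<inter> U = W" "J = ?co V" by blast
  have "V' = V" if V': "submodule V' R M" "V' \<subseteq> ?U'" "\<Phi> V'" "V \<subseteq> V'" for V'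
  proof (rule antisym)
    have \<Psi>': "\<Psi> V'" using V' by (simp add: \<Psi>_def)
    have sV: "submodule V R M" using V by (simp add: \<Psi>_def)
    have WW: "V' \<inter> U = W"
      using W(2)[rule_format, OF submodule_Int[OF V'(1) U]] \<Psi>' V'(4) V(2) by blast
    have "?co V \<subseteq> ?co V'" using V'(4) by (auto simp: colon_def)
    then have co: "?co V' = ?co V"
      using J(2)[rule_format, OF id[OF V'(1)]] \<Psi>' WW V(3) by blast
    show "V' \<subseteq> V"
    proof
      fix y assume y: "y \<in> V'"
      have yc: "y \<in> carrier M" using y sub_carr[OF V'(1)] by blast
      have "y \<in> ?U'" using y V'(2) by blast
      then obtain a where a: "a \<in> carrier R" "y \<ominus>\<^bsub>M\<^esub> a \<odot>\<^bsub>M\<^esub> x \<in> U" by (auto simp: add_cyclic_def)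
      define u where "u = y \<ominus>\<^bsub>M\<^esub> a \<odot>\<^bsub>M\<^esub> x"
      have u: "u \<in> U" "u \<in> carrier M" "\<ominus>\<^bsub>M\<^esub> u \<in> U" using a sub_carr[OF U] sub_minus[OF U] by (auto simp: u_def)
      have "a \<odot>\<^bsub>M\<^esub> x \<ominus>\<^bsub>M\<^esub> \<ominus>\<^bsub>M\<^esub> u = y"
        using yc a x by (simp add: u_def a_minus_def M.a_ac M.r_neg)
      then have "a \<in> ?co V'" using a x y u by (auto simp: colon_elem_iff)
      then have "a \<in> ?co V" using co by simp
      then obtain u' where u': "u' \<in> U" "a \<odot>\<^bsub>M\<^esub> x \<ominus>\<^bsub>M\<^esub> u' \<in> V" by (auto simp: colon_elem_iff)
      \<comment> \<open>An element of \<open>V\<close> with the same coefficient \<open>a\<close> as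
        \<open>y\<close>, so that \<open>y - z\<close> lies in \<open>U\<close> and hence in the
        common trace.\<close>
      define z where "z = a \<odot>\<^bsub>M\<^esub> x \<ominus>\<^bsub>M\<^esub> u'"
      have u'c: "u' \<in> carrier M" using u' sub_carr[OF U] by blast
      have z: "z \<in> V" "z \<in> carrier M" using u' sub_carr[OF sV] by (auto simp: z_def)
      have "y \<ominus>\<^bsub>M\<^esub> z = u \<oplus>\<^bsub>M\<^esub> u'"
        using yc a x u'c by (simp add: z_def u_def a_minus_def M.a_ac M.minus_add)
      then have "y \<ominus>\<^bsub>M\<^esub> z \<in> U" using sub_add[OF U u(1) u'(1)] by simp
      moreover have "y \<ominus>\<^bsub>M\<^esub> z \<in> V'" using y z V'(4) sub_diff[OF V'(1)] by blast
      ultimately have "y \<ominus>\<^bsub>M\<^esub> z \<in> V" using WW V(2) by blast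
      then show "y \<in> V" using sub_diff_cancel[OF sV yc z(2)] z(1) by blast
    qed
  qed (use V' in blast)
  then show "\<exists>V. submodule V R M \<and> V \<subseteq> ?U' \<and> \<Phi> V \<and>
    (\<forall>V'. submodule V' R M \<longrightarrow> V' \<subseteq> ?U' \<longrightarrow> \<Phi> V' \<longrightarrow> V \<subseteq> V' \<longrightarrow> V' = V)"
    using V(1) unfolding \<Psi>_def by blast
qed

lemma noetherian_module_of_fin_gen:
  assumes noeth: "noetherian_ring R" and fg: "fin_gen_module R M"
  shows "noetherian_module R M"
proof -
  obtain Y where Y: "finite Y" "Y \<subseteq> carrier M" "submodule_span R M Y = carrier M"
    using fg by (auto simp: fin_gen_module_def)
  have "\<exists>U. submodule U R M \<and> Y \<subseteq> U \<and> acc_below U"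
    using Y(1,2)
  proof (induction Y rule: finite_induct)
    case empty
    then show ?case using acc_below_zero submodule_zero by blast
  next
    case (insert x Y)
    then obtain U where U: "submodule U R M" "Y \<subseteq> U" "acc_below U" by auto
    have x: "x \<in> carrier M" using insert by simp
    have "insert x Y \<subseteq> add_cyclic R M U x"
      using add_cyclic_superset[OF U(1) x] add_cyclic_self[OF U(1) x] U(2) by blast
    then show ?case using submodule_add_cyclic[OF U(1) x] acc_below_add_cyclic[OF noeth U(3,1) x] by blast
  qed
  then obtain U where U: "submodule U R M" "Y \<subseteq> U" "acc_below U" by blast
  have "U = carrier M"
    using submodule_span_minimal[OF U(1,2)] Y(3) sub_carr[OF U(1)] by blast
  then have acc: "acc_below (carrier M)" using U by simp
  show ?thesis
  proof (intro noetherian_module.intro noetherian_module_axioms.intro module_self noeth)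
    fix \<Phi> K assume K: "submodule K R M" "\<Phi> K"
    have c: "V \<subseteq> carrier M" if "submodule V R M" for V using sub_carr[OF that] by blast
    from acc[unfolded acc_below_def, THEN spec[of _ \<Phi>], THEN spec[of _ K], THEN mp, OF K(1), THEN mp, OF c[OF K(1)], THEN mp, OF K(2)]
    obtain V where V: "submodule V R M" "\<Phi> V"
      "\<forall>V'. submodule V' R M \<longrightarrow> V' \<subseteq> carrier M \<longrightarrow> \<Phi> V' \<longrightarrow> V \<subseteq> V' \<longrightarrow> V' = V" by (elim exE conjE) metis
    then show "\<exists>U. submodule U R M \<and> \<Phi> U \<and> (\<forall>U'. submodule U' R M \<longrightarrow> \<Phi> U' \<longrightarrow> U \<subseteq> U' \<longrightarrow> U' = U)"
      using c by (intro exI[of _ V]) simp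
  qed
qed

end

lemma (in noetherian_cring) noetherian_ring_module: "noetherian_module R (ring_module R)"
proof (intro noetherian_module.intro noetherian_module_axioms.intro module_ring_module noetherian_ring_axioms)
  fix \<Phi> K assume "submodule K R (ring_module R)" "\<Phi> K"
  then show "\<exists>U. submodule U R (ring_module R) \<and> \<Phi> U \<and>
      (\<forall>U'. submodule U' R (ring_module R) \<longrightarrow> \<Phi> U' \<longrightarrow> U \<subseteq> U' \<longrightarrow> U' = U)"
    unfolding submodule_iff_ideal by (rule maximal_ideal_with)
qed

context noetherian_module
begin

text \<open>Nakayama's lemma after localization at \<open>P\<close>: the hypothesis says that \<open>U\<close> lies in the
  \<open>P\<close>-saturation of \<open>K + J U\<close>.\<close>

lemma local_nakayama:
  assumes P: "primeideal P R" and J: "J \<subseteq> P" and K: "submodule K R M" "saturation R M P K \<subseteq> K"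
    and U: "U \<subseteq> carrier M"
    and hyp: "\<And>V. submodule V R M \<Longrightarrow> K \<subseteq> V \<Longrightarrow> saturation R M P V \<subseteq> V \<Longrightarrow>
      (\<And>a u. a \<in> J \<Longrightarrow> u \<in> U \<Longrightarrow> a \<odot>\<^bsub>M\<^esub> u \<in> V) \<Longrightarrow> U \<subseteq> V"
  shows "U \<subseteq> K"
proof (rule ccontr)
  assume "\<not> U \<subseteq> K"
  then have "K \<subseteq> K \<and> saturation R M P K \<subseteq> K \<and> \<not> U \<subseteq> K" using K by blast
  \<comment> \<open>A maximal saturated \<open>V\<close> that misses part of \<open>U\<close>
    replaces the choice of a minimal set of generators; it is shown to satisfy the hypothesis, which
    then forces \<open>U \<subseteq> V\<close>.\<close>
  from maximal_submodule_with[of K "\<lambda>V. K \<subseteq> V \<and> saturation R M P V \<subseteq> V \<and> \<not> U \<subseteq> V", OF K(1) this]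
  obtain V where V: "submodule V R M" "K \<subseteq> V" "saturation R M P V \<subseteq> V" "\<not> U \<subseteq> V"
    and max: "\<And>V'. submodule V' R M \<Longrightarrow> K \<subseteq> V' \<and> saturation R M P V' \<subseteq> V' \<and> \<not> U \<subseteq> V' \<Longrightarrow> V \<subseteq> V' \<Longrightarrow> V' = V"
    by blast
  interpret P: primeideal P R by fact
  have "a \<odot>\<^bsub>M\<^esub> u \<in> V" if a: "a \<in> J" and u: "u \<in> U" for a u
  proof (rule ccontr)
    assume n: "a \<odot>\<^bsub>M\<^esub> u \<notin> V"
    have ac: "a \<in> carrier R" "a \<in> P" using a J P.Icarr by auto
    have uc: "u \<in> carrier M" using u U by blast
    have auc: "a \<odot>\<^bsub>M\<^esub> u \<in> carrier M" using ac uc by simp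
    let ?W = "add_cyclic R M V (a \<odot>\<^bsub>M\<^esub> u)"
    let ?V = "saturation R M P ?W"
    have W: "submodule ?W R M" by (rule submodule_add_cyclic[OF V(1) auc])
    have sV: "submodule ?V R M" by (rule submodule_saturation[OF P W])
    have VW: "V \<subseteq> ?W" "a \<odot>\<^bsub>M\<^esub> u \<in> ?W" using add_cyclic_superset[OF V(1) auc] add_cyclic_self[OF V(1) auc] by auto
    have sub: "V \<subseteq> ?V" "a \<odot>\<^bsub>M\<^esub> u \<in> ?V"
      using VW saturation_superset[OF P W] by auto
    have "U \<subseteq> ?V"
    proof (rule ccontr)
      assume "\<not> U \<subseteq> ?V"
      then have "?V = V" using max[OF sV] sub(1) V(2) saturation_idem[OF P] by blast
      then show False using sub(2) n by blast
    qed
    then have "u \<in> ?V" using u by blast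
    then obtain s where s: "s \<in> carrier R" "s \<notin> P" "s \<odot>\<^bsub>M\<^esub> u \<in> ?W" by (auto simp: saturation_def)
    then obtain t where t: "t \<in> carrier R" "s \<odot>\<^bsub>M\<^esub> u \<ominus>\<^bsub>M\<^esub> t \<odot>\<^bsub>M\<^esub> (a \<odot>\<^bsub>M\<^esub> u) \<in> V" by (auto simp: add_cyclic_def)
    have "(s \<ominus> t \<otimes> a) \<odot>\<^bsub>M\<^esub> u \<in> V"
      using t s ac uc by (simp add: smult_diff_distr_left smult_assoc1)
    \<comment> \<open>With \<open>s\<close> outside \<open>P\<close> and \<open>a\<close> inside,
      this coefficient is a unit after localization, so the saturated \<open>V\<close> absorbs
      \<open>u\<close>.\<close>
    moreover have "s \<ominus> t \<otimes> a \<notin> P"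
      using R.ideal_diff_cancel[OF P.is_ideal, of s "t \<otimes> a"] s t ac P.I_l_closed by auto
    ultimately have "u \<in> saturation R M P V"
      using s t ac uc by (auto simp: saturation_def intro!: bexI[of _ "s \<ominus> t \<otimes> a"])
    then show False using V n sub_smult[OF V(1) ac(1)] by blast
  qed
  then show False using hyp[OF V(1-3)] V(4) by blast
qed

text \<open>Instead of multiplying denominators of finitely many generators, \<open>s\<close> is
  taken with \<open>{t. s t \<in> K}\<close> maximal. A further denominator \<open>v\<close> cannot
  enlarge this set, so it already contains every \<open>t\<close>.\<close>

lemma annihilated_locally:
  assumes P: "primeideal P R" and K: "submodule K R M"
    and loc: "\<And>t. t \<in> carrier M \<Longrightarrow> \<exists>s\<in>carrier R - P. s \<odot>\<^bsub>M\<^esub> t \<in> K"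
  shows "\<exists>s\<in>carrier R - P. \<forall>t\<in>carrier M. s \<odot>\<^bsub>M\<^esub> t \<in> K"
proof -
  let ?V = "\<lambda>s. {t \<in> carrier M. s \<odot>\<^bsub>M\<^esub> t \<in> K}"
  have "\<one> \<in> carrier R - P" using primeideal_one[OF P] by simp
  then have "\<exists>s\<in>carrier R - P. ?V \<one> = ?V s" by blast
  from maximal_submodule_with[of "?V \<one>" "\<lambda>V. \<exists>s\<in>carrier R - P. V = ?V s", OF submodule_preimage_mult[OF K R.one_closed] this]
  obtain s where s: "s \<in> carrier R - P"
    and max: "\<And>V. submodule V R M \<Longrightarrow> \<exists>s\<in>carrier R - P. V = ?V s \<Longrightarrow> ?V s \<subseteq> V \<Longrightarrow> V = ?V s" by blast
  have "s \<odot>\<^bsub>M\<^esub> t \<in> K" if t: "t \<in> carrier M" for t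
  proof -
    obtain v where v: "v \<in> carrier R - P" "v \<odot>\<^bsub>M\<^esub> t \<in> K" using loc[OF t] by blast
    have vs: "v \<otimes> s \<in> carrier R - P" using R.prime_mult_not_in[OF P v(1) s] .
    have "?V s \<subseteq> ?V (v \<otimes> s)" using v s sub_smult[OF K] by (auto simp: smult_assoc1)
    then have eq: "?V (v \<otimes> s) = ?V s"
      using vs by (intro max submodule_preimage_mult[OF K]) auto
    have "s \<odot>\<^bsub>M\<^esub> (v \<odot>\<^bsub>M\<^esub> t) \<in> K" using sub_smult[OF K _ v(2)] s by blast
    then have "t \<in> ?V (v \<otimes> s)" using v s t by (simp add: smult_assoc1 smult_commute[of v s])
    then show ?thesis using eq by blast
  qed
  then show ?thesis using s by blast
qed

lemma colon_elem_smult: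
  assumes K: "submodule K R M" and x: "x \<in> carrier M" and b: "b \<in> carrier R"
  shows "colon R M K {x} \<subseteq> colon R M K {b \<odot>\<^bsub>M\<^esub> x}"
    and "a \<in> carrier R \<Longrightarrow> a \<in> colon R M K {b \<odot>\<^bsub>M\<^esub> x} \<longleftrightarrow> a \<otimes> b \<in> colon R M K {x}"
  using assms sub_smult[OF K b] by (auto simp: colon_elem_iff smult_assoc1 smult_commute[of _ b])

text \<open>An ideal maximal among the \<open>(K : x)\<close> inside \<open>P\<close> is prime:
  passing from \<open>x\<close> to a multiple enlarges \<open>(K : x)\<close>, which is impossible
  as long as the result stays in \<open>P\<close>. That some \<open>(K : x)\<close> lies in
  \<open>P\<close> at all is due to \<open>annihilated_locally\<close>.\<close>

lemma prime_colon_below: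
  assumes P: "primeideal P R" and K: "submodule K R M" and sub: "colon R M K (carrier M) \<subseteq> P"
  shows "\<exists>x\<in>carrier M. primeideal (colon R M K {x}) R \<and> colon R M K {x} \<subseteq> P"
proof -
  have "\<exists>x\<in>carrier M. colon R M K {x} \<subseteq> P"
  proof (rule ccontr)
    assume "\<not> ?thesis"
    then have "\<exists>s\<in>carrier R - P. s \<odot>\<^bsub>M\<^esub> x \<in> K" if "x \<in> carrier M" for x
      using that by (auto simp: colon_def)
    from annihilated_locally[OF P K this] sub show False by (auto simp: colon_def)
  qed
  then obtain x0 where x0: "x0 \<in> carrier M" "colon R M K {x0} \<subseteq> P" by blast
  from maximal_ideal_with[of "colon R M K {x0}" "\<lambda>J. \<exists>x\<in>carrier M. J = colon R M K {x} \<and> J \<subseteq> P",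
      OF ideal_colon_elem[OF K x0(1)]] x0
  obtain I where I: "\<exists>x\<in>carrier M. I = colon R M K {x} \<and> I \<subseteq> P"
    and maxI: "\<And>J. ideal J R \<Longrightarrow> \<exists>x\<in>carrier M. J = colon R M K {x} \<and> J \<subseteq> P \<Longrightarrow> I \<subseteq> J \<Longrightarrow> J = I" by blast
  obtain x where x: "x \<in> carrier M" "colon R M K {x} \<subseteq> P" and Ix: "I = colon R M K {x}" using I by blast
  have max: "colon R M K {y} = colon R M K {x}"
    if "y \<in> carrier M" "colon R M K {y} \<subseteq> P" "colon R M K {x} \<subseteq> colon R M K {y}" for y
    unfolding Ix[symmetric] using that Ix by (intro maxI ideal_colon_elem[OF K]) auto
  let ?I = "colon R M K {x}"
  have "primeideal ?I R"
  proof (rule primeidealI)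
    show "ideal ?I R" by (rule ideal_colon_elem[OF K x(1)])
    show "carrier R \<noteq> ?I" using x(2) primeideal_one[OF P] by auto
    fix a b assume ab: "a \<in> carrier R" "b \<in> carrier R" "a \<otimes> b \<in> ?I"
    show "a \<in> ?I \<or> b \<in> ?I"
    proof (cases "colon R M K {b \<odot>\<^bsub>M\<^esub> x} \<subseteq> P")
      case True
      have "a \<in> colon R M K {b \<odot>\<^bsub>M\<^esub> x}" using colon_elem_smult(2)[OF K x(1) ab(2) ab(1)] ab by simp
      moreover have "colon R M K {b \<odot>\<^bsub>M\<^esub> x} = ?I"
        using max[OF _ True] colon_elem_smult(1)[OF K x(1) ab(2)] ab x by blast
      ultimately show ?thesis by simp
    next
      case False
      then obtain s where s: "s \<in> carrier R" "s \<in> colon R M K {b \<odot>\<^bsub>M\<^esub> x}" "s \<notin> P"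
        by (meson colon_elem_iff subsetI)
      then have sb: "b \<otimes> s \<in> ?I" using colon_elem_smult(2)[OF K x(1) ab(2)] ab by (simp add: R.m_comm)
      then have b: "b \<in> colon R M K {s \<odot>\<^bsub>M\<^esub> x}" using colon_elem_smult(2)[OF K x(1) s(1)] ab by simp
      \<comment> \<open>Since \<open>s\<close> is outside \<open>P\<close>, multiplying
        \<open>x\<close> by it does not lead out of \<open>P\<close>; maximality then gives
        \<open>(K : s x) = (K : x)\<close>, and the left side contains \<open>b\<close>.\<close>
      have "colon R M K {s \<odot>\<^bsub>M\<^esub> x} \<subseteq> P"
      proof
        fix t assume t: "t \<in> colon R M K {s \<odot>\<^bsub>M\<^esub> x}"
        then have tc: "t \<in> carrier R" by (simp add: colon_elem_iff)
        then have "t \<otimes> s \<in> P" using t colon_elem_smult(2)[OF K x(1) s(1) tc] x(2) by blast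
        then show "t \<in> P" using primeideal.I_prime[OF P tc s(1)] s(3) by blast
      qed
      then have "colon R M K {s \<odot>\<^bsub>M\<^esub> x} = ?I"
        using max[of "s \<odot>\<^bsub>M\<^esub> x"] colon_elem_smult(1)[OF K x(1) s(1)] s x by blast
      then show ?thesis using b by simp
    qed
  qed (rule R.is_cring)
  then show ?thesis using x by blast
qed

text \<open>If \<open>(K : u) = P\<close> is prime, \<open>(K + R u) / K\<close> is a copy of
  \<open>R / P\<close>, whose nonzero elements all have annihilator \<open>P\<close>. Enlarging
  \<open>K\<close> by \<open>u\<close> therefore loses at most the prime \<open>P\<close>, and
  noetherian induction applies.\<close>

lemma finite_assoc_primes:
  assumes "submodule K R M"
  shows "finite (assoc_primes R M K)"
proof (rule ccontr)
  assume "infinite (assoc_primes R M K)"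
  from maximal_submodule_with[of K "\<lambda>K. infinite (assoc_primes R M K)", OF assms this]
  obtain K where K: "submodule K R M" and inf: "infinite (assoc_primes R M K)"
    and max: "\<And>K'. submodule K' R M \<Longrightarrow> infinite (assoc_primes R M K') \<Longrightarrow> K \<subseteq> K' \<Longrightarrow> K' = K" by blast
  obtain P where "P \<in> assoc_primes R M K" using inf by (metis ex_in_conv finite.emptyI)
  then obtain u where P: "primeideal P R" and u: "u \<in> carrier M" "P = colon R M K {u}" by (auto simp: assoc_primes_def)
  have uK: "u \<notin> K" using primeideal_one[OF P] u by (auto simp: colon_elem_iff)
  let ?K' = "add_cyclic R M K u"
  have "?K' \<noteq> K" using add_cyclic_self[OF K u(1)] uK by blast
  then have fin: "finite (assoc_primes R M ?K')"
    using max[OF submodule_add_cyclic[OF K u(1)]] add_cyclic_superset[OF K u(1)] by blast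
  have "assoc_primes R M K \<subseteq> insert P (assoc_primes R M ?K')"
  proof
    fix Q assume "Q \<in> assoc_primes R M K"
    then obtain v where Q: "primeideal Q R" and v: "v \<in> carrier M" "Q = colon R M K {v}" by (auto simp: assoc_primes_def)
    show "Q \<in> insert P (assoc_primes R M ?K')"
    proof (cases "\<exists>b\<in>carrier R. b \<odot>\<^bsub>M\<^esub> v \<in> ?K' \<and> b \<odot>\<^bsub>M\<^esub> v \<notin> K")
      case True
      \<comment> \<open>\<open>b v\<close> is nonzero modulo \<open>K\<close> and congruent to some
        \<open>c u\<close>. The annihilator of \<open>b v\<close> is still \<open>Q\<close> and that
        of \<open>c u\<close> is \<open>P\<close>, so the two primes coincide.\<close>
      then obtain b where b: "b \<in> carrier R" "b \<odot>\<^bsub>M\<^esub> v \<in> ?K'" "b \<odot>\<^bsub>M\<^esub> v \<notin> K" by blast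
      then obtain c where c: "c \<in> carrier R" "b \<odot>\<^bsub>M\<^esub> v \<ominus>\<^bsub>M\<^esub> c \<odot>\<^bsub>M\<^esub> u \<in> K" by (auto simp: add_cyclic_def)
      have bQ: "b \<notin> Q" using b v by (simp add: colon_elem_iff)
      have "c \<odot>\<^bsub>M\<^esub> u \<notin> K" using sub_diff_cancel[OF K _ _ c(2)] b c u v by simp
      then have cP: "c \<notin> P" using u c by (simp add: colon_elem_iff)
      have "d \<in> Q \<longleftrightarrow> d \<in> P" if d: "d \<in> carrier R" for d
      proof -
        have "d \<odot>\<^bsub>M\<^esub> (b \<odot>\<^bsub>M\<^esub> v \<ominus>\<^bsub>M\<^esub> c \<odot>\<^bsub>M\<^esub> u) \<in> K" using sub_smult[OF K d c(2)] .
        then have "d \<odot>\<^bsub>M\<^esub> (b \<odot>\<^bsub>M\<^esub> v) \<in> K \<longleftrightarrow> d \<odot>\<^bsub>M\<^esub> (c \<odot>\<^bsub>M\<^esub> u) \<in> K"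
          using sub_diff_cancel[OF K, of "d \<odot>\<^bsub>M\<^esub> (b \<odot>\<^bsub>M\<^esub> v)" "d \<odot>\<^bsub>M\<^esub> (c \<odot>\<^bsub>M\<^esub> u)"] b(1) c(1) u(1) v(1) d
          by (simp add: smult_diff_distr)
        then have "d \<otimes> b \<in> Q \<longleftrightarrow> d \<otimes> c \<in> P" using d b c u v by (simp add: colon_elem_iff smult_assoc1)
        moreover have "d \<otimes> b \<in> Q \<longleftrightarrow> d \<in> Q"
          using primeideal.I_prime[OF Q d b(1)] bQ ideal.I_r_closed[OF primeideal.axioms(1)[OF Q] _ b(1)] by blast
        moreover have "d \<otimes> c \<in> P \<longleftrightarrow> d \<in> P"
          using primeideal.I_prime[OF P d c(1)] cP ideal.I_r_closed[OF primeideal.axioms(1)[OF P] _ c(1)] by blast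
        ultimately show ?thesis by blast
      qed
      then have "Q = P" using primeideal_carr[OF P] primeideal_carr[OF Q] by blast
      then show ?thesis by blast
    next
      case False
      then have "Q = colon R M ?K' {v}"
        using v add_cyclic_superset[OF K u(1)] by (auto simp: colon_elem_iff)
      then show ?thesis using Q v(1) by (auto simp: assoc_primes_def)
    qed
  qed
  then show False using fin inf by (meson finite_insert finite_subset)
qed

text \<open>An ideal maximal among the \<open>(K : x)\<close> that contain \<open>a\<close>, with
  \<open>x\<close> outside \<open>K\<close>, is prime, by comparing \<open>(K : x)\<close> with
  \<open>(K : c x)\<close>.\<close>

lemma assoc_prime_of_zero_divisor:
  assumes K: "submodule K R M" and a: "a \<in> carrier R" and nr: "\<not> regular_mod M K a"
  shows "\<exists>P\<in>assoc_primes R M K. a \<in> P"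
proof -
  obtain y where y: "y \<in> carrier M" "a \<odot>\<^bsub>M\<^esub> y \<in> K" "y \<notin> K" using nr by (auto simp: regular_mod_def)
  then have "\<exists>x\<in>carrier M. colon R M K {y} = colon R M K {x} \<and> x \<notin> K \<and> a \<in> colon R M K {y}"
    using a by (auto simp: colon_elem_iff)
  from maximal_ideal_with[of "colon R M K {y}" "\<lambda>J. \<exists>x\<in>carrier M. J = colon R M K {x} \<and> x \<notin> K \<and> a \<in> J",
      OF ideal_colon_elem[OF K y(1)] this]
  obtain I where I: "\<exists>x\<in>carrier M. I = colon R M K {x} \<and> x \<notin> K \<and> a \<in> I"
    and maxI: "\<And>J. ideal J R \<Longrightarrow> \<exists>x\<in>carrier M. J = colon R M K {x} \<and> x \<notin> K \<and> a \<in> J \<Longrightarrow> I \<subseteq> J \<Longrightarrow> J = I" by blast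
  obtain x where x: "x \<in> carrier M" "x \<notin> K" "a \<in> colon R M K {x}" and Ix: "I = colon R M K {x}" using I by blast
  have max: "colon R M K {y} = colon R M K {x}"
    if "y \<in> carrier M" "y \<notin> K" "a \<in> colon R M K {y}" "colon R M K {x} \<subseteq> colon R M K {y}" for y
    unfolding Ix[symmetric] using that Ix by (intro maxI ideal_colon_elem[OF K]) auto
  let ?I = "colon R M K {x}"
  have "primeideal ?I R"
  proof (rule primeidealI)
    show "ideal ?I R" by (rule ideal_colon_elem[OF K x(1)])
    show "carrier R \<noteq> ?I" using x(1,2) by (metis R.one_closed colon_elem_iff smult_one)
    fix b c assume bc: "b \<in> carrier R" "c \<in> carrier R" "b \<otimes> c \<in> ?I"
    show "b \<in> ?I \<or> c \<in> ?I"
    proof (rule disjCI)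
      assume "c \<notin> ?I"
      then have cx: "c \<odot>\<^bsub>M\<^esub> x \<notin> K" "c \<odot>\<^bsub>M\<^esub> x \<in> carrier M" using bc x by (auto simp: colon_elem_iff)
      note sub = colon_elem_smult(1)[OF K x(1) bc(2)]
      have "b \<in> colon R M K {c \<odot>\<^bsub>M\<^esub> x}" using colon_elem_smult(2)[OF K x(1) bc(2,1)] bc by simp
      then show "b \<in> ?I" using max[OF cx(2,1) _ sub] x(3) sub by blast
    qed
  qed (rule R.is_cring)
  then show ?thesis using x by (auto simp: assoc_primes_def)
qed

lemma not_regular_assoc_prime:
  assumes "P \<in> assoc_primes R M K" "a \<in> P"
  shows "\<not> regular_mod M K a"
proof -
  obtain x where P: "primeideal P R" and x: "x \<in> carrier M" "P = colon R M K {x}"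
    using assms(1) by (auto simp: assoc_primes_def)
  have "x \<notin> K" using primeideal_one[OF P] x by (auto simp: colon_elem_iff)
  then show ?thesis using assms(2) x by (auto simp: regular_mod_def colon_elem_iff)
qed

text \<open>The zero divisors on \<open>M / K\<close> lie in the union of finitely many associated
  primes \<open>(K : x)\<close>. By prime avoidance an ideal of zero divisors lies in one of them,
  and its \<open>x\<close> is the required element.\<close>

lemma annihilated_element_of_zero_divisors:
  assumes K: "submodule K R M" and J: "ideal J R" and nr: "\<And>a. a \<in> J \<Longrightarrow> \<not> regular_mod M K a"
  shows "\<exists>u\<in>carrier M. u \<notin> K \<and> (\<forall>a\<in>J. a \<odot>\<^bsub>M\<^esub> u \<in> K)"
proof -
  have "\<exists>P\<in>assoc_primes R M K. J \<subseteq> P"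
  proof (rule ccontr)
    assume "\<not> ?thesis"
    then have "\<exists>x\<in>J. \<forall>P\<in>assoc_primes R M K. x \<notin> P"
      by (intro R.prime_avoidance finite_assoc_primes[OF K] J) (auto simp: assoc_primes_def)
    then show False using assoc_prime_of_zero_divisor[OF K] ideal.Icarr[OF J] nr by blast
  qed
  then obtain x where P: "primeideal (colon R M K {x}) R" and x: "x \<in> carrier M" "J \<subseteq> colon R M K {x}"
    by (auto simp: assoc_primes_def)
  have "x \<notin> K" using primeideal_one[OF P] x by (auto simp: colon_elem_iff)
  then show ?thesis using x by (meson colon_elem_iff subsetD)
qed

text \<open>The associated primes of all the \<open>M / K\<close> are avoided at once;
  \<open>J\<close> lies in none of them because it contains a regular element for each
  \<open>K\<close>.\<close>

lemma common_regular_element: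
  assumes fin: "finite \<K>" and K: "\<And>K. K \<in> \<K> \<Longrightarrow> submodule K R M" and J: "ideal J R"
    and reg: "\<And>K. K \<in> \<K> \<Longrightarrow> \<exists>a\<in>J. regular_mod M K a"
  shows "\<exists>z\<in>J. \<forall>K\<in>\<K>. regular_mod M K z"
proof -
  have "\<exists>x\<in>J. \<forall>P\<in>(\<Union>K\<in>\<K>. assoc_primes R M K). x \<notin> P"
  proof (rule R.prime_avoidance[OF _ _ J])
    show "finite (\<Union>K\<in>\<K>. assoc_primes R M K)" using fin finite_assoc_primes[OF K] by blast
    show "\<And>P. P \<in> (\<Union>K\<in>\<K>. assoc_primes R M K) \<Longrightarrow> primeideal P R" by (auto simp: assoc_primes_def)
    fix P assume "P \<in> (\<Union>K\<in>\<K>. assoc_primes R M K)"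
    then obtain K where "K \<in> \<K>" "P \<in> assoc_primes R M K" by blast
    then show "\<not> J \<subseteq> P" using reg not_regular_assoc_prime by blast
  qed
  then obtain z where z: "z \<in> J" "\<forall>P\<in>(\<Union>K\<in>\<K>. assoc_primes R M K). z \<notin> P" by blast
  have "regular_mod M K z" if "K \<in> \<K>" for K
    using assoc_prime_of_zero_divisor[OF K[OF that] ideal.Icarr[OF J z(1)]] z(2) that by auto
  then show ?thesis using z(1) by blast
qed

end

section \<open>The height theorem\<close>

lemma prime_chainsD:
  assumes "ps \<in> prime_chains A J"
  shows "ps \<noteq> []" "\<And>P. P \<in> set ps \<Longrightarrow> primeideal P A" "\<And>P. P \<in> set ps \<Longrightarrow> J \<subseteq> P" "sorted_wrt (\<subset>) ps"
  using assms by (auto simp: prime_chains_def)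

lemma prime_chains_hd_subset:
  assumes "ps \<in> prime_chains A J" "P \<in> set ps"
  shows "hd ps \<subseteq> P"
  using prime_chainsD(4)[OF assms(1)] assms(2) by (cases ps) auto

lemma prime_chains_last_subset:
  assumes "ps \<in> prime_chains A J" "P \<in> set ps"
  shows "P \<subseteq> last ps"
  using prime_chainsD(4)[OF assms(1)] assms(2)
  by (cases ps rule: rev_cases) (auto simp: sorted_wrt_append)

lemma prime_chains_hd_last:
  assumes "ps \<in> prime_chains A J" "length ps \<ge> 2"
  shows "hd ps \<subset> last ps"
proof -
  obtain P Q qs where "ps = P # Q # qs" using assms(2) by (metis One_nat_def Suc_1 Suc_le_length_iff)
  then show ?thesis using prime_chainsD(4)[OF assms(1)] by auto
qed

lemma prime_chains_snoc:
  assumes "ps \<in> prime_chains A J" "primeideal Q A" "last ps \<subset> Q"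
  shows "ps @ [Q] \<in> prime_chains A J"
proof -
  have "J \<subseteq> Q" using prime_chainsD(1,3)[OF assms(1)] assms(3) by (meson last_in_set order_trans psubsetE)
  moreover have "P \<subset> Q" if "P \<in> set ps" for P
    using prime_chains_last_subset[OF assms(1) that] assms(3) by (rule subset_psubset_trans)
  ultimately show ?thesis
    using prime_chainsD[OF assms(1)] assms(2) unfolding prime_chains_def by (auto simp: sorted_wrt_append)
qed

lemma prime_chains_singleton: "primeideal P A \<Longrightarrow> J \<subseteq> P \<Longrightarrow> [P] \<in> prime_chains A J"
  by (simp add: prime_chains_def)

context noetherian_cring
begin

abbreviation sat :: "'a set \<Rightarrow> 'a set \<Rightarrow> 'a set" where
  "sat P K \<equiv> saturation R (ring_module R) P K"

lemma sat_iff: "x \<in> sat P K \<longleftrightarrow> x \<in> carrier R \<and> (\<exists>s\<in>carrier R. s \<notin> P \<and> s \<otimes> x \<in> K)"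
  by (auto simp: saturation_def)

lemmas sat_ideal = self.submodule_saturation[unfolded submodule_iff_ideal]
  and sat_superset = self.saturation_superset[unfolded submodule_iff_ideal]

text \<open>This expresses that the localization at a prime minimal over \<open>J0\<close> is Artinian modulo \<open>J0\<close>;
  a strict chain is refuted over a saturated ideal \<open>J\<close> that is maximal among the bases of such chains.\<close>

lemma sat_chain_stabilizes:
  assumes P: "primeideal P R"
    and min: "\<And>Q. primeideal Q R \<Longrightarrow> J0 \<subseteq> Q \<Longrightarrow> Q \<subseteq> P \<Longrightarrow> Q = P"
    and J0: "ideal J0 R"
    and K: "\<And>n. ideal (K n) R" "\<And>n. J0 \<subseteq> K n" "\<And>n. sat P (K n) \<subseteq> K n" "\<And>n. K (Suc n) \<subseteq> K n"
  shows "\<exists>n::nat. K (Suc n) = K n"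
proof (rule ccontr)
  interpret NM: noetherian_module R "ring_module R" by (rule noetherian_ring_module)
  interpret P: primeideal P R by fact
  assume "\<not> ?thesis"
  then have strict: "\<And>n. K (Suc n) \<subset> K n" using K(4) by blast
  define strict_chain where "strict_chain J K \<longleftrightarrow> (\<forall>n. ideal (K n) R \<and> J \<subseteq> K n \<and> sat P (K n) \<subseteq> K n \<and> K (Suc n) \<subset> K n)"
    for J and K :: "nat \<Rightarrow> 'a set"
  define bad where "bad J \<longleftrightarrow> J0 \<subseteq> J \<and> sat P J \<subseteq> J \<and> (\<exists>K. strict_chain J K)" for J
  have "sat P J0 \<subseteq> K n" for n using K(3)[of n] self.saturation_mono[OF K(2)[of n], of P] by (rule order_trans[rotated])
  then have "strict_chain (sat P J0) K" using K strict by (simp add: strict_chain_def)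
  then have "bad (sat P J0)" unfolding bad_def using sat_superset[OF P J0] self.saturation_idem[OF P] by blast
  from maximal_ideal_with[of _ bad, OF sat_ideal[OF P J0] this]
  obtain J where J: "ideal J R" "bad J" and max: "\<And>J'. ideal J' R \<Longrightarrow> bad J' \<Longrightarrow> J \<subseteq> J' \<Longrightarrow> J' = J" by blast
  interpret J: ideal J R by fact
  obtain K where chain: "strict_chain J K" using J(2) by (auto simp: bad_def)
  have J0J: "J0 \<subseteq> J" and satJ: "sat P J \<subseteq> J" using J(2) by (auto simp: bad_def)
  have K: "ideal (K n) R" "J \<subseteq> K n" "sat P (K n) \<subseteq> K n" "K (Suc n) \<subset> K n" for n
    using chain by (auto simp: strict_chain_def)
  have one: "\<one> \<notin> J"
  proof
    assume "\<one> \<in> J"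
    then have c: "J = carrier R" by (rule J.one_imp_carrier)
    have "K (0::nat) \<subseteq> carrier R" using ideal.Icarr[OF K(1)] by blast
    then show False using K(2)[of "Suc 0"] K(4)[of 0] c by blast
  qed
  \<comment> \<open>As \<open>J\<close> is proper, 0 is a zero divisor modulo \<open>J\<close>,
    which yields some associated prime \<open>(J : y)\<close>; minimality of \<open>P\<close> over
    \<open>J0\<close> identifies it with \<open>P\<close>.\<close>
  have "\<not> regular_mod (ring_module R) J \<zero>"
    using one J.zero_closed by (auto simp: regular_mod_def intro!: bexI[of _ \<one>])
  from NM.assoc_prime_of_zero_divisor[OF _ zero_closed this] J(1)
  obtain y where y: "y \<in> carrier R" and Q: "primeideal (colon R (ring_module R) J {y}) R"
    by (auto simp: assoc_primes_def submodule_iff_ideal)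
  note Q_iff = self.colon_elem_iff[of _ J y, simplified]
  have yJ: "y \<notin> J" using primeideal_one[OF Q] y by (simp add: Q_iff)
  have "colon R (ring_module R) J {y} = P"
  proof (rule min[OF Q])
    have "a \<in> colon R (ring_module R) J {y}" if "a \<in> J0" for a
      using that J0J J.Icarr J.I_r_closed y by (auto simp: Q_iff)
    then show "J0 \<subseteq> colon R (ring_module R) J {y}" by blast
    show "colon R (ring_module R) J {y} \<subseteq> P"
    proof (rule subsetI, rule ccontr)
      fix a assume "a \<in> colon R (ring_module R) J {y}" "a \<notin> P"
      then have "y \<in> sat P J" using y by (auto simp: Q_iff sat_iff)
      then show False using satJ yJ by blast
    qed
  qed
  \<comment> \<open>Localized at \<open>P\<close>, \<open>(J + R y) / J\<close> is thus a copy of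
    the residue field and simple: a saturated ideal over \<open>J\<close> contains \<open>y\<close>
    or meets \<open>J + R y\<close> locally only in \<open>J\<close>.\<close>
  then have Py: "a \<otimes> y \<in> J" if "a \<in> P" for a using that Q_iff by blast
  define J' where "J' = sat P (ideal_plus R J y)"
  have idJ': "ideal J' R" unfolding J'_def by (intro sat_ideal P ideal_plus_ideal J(1) y)
  have sup: "J \<subseteq> J'" "y \<in> J'"
    using sat_superset[OF P ideal_plus_ideal[OF J(1) y]] ideal_plus_superset[OF J(1) y] ideal_plus_self[OF J(1) y]
    unfolding J'_def by blast+
  have "J' \<noteq> J" using sup(2) yJ by blast
  then have good: "\<not> bad J'" using max[OF idJ' _ sup(1)] by blast
  have satJ': "sat P J' \<subseteq> J'" unfolding J'_def by (rule self.saturation_idem[OF P])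
  have nochain: "\<not> strict_chain J' K'" for K' using good satJ' J0J sup(1) unfolding bad_def by blast
  \<comment> \<open>Otherwise the chain would lie over \<open>J'\<close>, which admits no strict
    chain.\<close>
  have "\<exists>m. y \<notin> K m"
  proof (rule ccontr)
    assume "\<not> ?thesis"
    then have y': "y \<in> K n" for n by blast
    have "J' \<subseteq> K n" for n
      unfolding J'_def
      by (rule order_trans[OF self.saturation_mono[OF ideal_plus_minimal[OF K(1,2) y']] K(3)])
    then have "strict_chain J' K" using K by (simp add: strict_chain_def)
    then show False using nochain by blast
  qed
  then obtain m where m: "y \<notin> K m" by blast
  have dec: "K (m + n) \<subseteq> K m" for n
  proof (induction n)
    case (Suc n) then show ?case using K(4)[of "m + n"] by auto
  qed simp
  define K' where "K' n = sat P (ideal_plus R (K (m + n)) y)" for n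
  have plus: "ideal (ideal_plus R (K n) y) R" for n by (rule ideal_plus_ideal[OF K(1) y])
  \<comment> \<open>Adding \<open>y\<close> turns the tail of the chain into one over
    \<open>J'\<close>, so two successive terms become equal.\<close>
  have "\<exists>n. \<not> (K' (Suc n) \<subset> K' n)"
  proof (rule ccontr)
    assume neg: "\<not> ?thesis"
    have "ideal (K' n) R" "J' \<subseteq> K' n" "sat P (K' n) \<subseteq> K' n" for n
    proof -
      show "ideal (K' n) R" unfolding K'_def by (rule sat_ideal[OF P plus])
      show "J' \<subseteq> K' n" unfolding K'_def J'_def
        using ideal_plus_minimal[OF plus order_trans[OF K(2) ideal_plus_superset[OF K(1) y]] ideal_plus_self[OF K(1) y]]
        by (rule self.saturation_mono)
      show "sat P (K' n) \<subseteq> K' n" unfolding K'_def by (rule self.saturation_idem[OF P])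
    qed
    then have "strict_chain J' K'" using neg by (simp add: strict_chain_def)
    then show False using nochain by blast
  qed
  then obtain n where n: "\<not> K' (Suc n) \<subset> K' n" by blast
  have "K (m + Suc n) \<subseteq> ideal_plus R (K (m + n)) y"
    using K(4)[of "m + n"] ideal_plus_superset[OF K(1)[of "m + n"] y] by auto
  then have "K' (Suc n) \<subseteq> K' n" unfolding K'_def
    using ideal_plus_minimal[OF plus _ ideal_plus_self[OF K(1) y]] by (intro self.saturation_mono) blast
  then have eq: "K' (Suc n) = K' n" using n by blast
  obtain b where b: "b \<in> K (m + n)" "b \<notin> K (Suc (m + n))" using K(4)[of "m + n"] by blast
  have bc: "b \<in> carrier R" using b ideal.Icarr[OF K(1)] by blast
  have "b \<in> K' n" unfolding K'_def
    using b sat_superset[OF P plus[of "m + n"]] ideal_plus_superset[OF K(1)[of "m + n"] y] by blast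
  then have "b \<in> sat P (ideal_plus R (K (Suc (m + n))) y)" using eq by (simp add: K'_def)
  then obtain s t where s: "s \<in> carrier R" "s \<notin> P" and t: "t \<in> carrier R" "s \<otimes> b \<ominus> t \<otimes> y \<in> K (Suc (m + n))"
    unfolding sat_iff ideal_plus_iff by blast
  note cancel = ideal_diff_cancel[OF K(1), of "s \<otimes> b" "t \<otimes> y"]
  have sb: "s \<otimes> b \<in> K (m + n)" using b s ideal.I_l_closed[OF K(1)] by blast
  have ty: "t \<otimes> y \<in> K (m + n)"
    using cancel[of "m + n"] K(4)[of "m + n"] t s bc y sb by blast
  show False
  \<comment> \<open>Modulo the next term, \<open>s b\<close> is \<open>t y\<close>. For
    \<open>t \<in> P\<close> this lies in \<open>J\<close>, and saturation brings \<open>b\<close>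
    into the next term; for \<open>t \<notin> P\<close> it makes \<open>y\<close> a member of
    \<open>K (m + n)\<close>, against the choice of \<open>m\<close>.\<close>
  proof (cases "t \<in> P")
    case True
    then have "s \<otimes> b \<in> K (Suc (m + n))" using cancel[of "Suc (m + n)"] Py K(2)[of "Suc (m + n)"] t s bc y by blast
    then have "b \<in> sat P (K (Suc (m + n)))" using s bc by (auto simp: sat_iff)
    then show False using K(3) b by blast
  next
    case False
    then have "y \<in> sat P (K (m + n))" using ty t y by (auto simp: sat_iff)
    then show False using K(3) dec m by blast
  qed
qed

lemma pow_not_in_prime:
  assumes "primeideal P R" "y \<in> carrier R" "y \<notin> P" shows "y [^] (n::nat) \<notin> P"
proof (induction n)
  case 0 then show ?case using primeideal_one[OF assms(1)] by simp
next
  case (Suc n)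
  then show ?case using primeideal.I_prime[OF assms(1) nat_pow_closed[OF assms(2)] assms(2), of n] assms(3) by auto
qed

text \<open>The symbolic powers in the usual proof are replaced by the contractions \<open>Y n\<close> of
  \<open>Q0 + (y ^ n)\<close> from the localization at \<open>Q\<close>, where \<open>y \<in> Q - Q0\<close>.\<close>

lemma krull_principal_ideal:
  assumes primes: "primeideal Q0 R" "primeideal Q R" "primeideal P R" and sub: "Q0 \<subset> Q" "Q \<subset> P"
    and x: "x \<in> P"
    and min: "\<And>P'. primeideal P' R \<Longrightarrow> Q0 \<subseteq> P' \<Longrightarrow> x \<in> P' \<Longrightarrow> P' \<subseteq> P \<Longrightarrow> P' = P"
  shows False
proof -
  interpret NM: noetherian_module R "ring_module R" by (rule noetherian_ring_module)
  interpret Q0: primeideal Q0 R by fact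
  interpret Q: primeideal Q R by fact
  interpret P: primeideal P R by fact
  have xc: "x \<in> carrier R" using x P.Icarr by blast
  have xQ: "x \<notin> Q" using min[OF primes(2)] sub by blast
  obtain y where y: "y \<in> Q" "y \<notin> Q0" using sub by blast
  have yc: "y \<in> carrier R" using y Q.Icarr by blast
  then have ync: "y [^] n \<in> carrier R" for n :: nat by simp
  let ?I = "\<lambda>n. ideal_plus R Q0 (y [^] n)"
  define Y where "Y n = sat Q (?I n)" for n :: nat
  have I: "ideal (?I n) R" for n :: nat by (rule ideal_plus_ideal[OF Q0.is_ideal ync])
  have Yid: "ideal (Y n) R" for n unfolding Y_def by (rule sat_ideal[OF primes(2) I])
  have Ysat: "sat Q (Y n) \<subseteq> Y n" for n unfolding Y_def by (rule self.saturation_idem[OF primes(2)])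
  \<comment> \<open>The complement of \<open>P\<close> is contained in that of \<open>Q\<close>, so
    saturation at \<open>P\<close> adds nothing, and Nakayama's lemma at \<open>P\<close> becomes
    applicable.\<close>
  have YsatP: "sat P (Y n) \<subseteq> Y n" for n using Ysat[of n] sub(2) by (auto simp: saturation_def)
  have "y [^] Suc n \<in> ?I n" for n
    using ideal.I_r_closed[OF I ideal_plus_self[OF Q0.is_ideal ync] yc, of n] by simp
  then have Ydec: "Y (Suc n) \<subseteq> Y n" for n
    unfolding Y_def by (intro self.saturation_mono ideal_plus_minimal[OF I] ideal_plus_superset Q0.is_ideal ync)
  define K where "K n = sat P (ideal_plus R (Y n) x)" for n
  have plus: "ideal (ideal_plus R (Y n) x) R" for n by (rule ideal_plus_ideal[OF Yid xc])
  have Q0Y: "Q0 \<subseteq> Y n" for n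
    unfolding Y_def by (rule order_trans[OF ideal_plus_superset[OF Q0.is_ideal ync] sat_superset[OF primes(2) I]])
  \<comment> \<open>All terms contain \<open>Q0 + R x\<close>, over which \<open>P\<close> is
    minimal.\<close>
  have "\<exists>n. K (Suc n) = K n"
  proof (rule sat_chain_stabilizes[OF primes(3)])
    show "ideal (ideal_plus R Q0 x) R" by (rule ideal_plus_ideal[OF Q0.is_ideal xc])
    show "Q' = P" if "primeideal Q' R" "ideal_plus R Q0 x \<subseteq> Q'" "Q' \<subseteq> P" for Q'
      using min[OF that(1) _ _ that(3)] that(2) ideal_plus_superset[OF Q0.is_ideal xc] ideal_plus_self[OF Q0.is_ideal xc]
      by blast
    show "ideal (K n) R" for n unfolding K_def by (rule sat_ideal[OF primes(3) plus])
    show "ideal_plus R Q0 x \<subseteq> K n" for n unfolding K_def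
      using ideal_plus_minimal[OF plus order_trans[OF Q0Y ideal_plus_superset[OF Yid xc]] ideal_plus_self[OF Yid xc]]
        sat_superset[OF primes(3) plus] by (rule order_trans)
    show "sat P (K n) \<subseteq> K n" for n unfolding K_def by (rule self.saturation_idem[OF primes(3)])
    show "K (Suc n) \<subseteq> K n" for n unfolding K_def
      by (intro self.saturation_mono ideal_plus_minimal[OF plus] order_trans[OF Ydec ideal_plus_superset[OF Yid xc]]
          ideal_plus_self[OF Yid xc])
  qed
  then obtain n where n: "K (Suc n) = K n" by blast
  \<comment> \<open>If \<open>s a = c x\<close> modulo \<open>Y (n + 1)\<close> with
    \<open>a \<in> Y n\<close>, then \<open>c x \<in> Y n\<close>, and \<open>x \<notin> Q\<close>
    gives \<open>c \<in> Y n\<close>. So \<open>Y n\<close> lies in \<open>Y (n + 1) + x Y n\<close>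
    up to saturation at \<open>P\<close>, and Nakayama's lemma removes the second summand.\<close>
  have "Y n \<subseteq> Y (Suc n)"
  proof (rule NM.local_nakayama[OF primes(3), of "{x}"])
    show "{x} \<subseteq> P" using x by simp
    show "submodule (Y (Suc n)) R (ring_module R)" using Yid by (simp add: submodule_iff_ideal)
    show "sat P (Y (Suc n)) \<subseteq> Y (Suc n)" by (rule YsatP)
    show "Y n \<subseteq> carrier (ring_module R)" using ideal.Icarr[OF Yid] by auto
    fix V assume "submodule V R (ring_module R)" and V: "Y (Suc n) \<subseteq> V" "sat P V \<subseteq> V"
      and xV: "\<And>a u. a \<in> {x} \<Longrightarrow> u \<in> Y n \<Longrightarrow> a \<odot>\<^bsub>ring_module R\<^esub> u \<in> V"
    then have idV: "ideal V R" by (simp add: submodule_iff_ideal)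
    show "Y n \<subseteq> V"
    proof
      fix a assume a: "a \<in> Y n"
      have ac: "a \<in> carrier R" using a ideal.Icarr[OF Yid] by blast
      have "a \<in> K n" unfolding K_def
        using a ideal_plus_superset[OF Yid xc, of n] sat_superset[OF primes(3) plus, of n] by blast
      then have "a \<in> sat P (ideal_plus R (Y (Suc n)) x)" using n by (simp add: K_def)
      then obtain s c where s: "s \<in> carrier R" "s \<notin> P" and c: "c \<in> carrier R" "s \<otimes> a \<ominus> c \<otimes> x \<in> Y (Suc n)"
        unfolding sat_iff ideal_plus_iff by blast
      have "s \<otimes> a \<in> Y n" using ideal.I_l_closed[OF Yid a s(1)] .
      then have "c \<otimes> x \<in> Y n"
        using ideal_diff_cancel[OF Yid, of "s \<otimes> a" "c \<otimes> x" n] c Ydec[of n] s ac xc by blast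
      then have "c \<in> sat Q (Y n)" using c xc xQ by (auto simp: sat_iff m_comm[of c x])
      then have "x \<otimes> c \<in> V" using Ysat xV[of x c] by auto
      then have "s \<otimes> a \<in> V"
        using ideal_diff_cancel[OF idV, of "s \<otimes> a" "c \<otimes> x"] c V(1) s ac xc m_comm[of c x] by auto
      then have "a \<in> sat P V" using s ac by (auto simp: sat_iff)
      then show "a \<in> V" using V(2) by blast
    qed
  qed
  moreover have "y [^] n \<in> Y n" unfolding Y_def
    using ideal_plus_self[OF Q0.is_ideal ync] sat_superset[OF primes(2) I] by blast
  ultimately have "y [^] n \<in> sat Q (?I (Suc n))" unfolding Y_def by blast
  then obtain s t where s: "s \<in> carrier R" "s \<notin> Q" and t: "t \<in> carrier R" "s \<otimes> y [^] n \<ominus> t \<otimes> y [^] Suc n \<in> Q0"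
    unfolding sat_iff ideal_plus_iff by blast
  have "s \<otimes> y [^] n \<ominus> t \<otimes> y [^] Suc n = s \<otimes> y [^] n \<ominus> t \<otimes> (y [^] n \<otimes> y)" by simp
  also have "\<dots> = (s \<ominus> t \<otimes> y) \<otimes> y [^] n" using s(1) t(1) yc ync[of n] by algebra
  finally have "(s \<ominus> t \<otimes> y) \<otimes> y [^] n \<in> Q0" using t(2) by simp
  \<comment> \<open>\<open>Q0\<close> is prime and \<open>y\<close> is outside, so the power of
    \<open>y\<close> cancels; as \<open>y \<in> Q\<close>, the denominator \<open>s\<close> would
    lie in \<open>Q\<close>.\<close>
  then have "s \<ominus> t \<otimes> y \<in> Q0"
    using Q0.I_prime[of "s \<ominus> t \<otimes> y" "y [^] n"] pow_not_in_prime[OF primes(1) yc y(2)] s t yc by auto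
  then have "s \<in> Q"
    using ideal_diff_cancel[OF Q.is_ideal, of s "t \<otimes> y"] sub(1) s t yc Q.I_l_closed[OF y(1) t(1)] by blast
  then show False using s by blast
qed

text \<open>The chain is moved into \<open>x\<close> from the top: whenever \<open>x\<close> lies in \<open>P\<^sub>i\<^sub>+\<^sub>1\<close> but not in \<open>P\<^sub>i\<close>, a prime
  minimal over \<open>P\<^sub>i\<^sub>-\<^sub>1\<close> and \<open>x\<close> replaces \<open>P\<^sub>i\<close>; it is not \<open>P\<^sub>i\<^sub>+\<^sub>1\<close> by the principal ideal theorem.\<close>

lemma prime_chain_through:
  assumes "ps \<in> prime_chains R {}" "length ps \<ge> 2" "x \<in> last ps"
  shows "\<exists>P Q qs. P # Q # qs \<in> prime_chains R {} \<and> length (P # Q # qs) = length ps \<and> P = hd ps \<and>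
    last (Q # qs) = last ps \<and> x \<in> Q"
  using assms
proof (induction ps)
  case (Cons P0 ps)
  obtain P1 rs where ps: "ps = P1 # rs" using Cons.prems(2) by (cases ps) auto
  show ?case
  proof (cases "rs = [] \<or> x \<in> P1")
    case True
    then have "x \<in> P1" using Cons.prems(3) ps by auto
    then show ?thesis using Cons.prems ps by (intro exI[of _ P0] exI[of _ P1] exI[of _ rs]) auto
  next
    case False
    have pr: "P0 \<subset> P1" "primeideal P0 R" "primeideal P1 R" "ps \<in> prime_chains R {}"
      using Cons.prems(1) ps by (auto simp: prime_chains_def)
    have len: "length ps \<ge> 2" "x \<in> last ps" using False Cons.prems(3) ps by (cases rs; auto)+
    from Cons.IH[OF pr(4) len] obtain Q qs where Q: "P1 # Q # qs \<in> prime_chains R {}"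
      "length (P1 # Q # qs) = length ps" "last (Q # qs) = last ps" "x \<in> Q"
      using ps by auto
    have Qp: "primeideal Q R" "P1 \<subset> Q" "Q # qs \<in> prime_chains R {}" using Q(1) by (auto simp: prime_chains_def)
    obtain P' where P': "primeideal P' R" "insert x P0 \<subseteq> P'" "P' \<subseteq> Q"
      "\<forall>Q'. primeideal Q' R \<longrightarrow> insert x P0 \<subseteq> Q' \<longrightarrow> Q' \<subseteq> P' \<longrightarrow> Q' = P'"
      using minimal_prime_exists[OF Qp(1), of "insert x P0"] Q(4) pr(1) Qp(2) by blast
    have "P' \<noteq> Q"
    proof
      assume "P' = Q"
      then show False using krull_principal_ideal[OF pr(2,3) Qp(1) pr(1) Qp(2) Q(4)] P'(4) by blast
    qed
    then have "P' # Q # qs \<in> prime_chains R {}" using prime_chains_Cons[OF Qp(3) _ P'(1)] P'(3) by auto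
    moreover have "P0 \<subset> P'" using P'(2) False pr(1) by blast
    ultimately have "P0 # P' # Q # qs \<in> prime_chains R {}" using prime_chains_Cons[OF _ _ pr(2)] by auto
    then show ?thesis
      using Q(2,3) P'(2) ps by (intro exI[of _ P0] exI[of _ P'] exI[of _ "Q # qs"]) auto
  qed
qed simp

text \<open>Induction on the number of elements: \<open>prime_chain_through\<close> makes the second
  prime of the chain contain \<open>x\<close>, and dropping the first leaves a chain over
  \<open>J\<close> and \<open>x\<close>, where \<open>P\<close> is still minimal. With no elements
  left, \<open>P\<close> is minimal over \<open>J\<close> and the only member of the chain.\<close>

theorem krull_height:
  assumes P: "primeideal P R" "J \<union> set xs \<subseteq> P"
    and min: "\<And>P'. primeideal P' R \<Longrightarrow> J \<union> set xs \<subseteq> P' \<Longrightarrow> P' \<subseteq> P \<Longrightarrow> P' = P"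
    and ps: "ps \<in> prime_chains R J" "last ps = P"
  shows "length ps \<le> Suc (length xs)"
  using P(2) min ps
proof (induction xs arbitrary: J ps)
  case Nil
  have hd: "hd ps \<in> set ps" using prime_chainsD(1)[OF Nil(3)] by simp
  have "hd ps = P"
    using Nil(2)[of "hd ps"] prime_chainsD(2,3)[OF Nil(3) hd] prime_chains_last_subset[OF Nil(3) hd] Nil(4) by auto
  then have "\<not> length ps \<ge> 2" using prime_chains_hd_last[OF Nil(3)] Nil(4) by auto
  then show ?case by simp
next
  case (Cons x xs)
  show ?case
  proof (cases "length ps \<ge> 2")
    case True
    have ps': "ps \<in> prime_chains R {}" using Cons.prems(3) by (auto simp: prime_chains_def)
    obtain Q0 Q qs where Q: "Q0 # Q # qs \<in> prime_chains R {}" "length (Q0 # Q # qs) = length ps" "Q0 = hd ps"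
      "last (Q # qs) = last ps" "x \<in> Q"
      using prime_chain_through[OF ps' True, of x] Cons.prems(1,4) by auto
    have c: "Q # qs \<in> prime_chains R {}" "Q0 \<subseteq> Q" using Q(1) by (auto simp: prime_chains_def)
    have "hd ps \<in> set ps" using True by (cases ps) auto
    then have "J \<subseteq> Q0" using prime_chainsD(3)[OF Cons.prems(3)] Q(3) by blast
    then have sub: "insert x J \<subseteq> Q" using c(2) Q(5) by blast
    have "insert x J \<subseteq> P'" if "P' \<in> set (Q # qs)" for P'
      using prime_chains_hd_subset[OF c(1) that] sub by auto
    then have "Q # qs \<in> prime_chains R (insert x J)"
      using prime_chainsD[OF c(1)] unfolding prime_chains_def by blast
    then have "length (Q # qs) \<le> Suc (length xs)"
    proof (rule Cons.IH[rotated 2])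
      show "insert x J \<union> set xs \<subseteq> P" using Cons.prems(1) by auto
      show "last (Q # qs) = P" using Q(4) Cons.prems(4) by simp
      show "P' = P" if "primeideal P' R" "insert x J \<union> set xs \<subseteq> P'" "P' \<subseteq> P" for P'
        using Cons.prems(2)[OF that(1) _ that(3)] that(2) by simp
    qed
    then show ?thesis using Q(2) by simp
  qed simp
qed

end

section \<open>Dimension in a noetherian local ring\<close>

context noetherian_local_ring
begin

text \<open>The height theorem bounds chains that end in \<open>\<mm>\<close>; a chain ending lower
  is first prolonged by \<open>\<mm>\<close>.\<close>

lemma dim_over_le_length:
  assumes xs: "set xs \<subseteq> \<mm>" and only: "\<And>P. primeideal P R \<Longrightarrow> J \<union> set xs \<subseteq> P \<Longrightarrow> P = \<mm>"
  shows "dim_over R J \<le> ereal (real (length xs))"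
  unfolding dim_over_def
proof (rule SUP_least)
  fix ps assume ps: "ps \<in> prime_chains R J"
  have last: "last ps \<in> set ps" using prime_chainsD(1)[OF ps] by simp
  have lm: "last ps \<subseteq> \<mm>" using prime_subset_maximal prime_chainsD(2)[OF ps last] by blast
  obtain qs where qs: "qs \<in> prime_chains R J" "last qs = \<mm>" "length ps \<le> length qs"
  proof (cases "last ps = \<mm>")
    case True
    then show ?thesis using that[of ps] ps by simp
  next
    case False
    then have "ps @ [\<mm>] \<in> prime_chains R J" using prime_chains_snoc[OF ps maximal_prime] lm by blast
    then show ?thesis using that[of "ps @ [\<mm>]"] by simp
  qed
  have "J \<subseteq> \<mm>" using lm prime_chainsD(3)[OF ps last] by blast
  then have "length qs \<le> Suc (length xs)"
    using krull_height[OF maximal_prime, of J xs qs] xs only qs by blast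
  then show "ereal (real (length ps - 1)) \<le> ereal (real (length xs))" using qs(3) by auto
qed

text \<open>A finite generating set of \<open>\<mm>\<close> is contained in no other prime, so its
  size bounds every dimension.\<close>

lemma dim_over_finite: "dim_over R J < \<infinity>"
proof -
  have "ideal \<mm> R" using maximal_prime primeideal.axioms(1) by blast
  then obtain Y where Y: "Y \<subseteq> carrier R" "finite Y" "\<mm> = Idl Y" using finetely_gen by blast
  obtain xs where xs: "set xs = Y" using finite_list[OF Y(2)] by blast
  have "dim_over R J \<le> ereal (real (length xs))"
  proof (rule dim_over_le_length)
    show "set xs \<subseteq> \<mm>" using genideal_self[OF Y(1)] xs Y(3) by simp
    fix P assume P: "primeideal P R" "J \<union> set xs \<subseteq> P"
    then have "\<mm> \<subseteq> P" using genideal_minimal[OF primeideal.axioms(1)[OF P(1)], of Y] xs Y(3) by simp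
    then show "P = \<mm>" using prime_subset_maximal[OF P(1)] by blast
  qed
  then show ?thesis by (rule order_le_less_trans) simp
qed

lemma dim_over_nonneg:
  assumes "ideal J R" "J \<noteq> carrier R"
  shows "0 \<le> dim_over R J"
  using dim_over_upper[OF prime_chains_singleton[OF maximal_prime proper_ideal_subset[OF assms]]]
  by (simp add: zero_ereal_def)

text \<open>Choose \<open>x\<close> in \<open>\<mm>\<close> outside all members other than
  \<open>\<mm>\<close> of a finite set of primes reaching below every prime over \<open>J\<close>. A
  chain over \<open>J + R x\<close> can then be prolonged downwards by such a prime, so adding
  \<open>x\<close> lowers the dimension.\<close>

lemma system_of_parameters:
  assumes "ideal J R" "dim_over R J \<le> ereal (real d)"
  shows "\<exists>xs. length xs \<le> d \<and> set xs \<subseteq> \<mm> \<and> (\<forall>P. primeideal P R \<longrightarrow> J \<union> set xs \<subseteq> P \<longrightarrow> P = \<mm>)"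
  using assms
proof (induction d arbitrary: J)
  case 0
  have "P = \<mm>" if P: "primeideal P R" "J \<subseteq> P" for P
  proof (rule ccontr)
    assume "P \<noteq> \<mm>"
    then have "[P] @ [\<mm>] \<in> prime_chains R J"
      using prime_subset_maximal[OF P(1)] by (intro prime_chains_snoc prime_chains_singleton P maximal_prime) auto
    from dim_over_upper[OF this] have "1 \<le> dim_over R J" by (simp add: one_ereal_def)
    from order_trans[OF this 0(2)] show False by simp
  qed
  then show ?case by (intro exI[of _ "[]"]) auto
next
  case (Suc d)
  obtain F where F: "finite F" "\<And>P. P \<in> F \<Longrightarrow> primeideal P R \<and> J \<subseteq> P"
    "\<And>Q. primeideal Q R \<Longrightarrow> J \<subseteq> Q \<Longrightarrow> \<exists>P\<in>F. P \<subseteq> Q"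
    using ideal_finite_primes[OF Suc.prems(1)] by blast
  have "\<exists>x\<in>\<mm>. \<forall>P\<in>F - {\<mm>}. x \<notin> P"
  proof (rule prime_avoidance)
    show "\<not> \<mm> \<subseteq> P" if "P \<in> F - {\<mm>}" for P
      using that F(2) prime_subset_maximal[of P] by blast
  qed (use F maximal_prime primeideal.axioms(1) in auto)
  then obtain x where x: "x \<in> \<mm>" "\<And>P. P \<in> F \<Longrightarrow> P \<noteq> \<mm> \<Longrightarrow> x \<notin> P" by blast
  have xc: "x \<in> carrier R" using primeideal_carr[OF maximal_prime x(1)] .
  let ?J = "ideal_plus R J x"
  have J': "ideal ?J R" "J \<subseteq> ?J" "x \<in> ?J"
    using ideal_plus_ideal[OF Suc.prems(1) xc] ideal_plus_superset[OF Suc.prems(1) xc] ideal_plus_self[OF Suc.prems(1) xc]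
    by auto
  have "dim_over R ?J \<le> ereal (real d)"
    unfolding dim_over_def
  proof (rule SUP_least)
    fix qs assume qs: "qs \<in> prime_chains R ?J"
    have hd: "hd qs \<in> set qs" using prime_chainsD(1)[OF qs] by simp
    note h = prime_chainsD(2,3)[OF qs hd]
    obtain p where p: "p \<in> F" "p \<subseteq> hd qs" using F(3)[OF h(1)] h(2) J'(2) by blast
    show "ereal (real (length qs - 1)) \<le> ereal (real d)"
    proof (cases "p = \<mm>")
      case True
      have l: "last qs \<in> set qs" using prime_chainsD(1)[OF qs] by simp
      \<comment> \<open>Here \<open>\<mm>\<close> lies below the whole chain, which therefore
        consists of a single prime.\<close>
      have "last qs \<subseteq> hd qs" using True p(2) prime_subset_maximal[OF prime_chainsD(2)[OF qs l]] by blast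
      then have "\<not> length qs \<ge> 2" using prime_chains_hd_last[OF qs] by blast
      then show ?thesis by simp
    next
      case False
      then have "p \<subset> hd qs" using x(2) p h(2) J'(3) by blast
      then have "p # qs \<in> prime_chains R J" using prime_chains_Cons[OF qs J'(2)] F(2)[OF p(1)] by blast
      from order_trans[OF dim_over_upper[OF this] Suc.prems(2)] show ?thesis by simp
    qed
  qed
  from Suc.IH[OF J'(1) this] obtain xs where xs: "length xs \<le> d" "set xs \<subseteq> \<mm>"
    "\<And>P. primeideal P R \<Longrightarrow> ?J \<union> set xs \<subseteq> P \<Longrightarrow> P = \<mm>" by blast
  have "P = \<mm>" if P: "primeideal P R" "J \<union> set (x # xs) \<subseteq> P" for P
    using xs(3)[OF P(1)] ideal_plus_minimal[OF primeideal.axioms(1)[OF P(1)], of J x] P(2) by simp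
  then show ?case using xs(1,2) x(1) by (intro exI[of _ "x # xs"]) simp
qed

end

section \<open>Regular sequences and grade\<close>

abbreviation add_mults :: "('a, 'l, 'k) module_scheme \<Rightarrow> 'l set \<Rightarrow> 'a list \<Rightarrow> 'l set" where
  "add_mults L K xs \<equiv> foldl (add_mult L) K xs"

text \<open>Weakly regular sequences on \<open>L / K\<close>: the modulus is an argument growing
  along the list, which suits induction, and properness of the last quotient is not
  demanded.\<close>

fun regular_seq_mod :: "('a, 'l, 'k) module_scheme \<Rightarrow> 'l set \<Rightarrow> 'a list \<Rightarrow> bool" where
  "regular_seq_mod L K [] \<longleftrightarrow> True"
| "regular_seq_mod L K (x # xs) \<longleftrightarrow> regular_mod L K x \<and> regular_seq_mod L (add_mult L K x) xs"

definition maximal_regular_seq_mod ::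
    "'a set \<Rightarrow> ('a, 'l, 'k) module_scheme \<Rightarrow> 'l set \<Rightarrow> 'a list \<Rightarrow> bool" where
  "maximal_regular_seq_mod J L K xs \<longleftrightarrow>
     set xs \<subseteq> J \<and> regular_seq_mod L K xs \<and> (\<forall>z\<in>J. \<not> regular_mod L (add_mults L K xs) z)"

lemma regular_seq_mod_append:
  "regular_seq_mod L K (xs @ ys) \<longleftrightarrow> regular_seq_mod L K xs \<and> regular_seq_mod L (add_mults L K xs) ys"
  by (induction xs arbitrary: K) auto

lemma regular_seq_mod_nth:
  "regular_seq_mod L K xs \<longleftrightarrow> (\<forall>i<length xs. regular_mod L (add_mults L K (take i xs)) (xs ! i))"
proof (induction xs rule: rev_induct)
  case (snoc x xs)
  have "(\<forall>i<length (xs @ [x]). regular_mod L (add_mults L K (take i (xs @ [x]))) ((xs @ [x]) ! i)) \<longleftrightarrow>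
    (\<forall>i<length xs. regular_mod L (add_mults L K (take i xs)) (xs ! i)) \<and> regular_mod L (add_mults L K xs) x"
    by (auto simp: less_Suc_eq nth_append)
  then show ?case using snoc by (simp add: regular_seq_mod_append)
qed simp

context module
begin

lemma diff_add_diff:
  assumes "x \<in> carrier M" "y \<in> carrier M" "z \<in> carrier M"
  shows "(x \<ominus>\<^bsub>M\<^esub> y) \<oplus>\<^bsub>M\<^esub> (y \<ominus>\<^bsub>M\<^esub> z) = x \<ominus>\<^bsub>M\<^esub> z"
  using assms by (simp add: a_minus_def M.a_assoc M.r_neg1)

lemma diff_diff_cancel:
  assumes "x \<in> carrier M" "y \<in> carrier M" "z \<in> carrier M"
  shows "(x \<ominus>\<^bsub>M\<^esub> y) \<ominus>\<^bsub>M\<^esub> (x \<ominus>\<^bsub>M\<^esub> z) = z \<ominus>\<^bsub>M\<^esub> y"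
proof -
  have "(x \<ominus>\<^bsub>M\<^esub> y) \<ominus>\<^bsub>M\<^esub> (x \<ominus>\<^bsub>M\<^esub> z) = (z \<ominus>\<^bsub>M\<^esub> x) \<oplus>\<^bsub>M\<^esub> (x \<ominus>\<^bsub>M\<^esub> y)"
    using assms by (simp add: a_minus_def M.minus_add M.a_ac)
  then show ?thesis using diff_add_diff assms by simp
qed

lemma submodule_add_mults:
  "submodule K R M \<Longrightarrow> set xs \<subseteq> carrier R \<Longrightarrow> submodule (add_mults M K xs) R M"
  by (induction xs arbitrary: K) (auto intro: submodule_add_mult)

lemma add_mults_add_mult_commute:
  assumes "submodule K R M" "set xs \<subseteq> carrier R" "z \<in> carrier R"
  shows "add_mults M (add_mult M K z) xs = add_mult M (add_mults M K xs) z"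
  using assms
proof (induction xs arbitrary: K)
  case (Cons x xs)
  then have x: "x \<in> carrier R" "set xs \<subseteq> carrier R" by auto
  have "add_mults M (add_mult M K z) (x # xs) = add_mults M (add_mult M (add_mult M K x) z) xs"
    using add_mult_commute[OF Cons.prems(1) Cons.prems(3) x(1)] by simp
  then show ?case using Cons.IH[OF submodule_add_mult[OF Cons.prems(1) x(1)] x(2) Cons.prems(3)] by simp
qed simp

lemma regular_seq_iff:
  "regular_seq R M xs \<longleftrightarrow>
     set xs \<subseteq> carrier R \<and> regular_seq_mod M {\<zero>\<^bsub>M\<^esub>} xs \<and> set_smult R (set xs) M \<noteq> carrier M"
proof (cases "set xs \<subseteq> carrier R")
  case True
  have "(\<forall>y\<in>carrier (quot_module M (set_smult R (set (take i xs)) M)).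
      xs ! i \<odot>\<^bsub>quot_module M (set_smult R (set (take i xs)) M)\<^esub> y = \<zero>\<^bsub>quot_module M (set_smult R (set (take i xs)) M)\<^esub> \<longrightarrow>
      y = \<zero>\<^bsub>quot_module M (set_smult R (set (take i xs)) M)\<^esub>) \<longleftrightarrow>
    regular_mod M (add_mults M {\<zero>\<^bsub>M\<^esub>} (take i xs)) (xs ! i)" if "i < length xs" for i
  proof -
    have t: "set (take i xs) \<subseteq> carrier R" using True set_take_subset[of i xs] by blast
    have x: "xs ! i \<in> carrier R" using True that by auto
    show ?thesis
      unfolding set_smult_list[OF t]
      by (rule quot_regular_iff[OF submodule_add_mults[OF submodule_zero t] x, folded regular_mod_def])
  qed
  then show ?thesis using True by (simp add: regular_seq_def regular_seq_mod_nth Let_def)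
qed (simp add: regular_seq_def)

text \<open>From \<open>x y = z v\<close> modulo \<open>K\<close>, regularity of \<open>z\<close>
  modulo \<open>K + x M\<close> gives \<open>v = x w\<close>, and cancelling \<open>x\<close> gives
  \<open>y = z w\<close>.\<close>

lemma regular_mod_swap:
  assumes K: "submodule K R M" and "x \<in> carrier R" "z \<in> carrier R"
    and reg: "regular_mod M K x" "regular_mod M K z" "regular_mod M (add_mult M K x) z"
  shows "regular_mod M (add_mult M K z) x"
  unfolding regular_mod_def
proof (intro ballI impI)
  fix y assume y: "y \<in> carrier M" "x \<odot>\<^bsub>M\<^esub> y \<in> add_mult M K z"
  then obtain v where v: "v \<in> carrier M" "x \<odot>\<^bsub>M\<^esub> y \<ominus>\<^bsub>M\<^esub> z \<odot>\<^bsub>M\<^esub> v \<in> K" by (auto simp: add_mult_def)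
  note s = submodule_add_mult[OF K assms(2)]
  have "x \<odot>\<^bsub>M\<^esub> y \<ominus>\<^bsub>M\<^esub> z \<odot>\<^bsub>M\<^esub> v \<in> add_mult M K x" using v(2) add_mult_superset[OF K assms(2)] by blast
  then have "z \<odot>\<^bsub>M\<^esub> v \<in> add_mult M K x"
    using sub_diff_cancel[OF s, of "x \<odot>\<^bsub>M\<^esub> y" "z \<odot>\<^bsub>M\<^esub> v"] add_mult_self[OF K assms(2) y(1)] y v assms by simp
  then have "v \<in> add_mult M K x" using reg(3) v(1) by (simp add: regular_mod_def)
  then obtain w where w: "w \<in> carrier M" "v \<ominus>\<^bsub>M\<^esub> x \<odot>\<^bsub>M\<^esub> w \<in> K" by (auto simp: add_mult_def)
  have "z \<odot>\<^bsub>M\<^esub> (v \<ominus>\<^bsub>M\<^esub> x \<odot>\<^bsub>M\<^esub> w) \<in> K" using sub_smult[OF K assms(3) w(2)] .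
  then have "(x \<odot>\<^bsub>M\<^esub> y \<ominus>\<^bsub>M\<^esub> z \<odot>\<^bsub>M\<^esub> v) \<oplus>\<^bsub>M\<^esub> z \<odot>\<^bsub>M\<^esub> (v \<ominus>\<^bsub>M\<^esub> x \<odot>\<^bsub>M\<^esub> w) \<in> K" using sub_add[OF K v(2)] by blast
  also have "(x \<odot>\<^bsub>M\<^esub> y \<ominus>\<^bsub>M\<^esub> z \<odot>\<^bsub>M\<^esub> v) \<oplus>\<^bsub>M\<^esub> z \<odot>\<^bsub>M\<^esub> (v \<ominus>\<^bsub>M\<^esub> x \<odot>\<^bsub>M\<^esub> w) = x \<odot>\<^bsub>M\<^esub> (y \<ominus>\<^bsub>M\<^esub> z \<odot>\<^bsub>M\<^esub> w)"
    using y(1) v(1) w(1) assms(2,3) by (simp add: smult_diff_distr smult_commute[of z x] diff_add_diff)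
  finally have "y \<ominus>\<^bsub>M\<^esub> z \<odot>\<^bsub>M\<^esub> w \<in> K" using reg(1) y(1) w(1) assms(3) by (simp add: regular_mod_def)
  then show "y \<in> add_mult M K z" using y(1) w(1) by (auto simp: add_mult_def)
qed

text \<open>\<open>z\<close> is moved to the front past one entry at a time by
  \<open>regular_mod_swap\<close>, whence the regularity of \<open>z\<close> modulo every initial
  segment.\<close>

lemma regular_seq_mod_add_mult:
  assumes "submodule K R M" "set xs \<subseteq> carrier R" "z \<in> carrier R" "regular_seq_mod M K xs"
    and "\<And>i. i \<le> length xs \<Longrightarrow> regular_mod M (add_mults M K (take i xs)) z"
  shows "regular_seq_mod M (add_mult M K z) xs"
  using assms
proof (induction xs arbitrary: K)
  case (Cons x xs)
  then have x: "x \<in> carrier R" "set xs \<subseteq> carrier R" "regular_mod M K x" "regular_seq_mod M (add_mult M K x) xs" by auto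
  have z: "regular_mod M (add_mults M (add_mult M K x) (take i xs)) z" if "i \<le> length xs" for i
    using Cons.prems(5)[of "Suc i"] that by simp
  have "regular_mod M (add_mult M K z) x"
    using regular_mod_swap[OF Cons.prems(1) x(1) Cons.prems(3) x(3)] Cons.prems(5)[of 0] z[of 0] by simp
  moreover have "regular_seq_mod M (add_mult M (add_mult M K x) z) xs"
    by (rule Cons.IH[OF submodule_add_mult[OF Cons.prems(1) x(1)] x(2) Cons.prems(3) x(4) z])
  ultimately show ?case using add_mult_commute[OF Cons.prems(1) x(1) Cons.prems(3)] by simp
qed simp

end

context noetherian_module
begin

text \<open>If \<open>J u\<close> vanishes modulo \<open>K + x M\<close> and \<open>y u = x v\<close> modulo \<open>K\<close>, then \<open>J v\<close> vanishes modulo \<open>K + y M\<close>.\<close>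

lemma zero_divisors_transfer:
  assumes K: "submodule K R M" and J: "ideal J R" and x: "x \<in> J" "regular_mod M K x"
    and y: "y \<in> J" "regular_mod M K y" and none: "\<And>a. a \<in> J \<Longrightarrow> \<not> regular_mod M (add_mult M K x) a"
    and a: "a \<in> J"
  shows "\<not> regular_mod M (add_mult M K y) a"
proof -
  have xc: "x \<in> carrier R" and yc: "y \<in> carrier R" using x y ideal.Icarr[OF J] by auto
  obtain u where u: "u \<in> carrier M" "u \<notin> add_mult M K x" "\<And>a. a \<in> J \<Longrightarrow> a \<odot>\<^bsub>M\<^esub> u \<in> add_mult M K x"
    using annihilated_element_of_zero_divisors[OF submodule_add_mult[OF K xc] J none] by blast
  obtain v where v: "v \<in> carrier M" "y \<odot>\<^bsub>M\<^esub> u \<ominus>\<^bsub>M\<^esub> x \<odot>\<^bsub>M\<^esub> v \<in> K"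
    using u(3)[OF y(1)] by (auto simp: add_mult_def)
  have "v \<notin> add_mult M K y"
  proof
    assume "v \<in> add_mult M K y"
    then obtain w where w: "w \<in> carrier M" "v \<ominus>\<^bsub>M\<^esub> y \<odot>\<^bsub>M\<^esub> w \<in> K" by (auto simp: add_mult_def)
    have "(y \<odot>\<^bsub>M\<^esub> u \<ominus>\<^bsub>M\<^esub> x \<odot>\<^bsub>M\<^esub> v) \<oplus>\<^bsub>M\<^esub> x \<odot>\<^bsub>M\<^esub> (v \<ominus>\<^bsub>M\<^esub> y \<odot>\<^bsub>M\<^esub> w) \<in> K"
      using sub_add[OF K v(2) sub_smult[OF K xc w(2)]] .
    also have "(y \<odot>\<^bsub>M\<^esub> u \<ominus>\<^bsub>M\<^esub> x \<odot>\<^bsub>M\<^esub> v) \<oplus>\<^bsub>M\<^esub> x \<odot>\<^bsub>M\<^esub> (v \<ominus>\<^bsub>M\<^esub> y \<odot>\<^bsub>M\<^esub> w) = y \<odot>\<^bsub>M\<^esub> (u \<ominus>\<^bsub>M\<^esub> x \<odot>\<^bsub>M\<^esub> w)"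
      using u(1) v(1) w(1) xc yc by (simp add: smult_diff_distr smult_commute[of x y] diff_add_diff)
    finally have "u \<ominus>\<^bsub>M\<^esub> x \<odot>\<^bsub>M\<^esub> w \<in> K" using y(2) u(1) w(1) xc by (simp add: regular_mod_def)
    then show False using u(1,2) w(1) by (auto simp: add_mult_def)
  qed
  moreover have "a \<odot>\<^bsub>M\<^esub> v \<in> add_mult M K y"
  proof -
    have ac: "a \<in> carrier R" using a ideal.Icarr[OF J] by auto
    obtain w where w: "w \<in> carrier M" "a \<odot>\<^bsub>M\<^esub> u \<ominus>\<^bsub>M\<^esub> x \<odot>\<^bsub>M\<^esub> w \<in> K"
      using u(3)[OF a] by (auto simp: add_mult_def)
    have "y \<odot>\<^bsub>M\<^esub> (a \<odot>\<^bsub>M\<^esub> u \<ominus>\<^bsub>M\<^esub> x \<odot>\<^bsub>M\<^esub> w) \<ominus>\<^bsub>M\<^esub> a \<odot>\<^bsub>M\<^esub> (y \<odot>\<^bsub>M\<^esub> u \<ominus>\<^bsub>M\<^esub> x \<odot>\<^bsub>M\<^esub> v) \<in> K"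
      using sub_diff[OF K sub_smult[OF K yc w(2)] sub_smult[OF K ac v(2)]] .
    also have "y \<odot>\<^bsub>M\<^esub> (a \<odot>\<^bsub>M\<^esub> u \<ominus>\<^bsub>M\<^esub> x \<odot>\<^bsub>M\<^esub> w) \<ominus>\<^bsub>M\<^esub> a \<odot>\<^bsub>M\<^esub> (y \<odot>\<^bsub>M\<^esub> u \<ominus>\<^bsub>M\<^esub> x \<odot>\<^bsub>M\<^esub> v) = x \<odot>\<^bsub>M\<^esub> (a \<odot>\<^bsub>M\<^esub> v \<ominus>\<^bsub>M\<^esub> y \<odot>\<^bsub>M\<^esub> w)"
    proof -
      define p q r where "p = y \<odot>\<^bsub>M\<^esub> (a \<odot>\<^bsub>M\<^esub> u)" and "q = x \<odot>\<^bsub>M\<^esub> (y \<odot>\<^bsub>M\<^esub> w)" and "r = x \<odot>\<^bsub>M\<^esub> (a \<odot>\<^bsub>M\<^esub> v)"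
      have c: "p \<in> carrier M" "q \<in> carrier M" "r \<in> carrier M" using u(1) v(1) w(1) xc yc ac by (auto simp: p_def q_def r_def)
      have "y \<odot>\<^bsub>M\<^esub> (a \<odot>\<^bsub>M\<^esub> u \<ominus>\<^bsub>M\<^esub> x \<odot>\<^bsub>M\<^esub> w) \<ominus>\<^bsub>M\<^esub> a \<odot>\<^bsub>M\<^esub> (y \<odot>\<^bsub>M\<^esub> u \<ominus>\<^bsub>M\<^esub> x \<odot>\<^bsub>M\<^esub> v) = (p \<ominus>\<^bsub>M\<^esub> q) \<ominus>\<^bsub>M\<^esub> (p \<ominus>\<^bsub>M\<^esub> r)"
        using u(1) v(1) w(1) xc yc ac
        by (simp add: p_def q_def r_def smult_diff_distr smult_commute[of y x] smult_commute[of a x] smult_commute[of a y])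
      also have "\<dots> = r \<ominus>\<^bsub>M\<^esub> q" using c by (rule diff_diff_cancel)
      also have "\<dots> = x \<odot>\<^bsub>M\<^esub> (a \<odot>\<^bsub>M\<^esub> v \<ominus>\<^bsub>M\<^esub> y \<odot>\<^bsub>M\<^esub> w)"
        using v(1) w(1) xc yc ac by (simp add: q_def r_def smult_diff_distr)
      finally show ?thesis .
    qed
    finally have "a \<odot>\<^bsub>M\<^esub> v \<ominus>\<^bsub>M\<^esub> y \<odot>\<^bsub>M\<^esub> w \<in> K" using x(2) v(1) w(1) ac yc by (simp add: regular_mod_def)
    then show ?thesis using v(1) w(1) ac by (auto simp: add_mult_def)
  qed
  ultimately show ?thesis using v(1) by (auto simp: regular_mod_def)
qed

text \<open>Kaplansky's argument: an element \<open>z\<close> of \<open>J\<close> that is regular modulo all proper initial segments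
  of both sequences can replace their last entries and can then be moved to the front.\<close>

lemma maximal_regular_seq_mod_transfer:
  assumes "submodule K R M" and J: "ideal J R" and "maximal_regular_seq_mod J M K xs"
    and "set ys \<subseteq> J" "regular_seq_mod M K ys" "length ys = length xs"
  shows "maximal_regular_seq_mod J M K ys"
  using assms(1,3-)
proof (induction "length xs" arbitrary: K xs ys)
  case 0
  then show ?case by simp
next
  case (Suc n)
  obtain xs' x where xs: "xs = xs' @ [x]" using Suc.hyps(2) by (cases xs rule: rev_cases) auto
  obtain ys' y where ys: "ys = ys' @ [y]" using Suc.hyps(2) Suc.prems(5) by (cases ys rule: rev_cases) auto
  have len: "n = length xs'" "length ys' = length xs'" using Suc.hyps(2) Suc.prems(5) xs ys by auto
  have J_carr: "a \<in> carrier R" if "a \<in> J" for a using that ideal.Icarr[OF J] by auto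
  note K = Suc.prems(1)
  have xJ: "set xs' \<subseteq> J" "x \<in> J" and xreg: "regular_seq_mod M K xs'" "regular_mod M (add_mults M K xs') x"
    and xmax: "\<And>z. z \<in> J \<Longrightarrow> \<not> regular_mod M (add_mult M (add_mults M K xs') x) z"
    using Suc.prems(2) xs by (auto simp: maximal_regular_seq_mod_def regular_seq_mod_append)
  have yJ: "set ys' \<subseteq> J" "y \<in> J" and yreg: "regular_seq_mod M K ys'" "regular_mod M (add_mults M K ys') y"
    using Suc.prems(3,4) ys by (auto simp: regular_seq_mod_append)
  have carr: "set xs' \<subseteq> carrier R" "set ys' \<subseteq> carrier R" using xJ yJ J_carr by auto
  \<comment> \<open>The moduli run up to the full shortened sequence; there the removed last entry
    is the regular element of \<open>J\<close>.\<close>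
  let ?\<K> = "\<lambda>zs. (\<lambda>i. add_mults M K (take i zs)) ` {..length zs}"
  have regs: "\<exists>a\<in>J. regular_mod M U a"
    if U: "U \<in> ?\<K> zs" and zs: "set zs \<subseteq> J" "regular_seq_mod M K zs" and z: "z \<in> J" "regular_mod M (add_mults M K zs) z" for U zs z
  proof -
    obtain i where i: "i \<le> length zs" "U = add_mults M K (take i zs)" using U by auto
    show ?thesis
    proof (cases "i = length zs")
      case False
      then have "zs ! i \<in> J" "regular_mod M U (zs ! i)"
        using i zs by (auto simp: regular_seq_mod_nth)
      then show ?thesis by blast
    qed (use i z in auto)
  qed
  have subs: "submodule U R M" if "U \<in> ?\<K> zs" "set zs \<subseteq> carrier R" for U zs
    using that set_take_subset by (fastforce intro!: submodule_add_mults[OF K])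
  have "\<exists>z\<in>J. \<forall>U\<in>?\<K> xs' \<union> ?\<K> ys'. regular_mod M U z"
  proof (rule common_regular_element[OF _ _ J])
    show "\<exists>a\<in>J. regular_mod M U a" if "U \<in> ?\<K> xs' \<union> ?\<K> ys'" for U
      using that regs[of U xs' x] regs[of U ys' y] xJ xreg yJ yreg by blast
    show "submodule U R M" if "U \<in> ?\<K> xs' \<union> ?\<K> ys'" for U
      using that subs[of U xs'] subs[of U ys'] carr by blast
  qed simp
  then obtain z where z: "z \<in> J" "\<And>i. i \<le> length xs' \<Longrightarrow> regular_mod M (add_mults M K (take i xs')) z"
    "\<And>i. i \<le> length ys' \<Longrightarrow> regular_mod M (add_mults M K (take i ys')) z"
    by auto
  have zc: "z \<in> carrier R" using J_carr z by blast
  \<comment> \<open>First exchange: \<open>z\<close> replaces the last entry of \<open>xs\<close>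
    without losing maximality. Moved to the front it becomes part of the modulus, and the induction
    hypothesis applies to the shortened sequences over \<open>K + z M\<close>.\<close>
  have "\<not> regular_mod M (add_mult M (add_mults M K xs') z) a" if "a \<in> J" for a
    using zero_divisors_transfer[OF submodule_add_mults[OF K carr(1)] J xJ(2) xreg(2) z(1) _ xmax that] z(2)[of "length xs'"]
    by simp
  then have "maximal_regular_seq_mod J M (add_mult M K z) xs'"
    using xJ(1) regular_seq_mod_add_mult[OF K carr(1) zc xreg(1) z(2)]
    by (simp add: maximal_regular_seq_mod_def add_mults_add_mult_commute[OF K carr(1) zc])
  then have "maximal_regular_seq_mod J M (add_mult M K z) ys'"
    using Suc.hyps(1)[OF len(1) submodule_add_mult[OF K zc] _ yJ(1) regular_seq_mod_add_mult[OF K carr(2) zc yreg(1) z(3)] len(2)]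
    by blast
  then have zmax: "\<And>a. a \<in> J \<Longrightarrow> \<not> regular_mod M (add_mult M (add_mults M K ys') z) a"
    by (simp add: maximal_regular_seq_mod_def add_mults_add_mult_commute[OF K carr(2) zc])
  \<comment> \<open>Second exchange: back from \<open>z\<close> to the last entry of
    \<open>ys\<close>.\<close>
  have "\<not> regular_mod M (add_mult M (add_mults M K ys') y) a" if "a \<in> J" for a
    using zero_divisors_transfer[OF submodule_add_mults[OF K carr(2)] J z(1) _ yJ(2) yreg(2) zmax that] z(3)[of "length ys'"]
    by simp
  then show ?case using Suc.prems(3,4) ys by (simp add: maximal_regular_seq_mod_def)
qed

text \<open>A longer sequence, cut to the length of the shorter one, would be maximal by the
  transfer lemma although its next entry extends it.\<close>

lemma maximal_regular_seq_mod_length_le: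
  assumes K: "submodule K R M" and J: "ideal J R"
    and xs: "maximal_regular_seq_mod J M K xs" and ys: "maximal_regular_seq_mod J M K ys"
  shows "length ys \<le> length xs"
proof (rule ccontr)
  assume n: "\<not> ?thesis"
  let ?zs = "take (length xs) ys" let ?z = "ys ! length xs"
  have "maximal_regular_seq_mod J M K ?zs"
  proof (rule maximal_regular_seq_mod_transfer[OF K J xs])
    show "set ?zs \<subseteq> J" using ys set_take_subset[of "length xs" ys] by (auto simp: maximal_regular_seq_mod_def)
    have "regular_seq_mod M K (?zs @ drop (length xs) ys)" using ys by (simp add: maximal_regular_seq_mod_def)
    then show "regular_seq_mod M K ?zs" unfolding regular_seq_mod_append by blast
    show "length ?zs = length xs" using n by simp
  qed
  moreover have "?z \<in> J" "regular_mod M (add_mults M K ?zs) ?z"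
    using ys n by (auto simp: maximal_regular_seq_mod_def regular_seq_mod_nth)
  ultimately show False by (auto simp: maximal_regular_seq_mod_def)
qed

text \<open>For entries in \<open>J\<close> the properness clause of \<open>regular_seq\<close>
  follows from \<open>J M \<noteq> M\<close>.\<close>

lemma maximal_regular_seq_iff:
  assumes J: "ideal J R" and proper: "set_smult R J M \<noteq> carrier M"
  shows "maximal_regular_seq R J M xs \<longleftrightarrow> maximal_regular_seq_mod J M {\<zero>\<^bsub>M\<^esub>} xs"
proof (cases "set xs \<subseteq> J")
  case True
  have JR: "J \<subseteq> carrier R" using ideal.Icarr[OF J] by blast
  have *: "regular_seq R M zs \<longleftrightarrow> regular_seq_mod M {\<zero>\<^bsub>M\<^esub>} zs" if zs: "set zs \<subseteq> J" for zs
  proof -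
    have "set_smult R (set zs) M \<noteq> carrier M"
      using proper set_smult_mono[OF zs JR] sub_carr[OF set_smult_submodule[OF JR]] by blast
    then show ?thesis using zs JR by (auto simp: regular_seq_iff)
  qed
  have "(\<forall>x\<in>J. \<not> regular_seq R M (xs @ [x])) \<longleftrightarrow> (\<forall>x\<in>J. \<not> regular_seq_mod M {\<zero>\<^bsub>M\<^esub>} (xs @ [x]))"
    using *[of "xs @ [_]"] True by simp
  then show ?thesis
    using True *[OF True]
    by (auto simp: maximal_regular_seq_def maximal_regular_seq_mod_def regular_seq_mod_append)
qed (simp add: maximal_regular_seq_def maximal_regular_seq_mod_def)

lemma grade_eq_length:
  assumes J: "ideal J R" and proper: "set_smult R J M \<noteq> carrier M"
    and xs: "maximal_regular_seq_mod J M {\<zero>\<^bsub>M\<^esub>} xs"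
  shows "grade R J M = length xs"
  unfolding grade_def maximal_regular_seq_iff[OF J proper]
  using xs maximal_regular_seq_mod_length_le[OF submodule_zero J] by (intro the_equality) (auto intro: antisym)

text \<open>An element regular on \<open>M / K\<close> is regular modulo the annihilator of
  \<open>M / K\<close>: if \<open>x a\<close> kills \<open>M / K\<close>, so does
  \<open>a\<close>.\<close>

lemma dim_over_regular_mod:
  assumes K: "submodule K R M" and x: "x \<in> carrier R" "regular_mod M K x"
  shows "dim_over R (colon R M (add_mult M K x) (carrier M)) + 1 \<le> dim_over R (colon R M K (carrier M))"
proof (rule dim_over_regular[OF ideal_colon[OF K order_refl] x(1)])
  fix a assume a: "a \<in> carrier R" "x \<otimes> a \<in> colon R M K (carrier M)"
  then show "a \<in> colon R M K (carrier M)"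
    using x by (auto simp: colon_def smult_assoc1 regular_mod_def)
next
  show "colon R M K (carrier M) \<subseteq> colon R M (add_mult M K x) (carrier M)"
    using add_mult_superset[OF K x(1)] by (auto simp: colon_def)
  show "x \<in> colon R M (add_mult M K x) (carrier M)"
    using add_mult_self[OF K x(1)] x(1) by (auto simp: colon_def)
qed

lemma dim_over_regular_seq_mod:
  assumes "submodule K R M" "set xs \<subseteq> carrier R" "regular_seq_mod M K xs"
  shows "dim_over R (colon R M (add_mults M K xs) (carrier M)) + ereal (real (length xs))
    \<le> dim_over R (colon R M K (carrier M))"
  using assms
proof (induction xs arbitrary: K)
  case (Cons x xs)
  then have x: "x \<in> carrier R" "set xs \<subseteq> carrier R" "regular_mod M K x" "regular_seq_mod M (add_mult M K x) xs" by auto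
  let ?d = "dim_over R (colon R M (add_mults M K (x # xs)) (carrier M))"
  have "?d + ereal (real (length (x # xs))) = (?d + ereal (real (length xs))) + 1"
    by (cases ?d) auto
  also have "\<dots> \<le> dim_over R (colon R M (add_mult M K x) (carrier M)) + 1"
    using Cons.IH[OF submodule_add_mult[OF Cons.prems(1) x(1)] x(2,4)] by (intro add_right_mono) simp
  also have "\<dots> \<le> dim_over R (colon R M K (carrier M))" by (rule dim_over_regular_mod[OF Cons.prems(1) x(1,3)])
  finally show ?case .
qed (simp add: zero_ereal_def[symmetric])

end

section \<open>Tensor products\<close>

lemma module_homsD:
  assumes "g \<in> module_homs A L M"
  shows "x \<in> carrier L \<Longrightarrow> g x \<in> carrier M"
    and "x \<in> carrier L \<Longrightarrow> y \<in> carrier L \<Longrightarrow> g (x \<oplus>\<^bsub>L\<^esub> y) = g x \<oplus>\<^bsub>M\<^esub> g y"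
    and "a \<in> carrier A \<Longrightarrow> x \<in> carrier L \<Longrightarrow> g (a \<odot>\<^bsub>L\<^esub> x) = a \<odot>\<^bsub>M\<^esub> g x"
  using assms by (auto simp: module_homs_def hom_def)

lemma module_homsI:
  assumes "\<And>x. x \<in> carrier L \<Longrightarrow> g x \<in> carrier M"
    and "\<And>x y. x \<in> carrier L \<Longrightarrow> y \<in> carrier L \<Longrightarrow> g (x \<oplus>\<^bsub>L\<^esub> y) = g x \<oplus>\<^bsub>M\<^esub> g y"
    and "\<And>a x. a \<in> carrier A \<Longrightarrow> x \<in> carrier L \<Longrightarrow> g (a \<odot>\<^bsub>L\<^esub> x) = a \<odot>\<^bsub>M\<^esub> g x"
  shows "g \<in> module_homs A L M"
  using assms by (auto simp: module_homs_def hom_def)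

lemma module_homs_zero:
  assumes "module A L" "module A M" "g \<in> module_homs A L M"
  shows "g \<zero>\<^bsub>L\<^esub> = \<zero>\<^bsub>M\<^esub>"
proof -
  interpret L: module A L by fact
  interpret M: module A M by fact
  have "g \<zero>\<^bsub>L\<^esub> = g (\<zero>\<^bsub>A\<^esub> \<odot>\<^bsub>L\<^esub> \<zero>\<^bsub>L\<^esub>)" by simp
  also have "\<dots> = \<zero>\<^bsub>A\<^esub> \<odot>\<^bsub>M\<^esub> g \<zero>\<^bsub>L\<^esub>" by (rule module_homsD(3)[OF assms(3)]) auto
  also have "\<dots> = \<zero>\<^bsub>M\<^esub>" using module_homsD(1)[OF assms(3)] by simp
  finally show ?thesis .
qed

lemma submodule_preimage_hom:
  assumes "module A L" "module A M" "g \<in> module_homs A L M" "submodule K A M"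
  shows "submodule {x \<in> carrier L. g x \<in> K} A L"
proof -
  interpret L: module A L by fact
  interpret M: module A M by fact
  note g = module_homsD[OF assms(3)]
  show ?thesis
  proof (rule L.submoduleI)
    fix x assume x: "x \<in> {x \<in> carrier L. g x \<in> K}"
    have "\<ominus>\<^bsub>L\<^esub> x = (\<ominus>\<^bsub>A\<^esub> \<one>\<^bsub>A\<^esub>) \<odot>\<^bsub>L\<^esub> x" using x by (simp add: L.smult_l_minus)
    then show "\<ominus>\<^bsub>L\<^esub> x \<in> {x \<in> carrier L. g x \<in> K}"
      using x g(3)[of "\<ominus>\<^bsub>A\<^esub> \<one>\<^bsub>A\<^esub>" x] M.sub_smult[OF assms(4), of "\<ominus>\<^bsub>A\<^esub> \<one>\<^bsub>A\<^esub>" "g x"] by simp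
  qed (use g module_homs_zero[OF assms(1-3)] M.sub_zero[OF assms(4)] M.sub_add[OF assms(4)] M.sub_smult[OF assms(4)] in auto)
qed

lemma submodule_image_hom:
  assumes "module A L" "module A M" "g \<in> module_homs A L M"
  shows "submodule (g ` carrier L) A M"
proof -
  interpret L: module A L by fact
  interpret M: module A M by fact
  note g = module_homsD[OF assms(3)]
  show ?thesis
  proof (rule M.submoduleI)
    show "\<zero>\<^bsub>M\<^esub> \<in> g ` carrier L"
      using module_homs_zero[OF assms] by (metis L.zero_closed imageI)
    show "\<ominus>\<^bsub>M\<^esub> y \<in> g ` carrier L" if y: "y \<in> g ` carrier L" for y
    proof -
      obtain x where x: "x \<in> carrier L" "y = g x" using y by auto
      have "\<ominus>\<^bsub>M\<^esub> y = g ((\<ominus>\<^bsub>A\<^esub> \<one>\<^bsub>A\<^esub>) \<odot>\<^bsub>L\<^esub> x)"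
        using x g(1)[OF x(1)] g(3)[of "\<ominus>\<^bsub>A\<^esub> \<one>\<^bsub>A\<^esub>" x] by (simp add: M.smult_l_minus)
      then show ?thesis using x by auto
    qed
  qed (use g in \<open>auto simp: g(2)[symmetric] g(3)[symmetric]\<close>)
qed

lemma submodule_kernel_hom:
  assumes "module A L" "module A M" "g \<in> module_homs A L M"
  shows "submodule {x \<in> carrier L. g x = \<zero>\<^bsub>M\<^esub>} A L"
  using submodule_preimage_hom[OF assms module.submodule_zero[OF assms(2)]] by simp

definition tens ::
    "('a, 'r) ring_scheme \<Rightarrow> ('a \<Rightarrow> 'b) \<Rightarrow> ('a, 'm, 'k) module_scheme \<Rightarrow> ('b, 'n, 'j) module_scheme
      \<Rightarrow> 'm \<Rightarrow> 'n \<Rightarrow> ('m \<times> 'n \<Rightarrow>\<^sub>0 int) set" where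
  "tens R f M N x y = tensor_kernel R f M N #>\<^bsub>tensor_free M N\<^esub> frag_of (x, y)"

lemma relator_add_left:
  "x \<in> carrier M \<Longrightarrow> x' \<in> carrier M \<Longrightarrow> y \<in> carrier N \<Longrightarrow>
    frag_of (x \<oplus>\<^bsub>M\<^esub> x', y) - frag_of (x, y) - frag_of (x', y) \<in> tensor_relators R f M N"
  unfolding tensor_relators_def by blast

lemma relator_add_right:
  "x \<in> carrier M \<Longrightarrow> y \<in> carrier N \<Longrightarrow> y' \<in> carrier N \<Longrightarrow>
    frag_of (x, y \<oplus>\<^bsub>N\<^esub> y') - frag_of (x, y) - frag_of (x, y') \<in> tensor_relators R f M N"
  unfolding tensor_relators_def by blast

lemma relator_balanced:
  "r \<in> carrier R \<Longrightarrow> x \<in> carrier M \<Longrightarrow> y \<in> carrier N \<Longrightarrow>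
    frag_of (r \<odot>\<^bsub>M\<^esub> x, y) - frag_of (x, f r \<odot>\<^bsub>N\<^esub> y) \<in> tensor_relators R f M N"
  unfolding tensor_relators_def by blast

lemma relator_cases [consumes 1, case_names add_left add_right balanced]:
  assumes "c \<in> tensor_relators R f M N"
  obtains x x' y where "x \<in> carrier M" "x' \<in> carrier M" "y \<in> carrier N"
      "c = frag_of (x \<oplus>\<^bsub>M\<^esub> x', y) - frag_of (x, y) - frag_of (x', y)"
    | x y y' where "x \<in> carrier M" "y \<in> carrier N" "y' \<in> carrier N"
      "c = frag_of (x, y \<oplus>\<^bsub>N\<^esub> y') - frag_of (x, y) - frag_of (x, y')"
    | r x y where "r \<in> carrier R" "x \<in> carrier M" "y \<in> carrier N"
      "c = frag_of (r \<odot>\<^bsub>M\<^esub> x, y) - frag_of (x, f r \<odot>\<^bsub>N\<^esub> y)"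
  using assms unfolding tensor_relators_def by blast

lemmas frag_keys_induct = free_Abelian_group_induct [consumes 1, case_names zero diff generator]

locale tensor_modules = M: module R M + N: module S N
  for R :: "('a, 'r) ring_scheme" and M :: "('a, 'm, 'k) module_scheme"
    and S :: "('b, 's) ring_scheme" and N :: "('b, 'n, 'j) module_scheme" +
  fixes f :: "'a \<Rightarrow> 'b"
  assumes hom: "f \<in> ring_hom R S"
begin

abbreviation "F \<equiv> tensor_free M N"
abbreviation "K \<equiv> tensor_kernel R f M N"
abbreviation "T \<equiv> tensor R f M N"
abbreviation "tn \<equiv> tens R f M N"

lemma f_closed [simp]: "a \<in> carrier R \<Longrightarrow> f a \<in> carrier S"
  using hom by (rule ring_hom_closed)

lemma relators_carrier: "c \<in> tensor_relators R f M N \<Longrightarrow> Poly_Mapping.keys c \<subseteq> carrier M \<times> carrier N"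
  unfolding tensor_relators_def by (auto simp: keys_frag_of dest!: subsetD[OF keys_diff])

lemma group_F: "group F" by simp

lemma kernel_induct [consumes 1]:
  assumes "c \<in> K" "\<And>c. c \<in> tensor_relators R f M N \<Longrightarrow> P c" "P 0"
    "\<And>c d. c \<in> K \<Longrightarrow> d \<in> K \<Longrightarrow> P c \<Longrightarrow> P d \<Longrightarrow> P (c + d)" "\<And>c. c \<in> K \<Longrightarrow> P c \<Longrightarrow> P (- c)"
  shows "P c"
  using assms(1) unfolding tensor_kernel_def
proof (induction rule: generate.induct)
  case (incl h) then show ?case by (rule assms(2))
next
  case (inv h)
  have "h \<in> K" unfolding tensor_kernel_def by (rule generate.incl[OF inv])
  then show ?case using assms(5)[OF _ assms(2)[OF inv]] relators_carrier[OF inv] by simp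
next
  case (eng h1 h2)
  then show ?case using assms(4)[of h1 h2] by (simp add: tensor_kernel_def)
qed (use assms(3) in simp)

lemma kernel_subgroup: "subgroup K F"
  unfolding tensor_kernel_def
  by (rule group.generate_is_subgroup[OF group_F]) (use relators_carrier in auto)

lemma kernel_carrier: "c \<in> K \<Longrightarrow> Poly_Mapping.keys c \<subseteq> carrier M \<times> carrier N"
  using subgroup.mem_carrier[OF kernel_subgroup] by simp

lemma kernel_zero: "0 \<in> K"
  using subgroup.one_closed[OF kernel_subgroup] by simp

lemma kernel_add: "c \<in> K \<Longrightarrow> d \<in> K \<Longrightarrow> c + d \<in> K"
  using subgroup.m_closed[OF kernel_subgroup] by simp

lemma kernel_minus: "c \<in> K \<Longrightarrow> - c \<in> K"
  using subgroup.m_inv_closed[OF kernel_subgroup] kernel_carrier by fastforce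

lemma kernel_diff: "c \<in> K \<Longrightarrow> d \<in> K \<Longrightarrow> c - d \<in> K"
  using kernel_add[of c "- d"] kernel_minus[of d] by simp

lemma kernel_relator: "c \<in> tensor_relators R f M N \<Longrightarrow> c \<in> K"
  unfolding tensor_kernel_def by (rule generate.incl)

lemma coset_iff: "d \<in> K #>\<^bsub>F\<^esub> c \<longleftrightarrow> d - c \<in> K"
proof -
  have "d \<in> K #>\<^bsub>F\<^esub> c \<longleftrightarrow> (\<exists>h\<in>K. d = h + c)" by (auto simp: r_coset_def)
  also have "\<dots> \<longleftrightarrow> d - c \<in> K" by (metis add_diff_cancel_right' diff_add_cancel)
  finally show ?thesis .
qed

lemma coset_eqI: "c - d \<in> K \<Longrightarrow> K #>\<^bsub>F\<^esub> c = K #>\<^bsub>F\<^esub> d"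
proof (rule Set.set_eqI)
  fix e assume cd: "c - d \<in> K"
  have "e - d = (e - c) + (c - d)" "e - c = (e - d) - (c - d)" by simp_all
  then show "e \<in> K #>\<^bsub>F\<^esub> c \<longleftrightarrow> e \<in> K #>\<^bsub>F\<^esub> d"
    unfolding coset_iff using kernel_add[OF _ cd, of "e - c"] kernel_diff[OF _ cd, of "e - d"] by metis
qed

lemma coset_eq_iff: "K #>\<^bsub>F\<^esub> c = K #>\<^bsub>F\<^esub> d \<longleftrightarrow> c - d \<in> K"
  using coset_eqI coset_iff[of c c] coset_iff[of c d] kernel_zero by auto

lemma tensor_carrier: "carrier T = (\<lambda>c. K #>\<^bsub>F\<^esub> c) ` {c. Poly_Mapping.keys c \<subseteq> carrier M \<times> carrier N}"
  by (auto simp: tensor_def Let_def RCOSETS_def)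

lemma tensor_zero: "\<zero>\<^bsub>T\<^esub> = K #>\<^bsub>F\<^esub> 0"
  by (rule Set.set_eqI) (auto simp: tensor_def Let_def coset_iff)

lemma tensor_add: "(K #>\<^bsub>F\<^esub> c) \<oplus>\<^bsub>T\<^esub> (K #>\<^bsub>F\<^esub> d) = K #>\<^bsub>F\<^esub> (c + d)"
proof -
  have "(K #>\<^bsub>F\<^esub> c) \<oplus>\<^bsub>T\<^esub> (K #>\<^bsub>F\<^esub> d) = {x + y | x y. x \<in> K #>\<^bsub>F\<^esub> c \<and> y \<in> K #>\<^bsub>F\<^esub> d}"
    by (auto simp: tensor_def Let_def set_mult_def)
  also have "\<dots> = K #>\<^bsub>F\<^esub> (c + d)"
  proof (rule Set.set_eqI, rule iffI)
    fix e assume "e \<in> {x + y | x y. x \<in> K #>\<^bsub>F\<^esub> c \<and> y \<in> K #>\<^bsub>F\<^esub> d}"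
    then obtain x y where xy: "e = x + y" "x - c \<in> K" "y - d \<in> K" by (auto simp: coset_iff)
    have "e - (c + d) = (x - c) + (y - d)" using xy by simp
    then show "e \<in> K #>\<^bsub>F\<^esub> (c + d)" using kernel_add[OF xy(2,3)] unfolding coset_iff by metis
  next
    fix e assume e: "e \<in> K #>\<^bsub>F\<^esub> (c + d)"
    have "e = (e - d) + d" "e - d \<in> K #>\<^bsub>F\<^esub> c" "d \<in> K #>\<^bsub>F\<^esub> d"
      using e kernel_zero by (simp_all add: coset_iff algebra_simps)
    then show "e \<in> {x + y | x y. x \<in> K #>\<^bsub>F\<^esub> c \<and> y \<in> K #>\<^bsub>F\<^esub> d}" by blast
  qed
  finally show ?thesis .
qed

end

text \<open>The map \<open>g \<otimes> k\<close> on free groups. With \<open>k = id\<close> it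
  describes \<open>tensor_map\<close>, with \<open>g = id\<close> and \<open>k\<close> a scalar
  multiplication the action of \<open>S\<close> on the tensor product.\<close>

definition push :: "('l \<Rightarrow> 'm) \<Rightarrow> ('n \<Rightarrow> 'n) \<Rightarrow> ('l \<times> 'n \<Rightarrow>\<^sub>0 int) \<Rightarrow> ('m \<times> 'n \<Rightarrow>\<^sub>0 int)" where
  "push g k = frag_extend (\<lambda>(x, y). frag_of (g x, k y))"

lemma push_simps [simp]:
  "push g k 0 = 0" "push g k (c + d) = push g k c + push g k d" "push g k (c - d) = push g k c - push g k d"
  "push g k (- c) = - push g k c" "push g k (frag_of (x, y)) = frag_of (g x, k y)"
  by (simp_all add: push_def frag_extend_add frag_extend_diff frag_extend_minus)

text \<open>Relators go to relators. This makes the unions over representatives, by which the scalar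
  action and \<open>tensor_map\<close> are defined, collapse to a single coset.\<close>

lemma push_kernel:
  assumes "tensor_modules R L S N f" "tensor_modules R M S N f"
    and g: "g \<in> module_homs R L M" and k: "k \<in> module_homs S N N"
    and c: "c \<in> tensor_kernel R f L N"
  shows "push g k c \<in> tensor_kernel R f M N"
proof -
  interpret L: tensor_modules R L S N f by fact
  interpret M: tensor_modules R M S N f by fact
  note g = module_homsD[OF g] and k = module_homsD[OF k]
  show ?thesis
    using c
  proof (induction rule: L.kernel_induct)
    case (1 c)
    then have "push g k c \<in> tensor_relators R f M N"
    proof (cases rule: relator_cases)
      case (add_left x x' y)
      then have "push g k c = frag_of (g x \<oplus>\<^bsub>M\<^esub> g x', k y) - frag_of (g x, k y) - frag_of (g x', k y)"
        using g by simp
      then show ?thesis using relator_add_left[of "g x" M "g x'" "k y" N R f] add_left g(1) k(1) by simp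
    next
      case (add_right x y y')
      then have "push g k c = frag_of (g x, k y \<oplus>\<^bsub>N\<^esub> k y') - frag_of (g x, k y) - frag_of (g x, k y')"
        using k by simp
      then show ?thesis using relator_add_right[of "g x" M "k y" N "k y'" R f] add_right g(1) k(1) by simp
    next
      case (balanced r x y)
      then have "push g k c = frag_of (r \<odot>\<^bsub>M\<^esub> g x, k y) - frag_of (g x, f r \<odot>\<^bsub>N\<^esub> k y)"
        using g k by simp
      then show ?thesis using relator_balanced[of r R "g x" M "k y" N f] balanced g(1) k(1) by simp
    qed
    then show ?case by (rule M.kernel_relator)
  qed (auto simp: M.kernel_zero M.kernel_add M.kernel_minus)
qed

lemma push_carrier:
  assumes "g ` carrier L \<subseteq> carrier M" "k ` carrier N \<subseteq> carrier N" "Poly_Mapping.keys c \<subseteq> carrier L \<times> carrier N"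
  shows "Poly_Mapping.keys (push g k c) \<subseteq> carrier M \<times> carrier N"
  using assms(3)
proof (induction rule: frag_keys_induct)
  case (diff c d)
  then show ?case using keys_diff[of "push g k c" "push g k d"] by auto
qed (use assms in \<open>auto simp: keys_frag_of\<close>)

context tensor_modules
begin

lemma smult_homs: "s \<in> carrier S \<Longrightarrow> (\<lambda>y. s \<odot>\<^bsub>N\<^esub> y) \<in> module_homs S N N"
  by (rule module_homsI) (auto simp: N.smult_r_distr N.smult_commute)

lemma id_homs: "id \<in> module_homs R M M" "id \<in> module_homs S N N"
  by (auto intro: module_homsI)

lemma tensor_smult:
  assumes s: "s \<in> carrier S"
  shows "s \<odot>\<^bsub>T\<^esub> (K #>\<^bsub>F\<^esub> c) = K #>\<^bsub>F\<^esub> push id (\<lambda>y. s \<odot>\<^bsub>N\<^esub> y) c"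
proof -
  let ?p = "push id (\<lambda>y. s \<odot>\<^bsub>N\<^esub> y)"
  have "s \<odot>\<^bsub>T\<^esub> (K #>\<^bsub>F\<^esub> c) = (\<Union>d\<in>K #>\<^bsub>F\<^esub> c. K #>\<^bsub>F\<^esub> ?p d)"
    by (simp add: tensor_def Let_def push_def)
  moreover have "K #>\<^bsub>F\<^esub> ?p d = K #>\<^bsub>F\<^esub> ?p c" if "d \<in> K #>\<^bsub>F\<^esub> c" for d
  proof (rule coset_eqI)
    have "?p (d - c) \<in> K"
      using push_kernel[OF tensor_modules_axioms tensor_modules_axioms id_homs(1) smult_homs[OF s]] that
      by (simp only: coset_iff)
    then show "?p d - ?p c \<in> K" by simp
  qed
  moreover have "c \<in> K #>\<^bsub>F\<^esub> c" using kernel_zero by (simp add: coset_iff)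
  ultimately show ?thesis by blast
qed

lemma tn_closed [simp]: "x \<in> carrier M \<Longrightarrow> y \<in> carrier N \<Longrightarrow> tn x y \<in> carrier T"
  unfolding tens_def tensor_carrier by (auto simp: keys_frag_of)

lemma coset_eq_of_relator:
  assumes "c - d \<in> tensor_relators R f M N" shows "K #>\<^bsub>F\<^esub> c = K #>\<^bsub>F\<^esub> d"
  using assms by (intro coset_eqI kernel_relator)

lemma tn_add_left:
  assumes "x \<in> carrier M" "x' \<in> carrier M" "y \<in> carrier N"
  shows "tn (x \<oplus>\<^bsub>M\<^esub> x') y = tn x y \<oplus>\<^bsub>T\<^esub> tn x' y"
  unfolding tens_def tensor_add
  by (rule coset_eq_of_relator) (use relator_add_left[OF assms] in \<open>simp add: diff_diff_add\<close>)

lemma tn_add_right: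
  assumes "x \<in> carrier M" "y \<in> carrier N" "y' \<in> carrier N"
  shows "tn x (y \<oplus>\<^bsub>N\<^esub> y') = tn x y \<oplus>\<^bsub>T\<^esub> tn x y'"
  unfolding tens_def tensor_add
  by (rule coset_eq_of_relator) (use relator_add_right[OF assms] in \<open>simp add: diff_diff_add\<close>)

lemma tn_balanced:
  assumes "r \<in> carrier R" "x \<in> carrier M" "y \<in> carrier N"
  shows "tn (r \<odot>\<^bsub>M\<^esub> x) y = tn x (f r \<odot>\<^bsub>N\<^esub> y)"
  unfolding tens_def
  by (rule coset_eq_of_relator) (rule relator_balanced[OF assms])

lemma tn_smult:
  assumes "s \<in> carrier S"
  shows "s \<odot>\<^bsub>T\<^esub> tn x y = tn x (s \<odot>\<^bsub>N\<^esub> y)"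
  unfolding tens_def tensor_smult[OF assms] by simp

lemma abelian_group_tensor: "abelian_group T"
proof (rule abelian_groupI)
  fix t u assume "t \<in> carrier T" "u \<in> carrier T"
  then show "t \<oplus>\<^bsub>T\<^esub> u \<in> carrier T"
    using keys_add by (fastforce simp: tensor_carrier tensor_add)
next
  show "\<zero>\<^bsub>T\<^esub> \<in> carrier T" by (auto simp: tensor_carrier tensor_zero)
next
  fix t assume "t \<in> carrier T"
  then obtain c where c: "Poly_Mapping.keys c \<subseteq> carrier M \<times> carrier N" "t = K #>\<^bsub>F\<^esub> c" by (auto simp: tensor_carrier)
  then have "K #>\<^bsub>F\<^esub> (- c) \<in> carrier T" "(K #>\<^bsub>F\<^esub> (- c)) \<oplus>\<^bsub>T\<^esub> t = \<zero>\<^bsub>T\<^esub>"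
    by (auto simp: tensor_carrier tensor_add tensor_zero keys_minus)
  then show "\<exists>u\<in>carrier T. u \<oplus>\<^bsub>T\<^esub> t = \<zero>\<^bsub>T\<^esub>" by blast
qed (auto simp: tensor_carrier tensor_add tensor_zero algebra_simps)

sublocale TG: abelian_group T by (rule abelian_group_tensor)

lemma tensor_induct [consumes 1, case_names tens add minus zero]:
  assumes t: "t \<in> carrier T"
    and "\<And>x y. x \<in> carrier M \<Longrightarrow> y \<in> carrier N \<Longrightarrow> P (tn x y)"
    and "\<And>t u. t \<in> carrier T \<Longrightarrow> u \<in> carrier T \<Longrightarrow> P t \<Longrightarrow> P u \<Longrightarrow> P (t \<oplus>\<^bsub>T\<^esub> u)"
    and "\<And>t. t \<in> carrier T \<Longrightarrow> P t \<Longrightarrow> P (\<ominus>\<^bsub>T\<^esub> t)" and "P \<zero>\<^bsub>T\<^esub>"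
  shows "P t"
proof -
  obtain c where c: "Poly_Mapping.keys c \<subseteq> carrier M \<times> carrier N" "t = K #>\<^bsub>F\<^esub> c" using t by (auto simp: tensor_carrier)
  have "P (K #>\<^bsub>F\<^esub> c)"
    using c(1)
  proof (induction rule: frag_keys_induct)
    case zero then show ?case using assms(5) by (simp add: tensor_zero)
  next
    case (diff c d)
    let ?c = "K #>\<^bsub>F\<^esub> c" let ?d = "K #>\<^bsub>F\<^esub> d"
    have car: "?c \<in> carrier T" "?d \<in> carrier T" using diff by (auto simp: tensor_carrier)
    have "K #>\<^bsub>F\<^esub> (c - d) \<in> carrier T" using diff keys_diff[of c d] by (auto simp: tensor_carrier)
    moreover have "(K #>\<^bsub>F\<^esub> (c - d)) \<oplus>\<^bsub>T\<^esub> ?d = ?c" by (simp add: tensor_add)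
    ultimately have "K #>\<^bsub>F\<^esub> (c - d) = ?c \<oplus>\<^bsub>T\<^esub> \<ominus>\<^bsub>T\<^esub> ?d"
      using car by (metis TG.a_assoc TG.a_inv_closed TG.r_neg TG.r_zero)
    then show ?case using assms(3,4) diff car by simp
  next
    case (generator p)
    then show ?case using assms(2) by (cases p) (auto simp: tens_def)
  qed
  then show ?thesis using c by simp
qed

lemma tensor_smult_closed: "s \<in> carrier S \<Longrightarrow> t \<in> carrier T \<Longrightarrow> s \<odot>\<^bsub>T\<^esub> t \<in> carrier T"
  using push_carrier[of id M M "\<lambda>y. s \<odot>\<^bsub>N\<^esub> y" N] by (fastforce simp: tensor_carrier tensor_smult)

lemma tensor_smult_add:
  assumes "s \<in> carrier S" "t \<in> carrier T" "u \<in> carrier T"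
  shows "s \<odot>\<^bsub>T\<^esub> (t \<oplus>\<^bsub>T\<^esub> u) = s \<odot>\<^bsub>T\<^esub> t \<oplus>\<^bsub>T\<^esub> s \<odot>\<^bsub>T\<^esub> u"
  using assms by (auto simp: tensor_carrier tensor_smult tensor_add)

lemma tensor_smult_zero: "s \<in> carrier S \<Longrightarrow> s \<odot>\<^bsub>T\<^esub> \<zero>\<^bsub>T\<^esub> = \<zero>\<^bsub>T\<^esub>"
  by (simp add: tensor_zero tensor_smult)

lemma tensor_smult_minus:
  assumes "s \<in> carrier S" "t \<in> carrier T"
  shows "s \<odot>\<^bsub>T\<^esub> (\<ominus>\<^bsub>T\<^esub> t) = \<ominus>\<^bsub>T\<^esub> (s \<odot>\<^bsub>T\<^esub> t)"
proof -
  have "s \<odot>\<^bsub>T\<^esub> (\<ominus>\<^bsub>T\<^esub> t) \<oplus>\<^bsub>T\<^esub> s \<odot>\<^bsub>T\<^esub> t = \<zero>\<^bsub>T\<^esub>"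
    using assms by (simp add: tensor_smult_add[symmetric] TG.l_neg tensor_smult_zero)
  then show ?thesis using assms tensor_smult_closed by (simp add: TG.minus_equality)
qed

lemma module_tensor: "module S T"
proof (rule moduleI)
  show "cring S" by (rule N.R.is_cring)
  show "abelian_group T" by (rule abelian_group_tensor)
  fix s t u v assume s: "s \<in> carrier S" and t: "t \<in> carrier S" and u: "u \<in> carrier T"
  show "s \<odot>\<^bsub>T\<^esub> u \<in> carrier T" by (rule tensor_smult_closed[OF s u])
  show "(s \<oplus>\<^bsub>S\<^esub> t) \<odot>\<^bsub>T\<^esub> u = s \<odot>\<^bsub>T\<^esub> u \<oplus>\<^bsub>T\<^esub> t \<odot>\<^bsub>T\<^esub> u"
    using u
  proof (induction rule: tensor_induct)
    case (tens x y) then show ?case using s t by (simp add: tn_smult N.smult_l_distr tn_add_right)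
  next
    case (add x y) then show ?case using s t by (simp add: tensor_smult_add TG.a_ac tensor_smult_closed)
  next
    case (minus x) then show ?case using s t by (simp add: tensor_smult_minus TG.minus_add tensor_smult_closed)
  qed (use s t in \<open>simp add: tensor_smult_zero\<close>)
  show "(s \<otimes>\<^bsub>S\<^esub> t) \<odot>\<^bsub>T\<^esub> u = s \<odot>\<^bsub>T\<^esub> (t \<odot>\<^bsub>T\<^esub> u)"
    using u
  proof (induction rule: tensor_induct)
    case (tens x y) then show ?case using s t by (simp add: tn_smult N.smult_assoc1)
  qed (use s t in \<open>simp_all add: tensor_smult_add tensor_smult_minus tensor_smult_zero tensor_smult_closed\<close>)
next
  show "\<one>\<^bsub>S\<^esub> \<odot>\<^bsub>T\<^esub> u = u" if "u \<in> carrier T" for u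
    using that
    by (induction rule: tensor_induct) (simp_all add: tn_smult tensor_smult_add tensor_smult_minus tensor_smult_zero)
qed (rule tensor_smult_add)

sublocale T: module S T by (rule module_tensor)

lemma submodule_tensor_eq:
  assumes W: "submodule W S T" and gen: "\<And>x y. x \<in> carrier M \<Longrightarrow> y \<in> carrier N \<Longrightarrow> tn x y \<in> W" and t: "t \<in> carrier T"
  shows "t \<in> W"
  using t by (induction rule: tensor_induct) (auto intro: gen T.sub_add[OF W] T.sub_minus[OF W] T.sub_zero[OF W])

lemma tn_zero [simp]: "y \<in> carrier N \<Longrightarrow> tn \<zero>\<^bsub>M\<^esub> y = \<zero>\<^bsub>T\<^esub>" "x \<in> carrier M \<Longrightarrow> tn x \<zero>\<^bsub>N\<^esub> = \<zero>\<^bsub>T\<^esub>"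
proof -
  assume y: "y \<in> carrier N"
  have "tn \<zero>\<^bsub>M\<^esub> y = tn \<zero>\<^bsub>M\<^esub> y \<oplus>\<^bsub>T\<^esub> tn \<zero>\<^bsub>M\<^esub> y" using y tn_add_left[of "\<zero>\<^bsub>M\<^esub>" "\<zero>\<^bsub>M\<^esub>" y] by simp
  then show "tn \<zero>\<^bsub>M\<^esub> y = \<zero>\<^bsub>T\<^esub>" using y by (metis M.M.zero_closed TG.add.r_cancel_one' tn_closed)
next
  assume x: "x \<in> carrier M"
  have "tn x \<zero>\<^bsub>N\<^esub> = tn x \<zero>\<^bsub>N\<^esub> \<oplus>\<^bsub>T\<^esub> tn x \<zero>\<^bsub>N\<^esub>" using x tn_add_right[of x "\<zero>\<^bsub>N\<^esub>" "\<zero>\<^bsub>N\<^esub>"] by simp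
  then show "tn x \<zero>\<^bsub>N\<^esub> = \<zero>\<^bsub>T\<^esub>" using x by (metis N.M.zero_closed TG.add.r_cancel_one' tn_closed)
qed

text \<open>A balanced bilinear map extends to the free group and kills the relators. It serves to
  read off from a tensor a vector over \<open>N\<close>, possibly modulo relations.\<close>

theorem tensor_universal:
  assumes G: "module S G"
    and closed: "\<And>x y. x \<in> carrier M \<Longrightarrow> y \<in> carrier N \<Longrightarrow> \<beta> x y \<in> carrier G"
    and left: "\<And>x x' y. x \<in> carrier M \<Longrightarrow> x' \<in> carrier M \<Longrightarrow> y \<in> carrier N \<Longrightarrow> \<beta> (x \<oplus>\<^bsub>M\<^esub> x') y = \<beta> x y \<oplus>\<^bsub>G\<^esub> \<beta> x' y"
    and right: "\<And>x y y'. x \<in> carrier M \<Longrightarrow> y \<in> carrier N \<Longrightarrow> y' \<in> carrier N \<Longrightarrow> \<beta> x (y \<oplus>\<^bsub>N\<^esub> y') = \<beta> x y \<oplus>\<^bsub>G\<^esub> \<beta> x y'"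
    and bal: "\<And>r x y. r \<in> carrier R \<Longrightarrow> x \<in> carrier M \<Longrightarrow> y \<in> carrier N \<Longrightarrow> \<beta> (r \<odot>\<^bsub>M\<^esub> x) y = \<beta> x (f r \<odot>\<^bsub>N\<^esub> y)"
    and smult: "\<And>s x y. s \<in> carrier S \<Longrightarrow> x \<in> carrier M \<Longrightarrow> y \<in> carrier N \<Longrightarrow> \<beta> x (s \<odot>\<^bsub>N\<^esub> y) = s \<odot>\<^bsub>G\<^esub> \<beta> x y"
  shows "\<exists>h\<in>module_homs S T G. \<forall>x\<in>carrier M. \<forall>y\<in>carrier N. h (tn x y) = \<beta> x y"
proof -
  interpret G: module S G by fact
  have "(\<lambda>(x, y). \<beta> x y) ` (carrier M \<times> carrier N) \<subseteq> carrier (add_monoid G)" using closed by auto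
  from comm_group.free_Abelian_group_universal[OF G.M.a_comm_group this]
  obtain h where h: "h \<in> hom F (add_monoid G)" "\<And>p. p \<in> carrier M \<times> carrier N \<Longrightarrow> h (frag_of p) = (\<lambda>(x, y). \<beta> x y) p" by metis
  let ?C = "\<lambda>c. Poly_Mapping.keys c \<subseteq> carrier M \<times> carrier N"
  have hc: "h c \<in> carrier G" if "?C c" for c using h(1) that by (auto simp: hom_def)
  have hadd: "h (c + d) = h c \<oplus>\<^bsub>G\<^esub> h d" if "?C c" "?C d" for c d using h(1) that by (auto simp: hom_def)
  have h0: "h 0 = \<zero>\<^bsub>G\<^esub>" using hadd[of 0 0] hc[of 0] by (metis G.M.add.r_cancel_one' add.right_neutral empty_subsetI keys_zero)
  have hdiff: "h (c - d) = h c \<ominus>\<^bsub>G\<^esub> h d" if "?C c" "?C d" for c d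
  proof -
    have cd: "?C (c - d)" using that keys_diff[of c d] by auto
    have "h c = h (c - d) \<oplus>\<^bsub>G\<^esub> h d" using hadd[OF cd that(2)] by simp
    then show ?thesis using hc[OF cd] hc[OF that(2)] by (simp add: a_minus_def G.M.a_assoc G.M.r_neg)
  qed
  have hof: "h (frag_of (x, y)) = \<beta> x y" if "x \<in> carrier M" "y \<in> carrier N" for x y using h(2) that by simp
  have ker: "h c = \<zero>\<^bsub>G\<^esub>" if "c \<in> K" for c
    using that
  proof (induction rule: kernel_induct)
    case (1 c)
    have C: "?C (frag_of (x, y))" if "x \<in> carrier M" "y \<in> carrier N" for x y using that by (simp add: keys_frag_of)
    have C2: "?C (frag_of (x, y) - frag_of (x', y'))"
      if "x \<in> carrier M" "y \<in> carrier N" "x' \<in> carrier M" "y' \<in> carrier N" for x y x' y'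
      using that keys_diff[of "frag_of (x, y)" "frag_of (x', y')"] by (auto simp: keys_frag_of)
    from 1 show ?case
    proof (cases rule: relator_cases)
      case (add_left x x' y)
      then show ?thesis
        using closed by (simp add: hdiff C C2 hof left a_minus_def G.M.a_ac G.M.r_neg1 G.M.r_neg)
    next
      case (add_right x y y')
      then show ?thesis
        using closed by (simp add: hdiff C C2 hof right a_minus_def G.M.a_ac G.M.r_neg1 G.M.r_neg)
    next
      case (balanced r x y)
      then show ?thesis using closed by (simp add: hdiff C hof bal)
    qed
  next
    case 2 then show ?case by (rule h0)
  next
    case (3 c d) then show ?case using hadd[of c d] kernel_carrier by simp
  next
    case (4 c) then show ?case using hdiff[of 0 c] kernel_carrier h0 by simp
  qed
  \<comment> \<open>\<open>h\<close> is controlled only on elements supported in the carriers, so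
    the chosen representative is required to be one of these.\<close>
  define H where "H t = h (SOME c. c \<in> t \<and> ?C c)" for t
  have Hc: "H (K #>\<^bsub>F\<^esub> c) = h c" if c: "?C c" for c
  proof -
    have "c \<in> K #>\<^bsub>F\<^esub> c \<and> ?C c" using c kernel_zero by (simp add: coset_iff)
    then have "(SOME d. d \<in> K #>\<^bsub>F\<^esub> c \<and> ?C d) \<in> K #>\<^bsub>F\<^esub> c \<and> ?C (SOME d. d \<in> K #>\<^bsub>F\<^esub> c \<and> ?C d)" by (rule someI)
    then obtain d where d: "H (K #>\<^bsub>F\<^esub> c) = h d" "d - c \<in> K" "?C d" by (auto simp: H_def coset_iff)
    have "h ((d - c) + c) = h (d - c) \<oplus>\<^bsub>G\<^esub> h c" by (rule hadd[OF kernel_carrier[OF d(2)] c])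
    then show ?thesis using d(1) ker[OF d(2)] hc[OF c] by simp
  qed
  have Hadd: "H (t \<oplus>\<^bsub>T\<^esub> u) = H t \<oplus>\<^bsub>G\<^esub> H u" if tu: "t \<in> carrier T" "u \<in> carrier T" for t u
  proof -
    obtain c where c: "?C c" "t = K #>\<^bsub>F\<^esub> c" using tu(1) by (auto simp: tensor_carrier)
    obtain d where d: "?C d" "u = K #>\<^bsub>F\<^esub> d" using tu(2) by (auto simp: tensor_carrier)
    have "?C (c + d)" using keys_add[of c d] Un_least[OF c(1) d(1)] by (rule order_trans)
    then show ?thesis using c d by (simp add: tensor_add Hc hadd)
  qed
  have Hcl: "H t \<in> carrier G" if "t \<in> carrier T" for t using that hc Hc by (auto simp: tensor_carrier)
  have H0: "H \<zero>\<^bsub>T\<^esub> = \<zero>\<^bsub>G\<^esub>" by (simp add: tensor_zero Hc h0)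
  have Hmin: "H (\<ominus>\<^bsub>T\<^esub> t) = \<ominus>\<^bsub>G\<^esub> H t" if t: "t \<in> carrier T" for t
  proof -
    have "H (\<ominus>\<^bsub>T\<^esub> t) \<oplus>\<^bsub>G\<^esub> H t = \<zero>\<^bsub>G\<^esub>" using t Hadd[of "\<ominus>\<^bsub>T\<^esub> t" t] H0 by (simp add: TG.l_neg)
    then show ?thesis using t Hcl by (simp add: G.M.minus_equality)
  qed
  have Htn: "H (tn x y) = \<beta> x y" if "x \<in> carrier M" "y \<in> carrier N" for x y
    using that Hc[of "frag_of (x, y)"] by (simp add: tens_def hof keys_frag_of)
  have "H \<in> module_homs S T G"
  proof (rule module_homsI)
    fix s t assume s: "s \<in> carrier S" and t: "t \<in> carrier T"
    show "H (s \<odot>\<^bsub>T\<^esub> t) = s \<odot>\<^bsub>G\<^esub> H t"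
      using t
    proof (induction rule: tensor_induct)
      case (tens x y) then show ?case using s by (simp add: tn_smult Htn smult)
    next
      case (add t u) then show ?case using s Hcl by (simp add: T.smult_r_distr Hadd G.smult_r_distr)
    next
      case (minus t) then show ?case using s Hcl by (simp add: T.smult_r_minus Hmin G.smult_r_minus)
    qed (use s H0 in simp)
  qed (use Hcl Hadd in auto)
  then show ?thesis using Htn by blast
qed

end

section \<open>Vectors\<close>

text \<open>All sequences, not only finitely supported ones: one type serves every length
  \<open>n\<close>, and over \<open>R\<close> it is the type from which \<open>flat_over\<close>
  builds its modules. Where finiteness matters, only the first coordinates are looked at.\<close>

definition fun_module :: "('a, 'l, 'k) module_scheme \<Rightarrow> ('a, nat \<Rightarrow> 'l) module" where
  "fun_module L = \<lparr>carrier = {v. \<forall>i. v i \<in> carrier L}, monoid.mult = undefined, one = undefined,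
     ring.zero = (\<lambda>i. \<zero>\<^bsub>L\<^esub>), add = (\<lambda>v w i. v i \<oplus>\<^bsub>L\<^esub> w i), smult = (\<lambda>a v i. a \<odot>\<^bsub>L\<^esub> v i)\<rparr>"

lemma fun_module_simps [simp]:
  "v \<in> carrier (fun_module L) \<longleftrightarrow> (\<forall>i. v i \<in> carrier L)"
  "\<zero>\<^bsub>fun_module L\<^esub> = (\<lambda>i. \<zero>\<^bsub>L\<^esub>)" "v \<oplus>\<^bsub>fun_module L\<^esub> w = (\<lambda>i. v i \<oplus>\<^bsub>L\<^esub> w i)"
  "a \<odot>\<^bsub>fun_module L\<^esub> v = (\<lambda>i. a \<odot>\<^bsub>L\<^esub> v i)"
  by (simp_all add: fun_module_def)

context module
begin

lemma module_fun_module: "module R (fun_module M)"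
proof (rule moduleI)
  show "abelian_group (fun_module M)"
  proof (rule abelian_groupI)
    fix v assume "v \<in> carrier (fun_module M)"
    then show "\<exists>w\<in>carrier (fun_module M). w \<oplus>\<^bsub>fun_module M\<^esub> v = \<zero>\<^bsub>fun_module M\<^esub>"
      by (intro bexI[of _ "\<lambda>i. \<ominus>\<^bsub>M\<^esub> v i"]) (auto simp: M.l_neg)
  qed (auto simp: M.a_ac)
qed (auto simp: R.is_cring smult_l_distr smult_r_distr smult_assoc1)

lemma fun_module_minus: "v \<in> carrier (fun_module M) \<Longrightarrow> \<ominus>\<^bsub>fun_module M\<^esub> v = (\<lambda>i. \<ominus>\<^bsub>M\<^esub> v i)"
proof -
  interpret FM: module R "fun_module M" by (rule module_fun_module)
  assume v: "v \<in> carrier (fun_module M)"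
  then show ?thesis by (intro FM.M.minus_equality) (auto simp: M.l_neg)
qed

lemma finsum_fun_module:
  assumes "\<And>i. i < n \<Longrightarrow> g i \<in> carrier (fun_module M)"
  shows "finsum (fun_module M) g {..<n::nat} = (\<lambda>j. finsum M (\<lambda>i. g i j) {..<n})"
  using assms
proof (induction n)
  interpret FM: module R "fun_module M" by (rule module_fun_module)
  case 0 then show ?case by simp
next
  interpret FM: module R "fun_module M" by (rule module_fun_module)
  case (Suc n)
  have "g i j \<in> carrier M" if "i < Suc n" for i j using Suc.prems[OF that] by simp
  then show ?case using Suc
    by (simp add: lessThan_Suc FM.M.finsum_insert M.finsum_insert Pi_def)
qed

lemma finsum_single:
  assumes "\<And>j. x j \<in> carrier M"
  shows "finsum M (\<lambda>i. if j = i then x i else \<zero>\<^bsub>M\<^esub>) {..<n::nat} = (if j < n then x j else \<zero>\<^bsub>M\<^esub>)"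
  by (induction n) (auto simp: lessThan_Suc M.finsum_insert Pi_def assms less_Suc_eq)

end

lemma finsum_hom:
  assumes "module A L" "module A M" "g \<in> module_homs A L M" "\<And>i. i < n \<Longrightarrow> x i \<in> carrier L"
  shows "g (finsum L x {..<n::nat}) = finsum M (\<lambda>i. g (x i)) {..<n}"
  using assms(4)
proof (induction n)
  interpret L: module A L by fact
  interpret M: module A M by fact
  case 0 then show ?case using module_homs_zero[OF assms(1-3)] by simp
next
  interpret L: module A L by fact
  interpret M: module A M by fact
  case (Suc n)
  have "finsum L x {..<n} \<in> carrier L" using Suc.prems by (intro L.M.finsum_closed) auto
  then show ?case using Suc module_homsD[OF assms(3)]
    by (simp add: lessThan_Suc L.M.finsum_insert M.M.finsum_insert Pi_def)
qed

definition unit_vector :: "('a, 'r) ring_scheme \<Rightarrow> nat \<Rightarrow> nat \<Rightarrow> 'a" where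
  "unit_vector A i = (\<lambda>j. if j = i then \<one>\<^bsub>A\<^esub> else \<zero>\<^bsub>A\<^esub>)"

text \<open>For a submodule \<open>W\<close> of the vectors over \<open>R\<close>, the submodule \<open>W N\<close> of the vectors over \<open>N\<close>.\<close>

definition extend_vectors ::
    "('b, 's) ring_scheme \<Rightarrow> ('a \<Rightarrow> 'b) \<Rightarrow> ('b, 'n, 'j) module_scheme \<Rightarrow> (nat \<Rightarrow> 'a) set \<Rightarrow> (nat \<Rightarrow> 'n) set" where
  "extend_vectors S f N W = submodule_span S (fun_module N) {\<lambda>i. f (k i) \<odot>\<^bsub>N\<^esub> z | k z. k \<in> W \<and> z \<in> carrier N}"

abbreviation vectors :: "('a, 'r) ring_scheme \<Rightarrow> ('a, nat \<Rightarrow> 'a) module" where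
  "vectors A \<equiv> fun_module (ring_module A)"

lemma tensor_map_coset:
  assumes L: "tensor_modules R L S N f" and M: "tensor_modules R M S N f" and g: "g \<in> module_homs R L M"
  shows "tensor_map R f M N g (tensor_kernel R f L N #>\<^bsub>tensor_free L N\<^esub> c) =
    tensor_kernel R f M N #>\<^bsub>tensor_free M N\<^esub> push g id c"
proof -
  interpret L: tensor_modules R L S N f by fact
  interpret M: tensor_modules R M S N f by fact
  have "tensor_map R f M N g (L.K #>\<^bsub>L.F\<^esub> c) = (\<Union>d\<in>L.K #>\<^bsub>L.F\<^esub> c. M.K #>\<^bsub>M.F\<^esub> push g id d)"
    by (simp add: tensor_map_def push_def)
  moreover have "M.K #>\<^bsub>M.F\<^esub> push g id d = M.K #>\<^bsub>M.F\<^esub> push g id c" if "d \<in> L.K #>\<^bsub>L.F\<^esub> c" for d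
  proof (rule M.coset_eqI)
    have "push g id (d - c) \<in> M.K"
      using push_kernel[OF L M g L.id_homs(2)] that by (simp only: L.coset_iff)
    then show "push g id d - push g id c \<in> M.K" by simp
  qed
  moreover have "c \<in> L.K #>\<^bsub>L.F\<^esub> c" using L.kernel_zero by (simp add: L.coset_iff)
  ultimately show ?thesis by blast
qed

lemma tensor_map_tens:
  assumes "tensor_modules R L S N f" "tensor_modules R M S N f" "g \<in> module_homs R L M"
  shows "tensor_map R f M N g (tens R f L N x y) = tens R f M N (g x) y"
  unfolding tens_def tensor_map_coset[OF assms] by simp

lemma tensor_map_homs:
  assumes L: "tensor_modules R L S N f" and M: "tensor_modules R M S N f" and g: "g \<in> module_homs R L M"
  shows "tensor_map R f M N g \<in> module_homs S (tensor R f L N) (tensor R f M N)"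
proof -
  interpret L: tensor_modules R L S N f by fact
  interpret M: tensor_modules R M S N f by fact
  note map = tensor_map_coset[OF L M g]
  note g' = module_homsD[OF g]
  show ?thesis
  proof (rule module_homsI)
    fix t assume "t \<in> carrier L.T"
    then obtain c where c: "Poly_Mapping.keys c \<subseteq> carrier L \<times> carrier N" "t = L.K #>\<^bsub>L.F\<^esub> c" by (auto simp: L.tensor_carrier)
    have "Poly_Mapping.keys (push g id c) \<subseteq> carrier M \<times> carrier N"
      using g'(1) by (intro push_carrier[OF _ _ c(1)]) auto
    then show "tensor_map R f M N g t \<in> carrier M.T" unfolding c(2) map M.tensor_carrier by blast
    fix s assume s: "s \<in> carrier S"
    have "push g id (push id (\<lambda>y. s \<odot>\<^bsub>N\<^esub> y) c) = push id (\<lambda>y. s \<odot>\<^bsub>N\<^esub> y) (push g id c)"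
      using c(1) by (induction rule: frag_keys_induct) auto
    then show "tensor_map R f M N g (s \<odot>\<^bsub>L.T\<^esub> t) = s \<odot>\<^bsub>M.T\<^esub> tensor_map R f M N g t"
      unfolding c(2) by (simp add: map L.tensor_smult[OF s] M.tensor_smult[OF s])
  next
    fix t u assume "t \<in> carrier L.T" "u \<in> carrier L.T"
    then show "tensor_map R f M N g (t \<oplus>\<^bsub>L.T\<^esub> u) = tensor_map R f M N g t \<oplus>\<^bsub>M.T\<^esub> tensor_map R f M N g u"
      by (auto simp: L.tensor_carrier L.tensor_add map M.tensor_add)
  qed
qed

context tensor_modules
begin

lemma hom_simps: "f \<zero>\<^bsub>R\<^esub> = \<zero>\<^bsub>S\<^esub>" "f \<one>\<^bsub>R\<^esub> = \<one>\<^bsub>S\<^esub>"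
  "a \<in> carrier R \<Longrightarrow> b \<in> carrier R \<Longrightarrow> f (a \<oplus>\<^bsub>R\<^esub> b) = f a \<oplus>\<^bsub>S\<^esub> f b"
  "a \<in> carrier R \<Longrightarrow> b \<in> carrier R \<Longrightarrow> f (a \<otimes>\<^bsub>R\<^esub> b) = f a \<otimes>\<^bsub>S\<^esub> f b"
  "a \<in> carrier R \<Longrightarrow> f (\<ominus>\<^bsub>R\<^esub> a) = \<ominus>\<^bsub>S\<^esub> f a"
proof -
  interpret h: ring_hom_cring R S f
    by (intro ring_hom_cring.intro ring_hom_cring_axioms.intro M.R.is_cring N.R.is_cring hom)
  show "f \<zero>\<^bsub>R\<^esub> = \<zero>\<^bsub>S\<^esub>" "f \<one>\<^bsub>R\<^esub> = \<one>\<^bsub>S\<^esub>"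
    "a \<in> carrier R \<Longrightarrow> b \<in> carrier R \<Longrightarrow> f (a \<oplus>\<^bsub>R\<^esub> b) = f a \<oplus>\<^bsub>S\<^esub> f b"
    "a \<in> carrier R \<Longrightarrow> b \<in> carrier R \<Longrightarrow> f (a \<otimes>\<^bsub>R\<^esub> b) = f a \<otimes>\<^bsub>S\<^esub> f b"
    "a \<in> carrier R \<Longrightarrow> f (\<ominus>\<^bsub>R\<^esub> a) = \<ominus>\<^bsub>S\<^esub> f a"
    by simp_all
qed

sublocale FN: module S "fun_module N" by (rule N.module_fun_module)
sublocale FR: module R "vectors R" by (rule M.R.self.module_fun_module)

text \<open>For generators \<open>y\<close> of \<open>M\<close>, this and \<open>lin_comb\<close>
  present \<open>T\<close> and \<open>M\<close> as images of the \<open>n\<close>-tuples over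
  \<open>N\<close> and over \<open>R\<close>.\<close>

definition tens_sum :: "(nat \<Rightarrow> 'm) \<Rightarrow> nat \<Rightarrow> (nat \<Rightarrow> 'n) \<Rightarrow> ('m \<times> 'n \<Rightarrow>\<^sub>0 int) set" where
  "tens_sum y n w = finsum T (\<lambda>i. tn (y i) (w i)) {..<n}"

definition lin_comb :: "(nat \<Rightarrow> 'm) \<Rightarrow> nat \<Rightarrow> (nat \<Rightarrow> 'a) \<Rightarrow> 'm" where
  "lin_comb y n v = finsum M (\<lambda>i. v i \<odot>\<^bsub>M\<^esub> y i) {..<n}"

lemma lin_comb_homs:
  assumes y: "\<And>i. i < n \<Longrightarrow> y i \<in> carrier M"
  shows "lin_comb y n \<in> module_homs R (vectors R) M"
proof (rule module_homsI)
  fix v assume v: "v \<in> carrier (vectors R)"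
  then have vc: "v i \<in> carrier R" for i by simp
  show "lin_comb y n v \<in> carrier M" unfolding lin_comb_def using vc y by (intro M.M.finsum_closed) auto
  { fix w assume w: "w \<in> carrier (vectors R)"
    then have wc: "w i \<in> carrier R" for i by simp
    have "lin_comb y n (v \<oplus>\<^bsub>vectors R\<^esub> w) = finsum M (\<lambda>i. v i \<odot>\<^bsub>M\<^esub> y i \<oplus>\<^bsub>M\<^esub> w i \<odot>\<^bsub>M\<^esub> y i) {..<n}"
      unfolding lin_comb_def using vc wc y by (intro M.M.finsum_cong') (auto simp: M.smult_l_distr)
    also have "\<dots> = lin_comb y n v \<oplus>\<^bsub>M\<^esub> lin_comb y n w"
      unfolding lin_comb_def using vc wc y by (intro M.M.finsum_addf) auto
    finally show "lin_comb y n (v \<oplus>\<^bsub>vectors R\<^esub> w) = lin_comb y n v \<oplus>\<^bsub>M\<^esub> lin_comb y n w" . }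
  fix a assume a: "a \<in> carrier R"
  have "a \<odot>\<^bsub>M\<^esub> lin_comb y n v = finsum M (\<lambda>i. a \<odot>\<^bsub>M\<^esub> (v i \<odot>\<^bsub>M\<^esub> y i)) {..<n}"
    unfolding lin_comb_def using a vc y by (intro M.finsum_smult_ldistr) auto
  also have "\<dots> = lin_comb y n (a \<odot>\<^bsub>vectors R\<^esub> v)"
    unfolding lin_comb_def using a vc y by (intro M.M.finsum_cong') (auto simp: M.smult_assoc1)
  finally show "lin_comb y n (a \<odot>\<^bsub>vectors R\<^esub> v) = a \<odot>\<^bsub>M\<^esub> lin_comb y n v" by simp
qed

lemma tens_sum_homs:
  assumes y: "\<And>i. i < n \<Longrightarrow> y i \<in> carrier M"
  shows "tens_sum y n \<in> module_homs S (fun_module N) T"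
proof (rule module_homsI)
  fix v assume v: "v \<in> carrier (fun_module N)"
  then have vc: "v i \<in> carrier N" for i by simp
  show "tens_sum y n v \<in> carrier T" unfolding tens_sum_def using vc y by (intro TG.finsum_closed) auto
  { fix w assume w: "w \<in> carrier (fun_module N)"
    then have wc: "w i \<in> carrier N" for i by simp
    have "tens_sum y n (v \<oplus>\<^bsub>fun_module N\<^esub> w) = finsum T (\<lambda>i. tn (y i) (v i) \<oplus>\<^bsub>T\<^esub> tn (y i) (w i)) {..<n}"
      unfolding tens_sum_def using vc wc y by (intro TG.finsum_cong') (auto simp: tn_add_right)
    also have "\<dots> = tens_sum y n v \<oplus>\<^bsub>T\<^esub> tens_sum y n w"
      unfolding tens_sum_def using vc wc y by (intro TG.finsum_addf) auto
    finally show "tens_sum y n (v \<oplus>\<^bsub>fun_module N\<^esub> w) = tens_sum y n v \<oplus>\<^bsub>T\<^esub> tens_sum y n w" . }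
  fix a assume a: "a \<in> carrier S"
  have "a \<odot>\<^bsub>T\<^esub> tens_sum y n v = finsum T (\<lambda>i. a \<odot>\<^bsub>T\<^esub> tn (y i) (v i)) {..<n}"
    unfolding tens_sum_def using a vc y by (intro T.finsum_smult_ldistr) auto
  also have "\<dots> = tens_sum y n (a \<odot>\<^bsub>fun_module N\<^esub> v)"
    unfolding tens_sum_def using a vc y by (intro TG.finsum_cong') (auto simp: tn_smult)
  finally show "tens_sum y n (a \<odot>\<^bsub>fun_module N\<^esub> v) = a \<odot>\<^bsub>T\<^esub> tens_sum y n v" by simp
qed

lemma tn_finsum_left:
  assumes "\<And>i. i < n \<Longrightarrow> x i \<in> carrier M" "z \<in> carrier N"
  shows "tn (finsum M x {..<n::nat}) z = finsum T (\<lambda>i. tn (x i) z) {..<n}"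
  using assms(1)
proof (induction n)
  case (Suc n)
  have "finsum M x {..<n} \<in> carrier M" using Suc.prems by (intro M.M.finsum_closed) auto
  then show ?case using Suc assms(2)
    by (simp add: lessThan_Suc M.M.finsum_insert TG.finsum_insert Pi_def tn_add_left)
qed (use assms(2) in simp)

text \<open>The scalars \<open>v i\<close> move across the tensor sign; this ties
  \<open>tens_sum\<close> on extended vectors to \<open>lin_comb\<close>.\<close>

lemma tens_sum_extend:
  assumes y: "\<And>i. i < n \<Longrightarrow> y i \<in> carrier M" and v: "v \<in> carrier (vectors R)" and z: "z \<in> carrier N"
  shows "tens_sum y n (\<lambda>i. f (v i) \<odot>\<^bsub>N\<^esub> z) = tn (lin_comb y n v) z"
proof -
  have vc: "v i \<in> carrier R" for i using v by simp
  have "tn (lin_comb y n v) z = finsum T (\<lambda>i. tn (v i \<odot>\<^bsub>M\<^esub> y i) z) {..<n}"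
    unfolding lin_comb_def using vc y z by (intro tn_finsum_left) auto
  also have "\<dots> = tens_sum y n (\<lambda>i. f (v i) \<odot>\<^bsub>N\<^esub> z)"
    unfolding tens_sum_def using vc y z by (intro TG.finsum_cong') (auto simp: tn_balanced)
  finally show ?thesis by simp
qed

lemma tens_sum_cong:
  assumes "\<And>i. i < n \<Longrightarrow> y i \<in> carrier M" "\<And>i. i < n \<Longrightarrow> w i \<in> carrier N" "\<And>i. i < n \<Longrightarrow> v i = w i"
  shows "tens_sum y n v = tens_sum y n w"
  unfolding tens_sum_def using assms by (intro TG.finsum_cong') auto

lemma extend_closed: "v \<in> carrier (vectors R) \<Longrightarrow> z \<in> carrier N \<Longrightarrow> (\<lambda>i. f (v i) \<odot>\<^bsub>N\<^esub> z) \<in> carrier (fun_module N)"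
  by simp

lemma extend_vectors_gens: "W \<subseteq> carrier (vectors R) \<Longrightarrow>
    {\<lambda>i. f (k i) \<odot>\<^bsub>N\<^esub> z | k z. k \<in> W \<and> z \<in> carrier N} \<subseteq> carrier (fun_module N)"
  using extend_closed by blast

lemma extend_vectors_submodule: "W \<subseteq> carrier (vectors R) \<Longrightarrow> submodule (extend_vectors S f N W) S (fun_module N)"
  unfolding extend_vectors_def by (rule FN.submodule_span_submodule[OF extend_vectors_gens])

lemma extend_vectors_mem: "k \<in> W \<Longrightarrow> z \<in> carrier N \<Longrightarrow> (\<lambda>i. f (k i) \<odot>\<^bsub>N\<^esub> z) \<in> extend_vectors S f N W"
  unfolding extend_vectors_def by (rule subsetD[OF FN.submodule_span_superset]) blast

lemma extend_vectors_minimal: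
  assumes "submodule U S (fun_module N)" "\<And>k z. k \<in> W \<Longrightarrow> z \<in> carrier N \<Longrightarrow> (\<lambda>i. f (k i) \<odot>\<^bsub>N\<^esub> z) \<in> U"
  shows "extend_vectors S f N W \<subseteq> U"
  unfolding extend_vectors_def using assms by (intro FN.submodule_span_minimal) auto

lemma unit_vector_closed [simp]: "unit_vector R i \<in> carrier (vectors R)" "unit_vector R i j \<in> carrier R"
  by (auto simp: unit_vector_def)

lemma finsum_unit_vector:
  assumes v: "v \<in> carrier (vectors R)"
  shows "finsum (vectors R) (\<lambda>i. v i \<odot>\<^bsub>vectors R\<^esub> unit_vector R i) {..<n} = (\<lambda>j. if j < n then v j else \<zero>\<^bsub>R\<^esub>)"
proof -
  have vc: "v i \<in> carrier R" for i using v by simp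
  have "finsum (vectors R) (\<lambda>i. v i \<odot>\<^bsub>vectors R\<^esub> unit_vector R i) {..<n} =
      (\<lambda>j. finsum (ring_module R) (\<lambda>i. (v i \<odot>\<^bsub>vectors R\<^esub> unit_vector R i) j) {..<n})"
    using vc by (intro M.R.self.finsum_fun_module) auto
  also have "\<dots> = (\<lambda>j. finsum (ring_module R) (\<lambda>i. if j = i then v i else \<zero>\<^bsub>ring_module R\<^esub>) {..<n})"
    using vc by (intro ext M.R.self.M.finsum_cong') (auto simp: unit_vector_def)
  also have "\<dots> = (\<lambda>j. if j < n then v j else \<zero>\<^bsub>R\<^esub>)"
    using M.R.self.finsum_single[of v] vc by (auto simp: fun_eq_iff)
  finally show ?thesis .
qed

lemma finsum_extend_unit_vector:
  assumes x: "x \<in> carrier (fun_module N)"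
  shows "finsum (fun_module N) (\<lambda>s i. f (unit_vector R s i) \<odot>\<^bsub>N\<^esub> x s) {..<n} = (\<lambda>j. if j < n then x j else \<zero>\<^bsub>N\<^esub>)"
proof -
  have xc: "x i \<in> carrier N" for i using x by simp
  have "finsum (fun_module N) (\<lambda>s i. f (unit_vector R s i) \<odot>\<^bsub>N\<^esub> x s) {..<n} =
      (\<lambda>j. finsum N (\<lambda>s. f (unit_vector R s j) \<odot>\<^bsub>N\<^esub> x s) {..<n})"
    using xc by (intro N.finsum_fun_module) auto
  also have "\<dots> = (\<lambda>j. finsum N (\<lambda>s. if j = s then x s else \<zero>\<^bsub>N\<^esub>) {..<n})"
    using xc by (intro ext N.M.finsum_cong') (auto simp: unit_vector_def hom_simps)
  also have "\<dots> = (\<lambda>j. if j < n then x j else \<zero>\<^bsub>N\<^esub>)"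
    using N.finsum_single[of x] xc by simp
  finally show ?thesis .
qed

end

section \<open>Flatness\<close>

lemma module_homs_smult:
  assumes "module A L" "a \<in> carrier A" shows "(\<lambda>x. a \<odot>\<^bsub>L\<^esub> x) \<in> module_homs A L L"
proof -
  interpret L: module A L by fact
  show ?thesis using assms(2) by (intro module_homsI) (auto simp: L.smult_r_distr L.smult_commute)
qed

lemma (in module) coset_homs:
  assumes "submodule K R M" shows "(\<lambda>x. K +>\<^bsub>M\<^esub> x) \<in> module_homs R M (quot_module M K)"
  by (rule module_homsI) (auto simp: quot_carrier quot_add[OF assms] quot_smult[OF assms])

lemma (in module) diff_eq_zeroD:
  assumes "x \<in> carrier M" "y \<in> carrier M" "x \<ominus>\<^bsub>M\<^esub> y = \<zero>\<^bsub>M\<^esub>" shows "x = y"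
  using M.minus_equality[of x "\<ominus>\<^bsub>M\<^esub> y"] assms by (simp add: a_minus_def)

lemma (in module) submodule_carrier: "submodule K R M \<Longrightarrow> K \<subseteq> carrier M"
  using sub_carr by blast

text \<open>Flatness in the form in which it is used: taking preimages of submodules of vectors commutes
  with extension to \<open>N\<close>. It is the exactness of \<open>W \<otimes> N \<rightarrow> B \<otimes> N \<rightarrow> C \<otimes> N\<close>, where \<open>B\<close> consists of the
  vectors over \<open>R\<close>, \<open>C = B / K\<close>, and \<open>W\<close> is the kernel of the map from \<open>B\<close> to \<open>C\<close> induced by \<open>u\<close>.\<close>

lemma flat_extend_vectors:
  fixes R :: "('a, 'r) ring_scheme" and S :: "('b, 's) ring_scheme" and N :: "('b, 'n, 'j) module_scheme"
  assumes R: "cring R" and N: "module S N" and hom: "f \<in> ring_hom R S" and flat: "flat_over R f N"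
    and K: "submodule K R (vectors R)" and van: "\<And>v. v \<in> carrier (vectors R) \<Longrightarrow> (\<And>i. i < n \<Longrightarrow> v i = \<zero>\<^bsub>R\<^esub>) \<Longrightarrow> v \<in> K"
    and u: "u \<in> module_homs R (vectors R) (vectors R)" and u': "u' \<in> module_homs S (fun_module N) (fun_module N)"
    and comp: "\<And>v z. v \<in> carrier (vectors R) \<Longrightarrow> z \<in> carrier N \<Longrightarrow> u' (\<lambda>i. f (v i) \<odot>\<^bsub>N\<^esub> z) = (\<lambda>i. f (u v i) \<odot>\<^bsub>N\<^esub> z)"
    and x: "x \<in> carrier (fun_module N)" "\<And>i. i \<ge> a \<Longrightarrow> x i = \<zero>\<^bsub>N\<^esub>"
    and w: "w \<in> extend_vectors S f N K" "\<And>i. i < n \<Longrightarrow> u' x i = w i"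
  shows "x \<in> extend_vectors S f N {v \<in> carrier (vectors R). u v \<in> K}"
proof -
  let ?V = "vectors R" let ?W = "{v \<in> carrier ?V. u v \<in> K}" let ?e = "unit_vector R"
  have modR: "module R (ring_module R)" by (rule cring.module_ring_module[OF R])
  interpret E: tensor_modules R "ring_module R" S N f
    by (intro tensor_modules.intro tensor_modules_axioms.intro modR N hom)
  note Z = E.FR.submodule_zero
  \<comment> \<open>The quotient by zero is only a change of type: \<open>B\<close> is the module of
    vectors, carried by sets of vectors as \<open>flat_over\<close> demands. Below, \<open>q\<close>
    is the isomorphism and \<open>r\<close> its inverse.\<close>
  define B where "B = quot_module ?V {\<zero>\<^bsub>?V\<^esub>}"
  define C where "C = quot_module ?V K"
  define q where "q v = {\<zero>\<^bsub>?V\<^esub>} +>\<^bsub>?V\<^esub> v" for v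
  define c where "c v = K +>\<^bsub>?V\<^esub> v" for v
  define r where "r Y = (SOME v. v \<in> carrier ?V \<and> Y = q v)" for Y
  define h where "h Y = c (u (r Y))" for Y
  have modB: "module R B" unfolding B_def by (rule E.FR.module_quot[OF Z])
  have modC: "module R C" unfolding C_def by (rule E.FR.module_quot[OF K])
  interpret B: module R B by fact
  interpret C: module R C by fact
  note uD = module_homsD[OF u]
  have q_hom: "q \<in> module_homs R ?V B" unfolding q_def B_def by (rule E.FR.coset_homs[OF Z])
  have c_hom: "c \<in> module_homs R ?V C" unfolding c_def C_def by (rule E.FR.coset_homs[OF K])
  note qD = module_homsD[OF q_hom] and cD = module_homsD[OF c_hom]
  have q_inj: "v = v'" if "v \<in> carrier ?V" "v' \<in> carrier ?V" "q v = q v'" for v v'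
  proof -
    have "v \<ominus>\<^bsub>?V\<^esub> v' = \<zero>\<^bsub>?V\<^esub>" using that E.FR.coset_eq_iff[OF Z that(1,2)] by (simp add: q_def)
    then show ?thesis by (rule E.FR.diff_eq_zeroD[OF that(1,2)])
  qed
  have B_carrier: "\<exists>v. v \<in> carrier ?V \<and> Y = q v" if "Y \<in> carrier B" for Y
    using that unfolding B_def q_def E.FR.quot_carrier by blast
  have rq: "r (q v) = v" if v: "v \<in> carrier ?V" for v
  proof -
    have "r (q v) \<in> carrier ?V \<and> q v = q (r (q v))" unfolding r_def
      by (rule someI[of "\<lambda>v'. v' \<in> carrier ?V \<and> q v = q v'" v]) (use v in blast)
    then show ?thesis using q_inj v by metis
  qed
  have c_zero: "c v = \<zero>\<^bsub>C\<^esub> \<longleftrightarrow> v \<in> K" if "v \<in> carrier ?V" for v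
    using E.FR.coset_eq_zero_iff[OF K that] by (simp add: c_def C_def E.FR.quot_zero)
  have h_hom: "h \<in> module_homs R B C"
  proof (rule module_homsI)
    fix Y assume "Y \<in> carrier B"
    then obtain v where v: "v \<in> carrier ?V" "Y = q v" using B_carrier by blast
    show "h Y \<in> carrier C" using v rq[OF v(1)] uD(1) cD(1) unfolding h_def by metis
    { fix Y' assume "Y' \<in> carrier B"
      then obtain v' where v': "v' \<in> carrier ?V" "Y' = q v'" using B_carrier by blast
      have s: "v \<oplus>\<^bsub>?V\<^esub> v' \<in> carrier ?V" using v v' E.FR.M.a_closed by blast
      have "h (Y \<oplus>\<^bsub>B\<^esub> Y') = c (u (v \<oplus>\<^bsub>?V\<^esub> v'))"
        unfolding h_def v(2) v'(2) qD(2)[OF v(1) v'(1), symmetric] rq[OF s] ..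
      also have "\<dots> = h Y \<oplus>\<^bsub>C\<^esub> h Y'"
        unfolding h_def v(2) v'(2) rq[OF v(1)] rq[OF v'(1)] uD(2)[OF v(1) v'(1)]
        by (rule cD(2)[OF uD(1)[OF v(1)] uD(1)[OF v'(1)]])
      finally show "h (Y \<oplus>\<^bsub>B\<^esub> Y') = h Y \<oplus>\<^bsub>C\<^esub> h Y'" . }
    fix b assume b: "b \<in> carrier R"
    have s: "b \<odot>\<^bsub>?V\<^esub> v \<in> carrier ?V" using b v E.FR.smult_closed by blast
    have "h (b \<odot>\<^bsub>B\<^esub> Y) = c (u (b \<odot>\<^bsub>?V\<^esub> v))" unfolding h_def v(2) qD(3)[OF b v(1), symmetric] rq[OF s] ..
    also have "\<dots> = b \<odot>\<^bsub>C\<^esub> h Y"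
      unfolding h_def v(2) rq[OF v(1)] uD(3)[OF b v(1)] by (rule cD(3)[OF b uD(1)[OF v(1)]])
    finally show "h (b \<odot>\<^bsub>B\<^esub> Y) = b \<odot>\<^bsub>C\<^esub> h Y" .
  qed
  define A where "A = B\<lparr>carrier := {Y \<in> carrier B. h Y = \<zero>\<^bsub>C\<^esub>}\<rparr>"
  have modA: "module R A" unfolding A_def
    by (rule submodule.submodule_is_module[OF submodule_kernel_hom[OF modB modC h_hom] modB])
  have A_carrier: "carrier A = {Y \<in> carrier B. h Y = \<zero>\<^bsub>C\<^esub>}" by (simp add: A_def)
  have g_hom: "(\<lambda>Y. Y) \<in> module_homs R A B" by (rule module_homsI) (auto simp: A_def)
  interpret TA: tensor_modules R A S N f by (intro tensor_modules.intro tensor_modules_axioms.intro modA N hom)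
  interpret TB: tensor_modules R B S N f by (intro tensor_modules.intro tensor_modules_axioms.intro modB N hom)
  interpret TC: tensor_modules R C S N f by (intro tensor_modules.intro tensor_modules_axioms.intro modC N hom)
  have "(\<lambda>Y. Y) ` carrier A = a_kernel B C h" unfolding A_carrier by (simp add: a_kernel_def')
  then have exact: "tensor_map R f B N (\<lambda>Y. Y) ` carrier TA.T = a_kernel TB.T TC.T (tensor_map R f C N h)"
    using flat[unfolded flat_over_def] modA modB modC g_hom h_hom by blast
  let ?g = "tensor_map R f B N (\<lambda>Y. Y)" let ?h = "tensor_map R f C N h"
  note gT = tensor_map_homs[OF TA.tensor_modules_axioms TB.tensor_modules_axioms g_hom]
    and hT = tensor_map_homs[OF TB.tensor_modules_axioms TC.tensor_modules_axioms h_hom]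
  have xc: "x i \<in> carrier N" for i using x(1) by simp
  have e: "?e s \<in> carrier ?V" for s by (rule E.unit_vector_closed(1))
  \<comment> \<open>The lift of \<open>x\<close> to \<open>B \<otimes> N\<close>. It is a finite
    sum, which is possible because \<open>x\<close> vanishes from index \<open>a\<close> on.\<close>
  define t where "t = TB.tens_sum (\<lambda>s. q (?e s)) a x"
  have tB: "t \<in> carrier TB.T"
    unfolding t_def using module_homsD(1)[OF TB.tens_sum_homs[of a "\<lambda>s. q (?e s)"] x(1)] qD(1)[OF e] by blast
  have x_sum: "finsum (fun_module N) (\<lambda>s i. f (?e s i) \<odot>\<^bsub>N\<^esub> x s) {..<a} = x"
    unfolding E.finsum_extend_unit_vector[OF x(1)] using x(2) by (auto simp: fun_eq_iff)
  let ?\<Theta> = "TC.tens_sum (\<lambda>i. c (?e i)) n"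
  have ce: "c (?e i) \<in> carrier C" for i by (rule cD(1)[OF e])
  have \<Theta>_hom: "?\<Theta> \<in> module_homs S (fun_module N) TC.T" using ce by (rule TC.tens_sum_homs)
  \<comment> \<open>Vectors vanishing in the first \<open>n\<close> coordinates lie in
    \<open>K\<close>, so the class of \<open>v\<close> in \<open>C\<close> depends only on these
    coordinates and is a finite combination of classes of unit vectors.\<close>
  have lin: "TC.lin_comb (\<lambda>i. c (?e i)) n v = c v" if v: "v \<in> carrier ?V" for v
  proof -
    have vc: "v i \<in> carrier R" for i using v by simp
    have sm: "v i \<odot>\<^bsub>?V\<^esub> ?e i \<in> carrier ?V" for i using vc e E.FR.smult_closed by blast
    let ?v = "\<lambda>j. if j < n then v j else \<zero>\<^bsub>R\<^esub>"
    have v'c: "?v \<in> carrier ?V" using vc by simp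
    have "TC.lin_comb (\<lambda>i. c (?e i)) n v = finsum C (\<lambda>i. c (v i \<odot>\<^bsub>?V\<^esub> ?e i)) {..<n}"
      unfolding TC.lin_comb_def cD(3)[OF vc e] ..
    also have "\<dots> = c (finsum ?V (\<lambda>i. v i \<odot>\<^bsub>?V\<^esub> ?e i) {..<n})"
      by (rule finsum_hom[OF E.FR.module_self modC c_hom sm, symmetric])
    also have "\<dots> = c ?v" unfolding E.finsum_unit_vector[OF v] ..
    also have "\<dots> = c v"
    proof -
      have minus: "\<ominus>\<^bsub>?V\<^esub> v = (\<lambda>i. \<ominus>\<^bsub>R\<^esub> v i)" using module.fun_module_minus[OF modR v] cring.ring_module_simps[OF R] by simp
      have "?v \<ominus>\<^bsub>?V\<^esub> v = (\<lambda>i. ?v i \<oplus>\<^bsub>R\<^esub> \<ominus>\<^bsub>R\<^esub> v i)" unfolding a_minus_def minus by (simp add: cring.ring_module_simps[OF R])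
      moreover have "v i \<oplus>\<^bsub>R\<^esub> \<ominus>\<^bsub>R\<^esub> v i = \<zero>\<^bsub>R\<^esub>" for i using vc E.M.R.r_neg by blast
      ultimately have "(?v \<ominus>\<^bsub>?V\<^esub> v) i = \<zero>\<^bsub>R\<^esub>" if "i < n" for i using that by simp
      then have "?v \<ominus>\<^bsub>?V\<^esub> v \<in> K" by (rule van[OF E.FR.M.minus_closed[OF v'c v]])
      then show ?thesis unfolding c_def using E.FR.coset_eq_iff[OF K v'c v] by blast
    qed
    finally show ?thesis .
  qed
  have \<Theta>_ext: "?\<Theta> (\<lambda>i. f (v i) \<odot>\<^bsub>N\<^esub> z) = TC.tn (c v) z" if "v \<in> carrier ?V" "z \<in> carrier N" for v z
    using TC.tens_sum_extend[of n "\<lambda>i. c (?e i)", OF ce that] lin[OF that(1)] by simp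
  have "extend_vectors S f N K \<subseteq> {w \<in> carrier (fun_module N). ?\<Theta> w = \<zero>\<^bsub>TC.T\<^esub>}"
  proof (rule E.extend_vectors_minimal[OF submodule_kernel_hom[OF E.FN.module_self TC.module_tensor \<Theta>_hom]])
    fix k z assume k: "k \<in> K" and z: "z \<in> carrier N"
    have kc: "k \<in> carrier ?V" by (rule E.FR.sub_carr[OF K k])
    then have "?\<Theta> (\<lambda>i. f (k i) \<odot>\<^bsub>N\<^esub> z) = TC.tn \<zero>\<^bsub>C\<^esub> z" using \<Theta>_ext[OF kc z] c_zero[OF kc] k by simp
    then show "(\<lambda>i. f (k i) \<odot>\<^bsub>N\<^esub> z) \<in> {w \<in> carrier (fun_module N). ?\<Theta> w = \<zero>\<^bsub>TC.T\<^esub>}"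
      using z kc E.extend_closed by simp
  qed
  then have w0: "w \<in> carrier (fun_module N)" "?\<Theta> w = \<zero>\<^bsub>TC.T\<^esub>" using w(1) by auto
  have gens: "(\<lambda>i. f (?e s i) \<odot>\<^bsub>N\<^esub> x s) \<in> carrier (fun_module N)" for s using E.extend_closed[OF e xc] .
  \<comment> \<open>The image of \<open>t\<close> in \<open>C \<otimes> N\<close> is determined by
    \<open>u' x\<close>, which agrees with \<open>w\<close> in the first \<open>n\<close>
    coordinates; as \<open>w\<close> comes from \<open>K\<close>, this image is zero.\<close>
  have "?h t = finsum TC.T (\<lambda>s. ?h (TB.tn (q (?e s)) (x s))) {..<a}"
    unfolding t_def TB.tens_sum_def
    by (rule finsum_hom[OF TB.module_tensor TC.module_tensor hT]) (use qD(1)[OF e] xc in simp)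
  also have "\<dots> = finsum TC.T (\<lambda>s. ?\<Theta> (u' (\<lambda>i. f (?e s i) \<odot>\<^bsub>N\<^esub> x s))) {..<a}"
    unfolding tensor_map_tens[OF TB.tensor_modules_axioms TC.tensor_modules_axioms h_hom] h_def rq[OF e]
      comp[OF e xc] \<Theta>_ext[OF uD(1)[OF e] xc] ..
  also have "\<dots> = ?\<Theta> (finsum (fun_module N) (\<lambda>s. u' (\<lambda>i. f (?e s i) \<odot>\<^bsub>N\<^esub> x s)) {..<a})"
    by (rule finsum_hom[OF E.FN.module_self TC.module_tensor \<Theta>_hom, symmetric]) (rule module_homsD(1)[OF u' gens])
  also have "\<dots> = ?\<Theta> (u' (finsum (fun_module N) (\<lambda>s i. f (?e s i) \<odot>\<^bsub>N\<^esub> x s) {..<a}))"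
    by (subst finsum_hom[OF E.FN.module_self E.FN.module_self u' gens]) (rule refl)
  also have "\<dots> = ?\<Theta> (u' x)" unfolding x_sum ..
  also have "\<dots> = ?\<Theta> w" using w0(1) ce w(2) by (intro TC.tens_sum_cong) auto
  finally have "t \<in> a_kernel TB.T TC.T ?h" using tB w0(2) by (simp add: a_kernel_def')
  then obtain t' where t': "t' \<in> carrier TA.T" "t = ?g t'"
    unfolding exact[symmetric] by (rule imageE)
  \<comment> \<open>This map from \<open>B \<otimes> N\<close> to the vectors over \<open>N\<close>
    recovers \<open>x\<close> from \<open>t\<close>.\<close>
  have "\<exists>p\<in>module_homs S TB.T (fun_module N). \<forall>Y\<in>carrier B. \<forall>z\<in>carrier N. p (TB.tn Y z) = (\<lambda>i. f (r Y i) \<odot>\<^bsub>N\<^esub> z)"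
  proof (rule TB.tensor_universal[OF E.FN.module_self])
    have rc: "r Y i \<in> carrier R" if Y: "Y \<in> carrier B" for Y i
      using B_carrier[OF Y] rq by fastforce
    show "(\<lambda>i. f (r Y i) \<odot>\<^bsub>N\<^esub> z) \<in> carrier (fun_module N)" if "Y \<in> carrier B" "z \<in> carrier N" for Y z
      using rc[OF that(1)] that(2) by simp
    show "(\<lambda>i. f (r Y i) \<odot>\<^bsub>N\<^esub> (z \<oplus>\<^bsub>N\<^esub> z')) = (\<lambda>i. f (r Y i) \<odot>\<^bsub>N\<^esub> z) \<oplus>\<^bsub>fun_module N\<^esub> (\<lambda>i. f (r Y i) \<odot>\<^bsub>N\<^esub> z')"
      if "Y \<in> carrier B" "z \<in> carrier N" "z' \<in> carrier N" for Y z z'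
      using rc[OF that(1)] that(2,3) by (simp add: E.N.smult_r_distr)
    show "(\<lambda>i. f (r Y i) \<odot>\<^bsub>N\<^esub> (s \<odot>\<^bsub>N\<^esub> z)) = s \<odot>\<^bsub>fun_module N\<^esub> (\<lambda>i. f (r Y i) \<odot>\<^bsub>N\<^esub> z)"
      if "s \<in> carrier S" "Y \<in> carrier B" "z \<in> carrier N" for s Y z
      using rc[OF that(2)] that(1,3) by (simp add: E.N.smult_commute)
    show "(\<lambda>i. f (r (b \<odot>\<^bsub>B\<^esub> Y) i) \<odot>\<^bsub>N\<^esub> z) = (\<lambda>i. f (r Y i) \<odot>\<^bsub>N\<^esub> (f b \<odot>\<^bsub>N\<^esub> z))"
      if b: "b \<in> carrier R" and Y: "Y \<in> carrier B" and z: "z \<in> carrier N" for b Y z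
    proof -
      obtain v where v: "v \<in> carrier ?V" "Y = q v" using B_carrier[OF Y] by blast
      have "r (b \<odot>\<^bsub>B\<^esub> Y) = b \<odot>\<^bsub>?V\<^esub> v"
        unfolding v(2) qD(3)[OF b v(1), symmetric] by (rule rq[OF E.FR.smult_closed[OF b v(1)]])
      then show ?thesis
        using v rq[OF v(1)] b z E.M.R.ring_module_simps
        by (simp add: E.hom_simps E.N.smult_assoc1[symmetric] E.N.R.m_comm)
    qed
    show "(\<lambda>i. f (r (Y \<oplus>\<^bsub>B\<^esub> Y') i) \<odot>\<^bsub>N\<^esub> z) = (\<lambda>i. f (r Y i) \<odot>\<^bsub>N\<^esub> z) \<oplus>\<^bsub>fun_module N\<^esub> (\<lambda>i. f (r Y' i) \<odot>\<^bsub>N\<^esub> z)"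
      if Y: "Y \<in> carrier B" and Y': "Y' \<in> carrier B" and z: "z \<in> carrier N" for Y Y' z
    proof -
      obtain v where v: "v \<in> carrier ?V" "Y = q v" using B_carrier[OF Y] by blast
      obtain v' where v': "v' \<in> carrier ?V" "Y' = q v'" using B_carrier[OF Y'] by blast
      have "r (Y \<oplus>\<^bsub>B\<^esub> Y') = v \<oplus>\<^bsub>?V\<^esub> v'"
        unfolding v(2) v'(2) qD(2)[OF v(1) v'(1), symmetric] by (rule rq[OF E.FR.M.a_closed[OF v(1) v'(1)]])
      then show ?thesis
        using v v' rq[OF v(1)] rq[OF v'(1)] z E.M.R.ring_module_simps
        by (simp add: E.hom_simps E.N.smult_l_distr)
    qed
  qed
  then obtain p where p: "p \<in> module_homs S TB.T (fun_module N)"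
    "\<And>Y z. Y \<in> carrier B \<Longrightarrow> z \<in> carrier N \<Longrightarrow> p (TB.tn Y z) = (\<lambda>i. f (r Y i) \<odot>\<^bsub>N\<^esub> z)" by blast
  have "p t = finsum (fun_module N) (\<lambda>s. p (TB.tn (q (?e s)) (x s))) {..<a}"
    unfolding t_def TB.tens_sum_def
    by (rule finsum_hom[OF TB.module_tensor E.FN.module_self p(1)]) (use qD(1)[OF e] xc in simp)
  also have "\<dots> = finsum (fun_module N) (\<lambda>s i. f (?e s i) \<odot>\<^bsub>N\<^esub> x s) {..<a}"
    unfolding p(2)[OF qD(1)[OF e] xc] rq[OF e] ..
  also have "\<dots> = x" by (rule x_sum)
  finally have pt: "p t = x" .
  let ?X = "extend_vectors S f N ?W"
  have Wsub: "?W \<subseteq> carrier ?V" by blast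
  have X: "submodule ?X S (fun_module N)" by (rule E.extend_vectors_submodule[OF Wsub])
  \<comment> \<open>It remains to see that \<open>p\<close> sends whatever comes from
    \<open>A \<otimes> N\<close> into the extension of \<open>?W\<close>, which can be tested on
    pure tensors.\<close>
  have "t' \<in> {t' \<in> carrier TA.T. ?g t' \<in> {t \<in> carrier TB.T. p t \<in> ?X}}"
  proof (rule TA.submodule_tensor_eq[OF _ _ t'(1)])
    show "submodule {t' \<in> carrier TA.T. ?g t' \<in> {t \<in> carrier TB.T. p t \<in> ?X}} S TA.T"
      by (rule submodule_preimage_hom[OF TA.module_tensor TB.module_tensor gT
            submodule_preimage_hom[OF TB.module_tensor E.FN.module_self p(1) X]])
    fix Y z assume Y: "Y \<in> carrier A" and z: "z \<in> carrier N"
    have YB: "Y \<in> carrier B" "h Y = \<zero>\<^bsub>C\<^esub>" using Y A_carrier by auto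
    obtain v where v: "v \<in> carrier ?V" "Y = q v" using B_carrier[OF YB(1)] by blast
    have "u v \<in> K" using YB(2) c_zero[OF uD(1)[OF v(1)]] rq[OF v(1)] v(2) by (simp add: h_def)
    then have "(\<lambda>i. f (v i) \<odot>\<^bsub>N\<^esub> z) \<in> ?X" using v(1) z by (intro E.extend_vectors_mem) simp
    moreover have "?g (TA.tn Y z) = TB.tn Y z"
      by (rule tensor_map_tens[OF TA.tensor_modules_axioms TB.tensor_modules_axioms g_hom])
    ultimately show "TA.tn Y z \<in> {t' \<in> carrier TA.T. ?g t' \<in> {t \<in> carrier TB.T. p t \<in> ?X}}"
      using Y YB z p(2)[OF YB(1) z] rq[OF v(1)] v(2) by simp
  qed
  then show ?thesis using t'(2) pt by simp
qed

text \<open>The image of \<open>U \<otimes> N\<close> in \<open>M \<otimes> N\<close>. By right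
  exactness the quotient by it is \<open>(M / U) \<otimes> N\<close>, for which it stands
  in.\<close>

definition tensor_sub ::
    "('a, 'r) ring_scheme \<Rightarrow> ('a \<Rightarrow> 'b) \<Rightarrow> ('a, 'm, 'k) module_scheme \<Rightarrow> ('b, 's) ring_scheme
      \<Rightarrow> ('b, 'n, 'j) module_scheme \<Rightarrow> 'm set \<Rightarrow> ('m \<times> 'n \<Rightarrow>\<^sub>0 int) set set" where
  "tensor_sub R f M S N U = submodule_span S (tensor R f M N) {tens R f M N x z | x z. x \<in> U \<and> z \<in> carrier N}"

context tensor_modules
begin

abbreviation tsub :: "'m set \<Rightarrow> ('m \<times> 'n \<Rightarrow>\<^sub>0 int) set set" where
  "tsub U \<equiv> tensor_sub R f M S N U"

lemma tsub_submodule: "U \<subseteq> carrier M \<Longrightarrow> submodule (tsub U) S T"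
  unfolding tensor_sub_def by (rule T.submodule_span_submodule) (use tn_closed in blast)

lemma tsub_mem: "x \<in> U \<Longrightarrow> z \<in> carrier N \<Longrightarrow> tn x z \<in> tsub U"
  unfolding tensor_sub_def by (rule subsetD[OF T.submodule_span_superset]) blast

lemma tsub_minimal:
  assumes "submodule W S T" "\<And>x z. x \<in> U \<Longrightarrow> z \<in> carrier N \<Longrightarrow> tn x z \<in> W"
  shows "tsub U \<subseteq> W"
  unfolding tensor_sub_def using assms by (intro T.submodule_span_minimal) auto

lemma submodule_tn_preimage:
  assumes W: "submodule W S T"
  shows "submodule {x \<in> carrier M. \<forall>z\<in>carrier N. tn x z \<in> W} R M"
proof (rule M.submoduleI)
  fix x assume x: "x \<in> {x \<in> carrier M. \<forall>z\<in>carrier N. tn x z \<in> W}"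
  { fix a assume a: "a \<in> carrier R"
    show "a \<odot>\<^bsub>M\<^esub> x \<in> {x \<in> carrier M. \<forall>z\<in>carrier N. tn x z \<in> W}"
      using a x by (auto simp: tn_balanced) }
  note smult = this
  have "\<ominus>\<^bsub>M\<^esub> x = (\<ominus>\<^bsub>R\<^esub> \<one>\<^bsub>R\<^esub>) \<odot>\<^bsub>M\<^esub> x" using x by (simp add: M.smult_l_minus)
  then show "\<ominus>\<^bsub>M\<^esub> x \<in> {x \<in> carrier M. \<forall>z\<in>carrier N. tn x z \<in> W}" using smult[of "\<ominus>\<^bsub>R\<^esub> \<one>\<^bsub>R\<^esub>"] by simp
qed (use T.sub_zero[OF W] T.sub_add[OF W] in \<open>auto simp: tn_add_left\<close>)

lemma submodule_tn_preimage_right: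
  assumes W: "submodule W S T" and x: "x \<in> carrier M"
  shows "submodule {z \<in> carrier N. tn x z \<in> W} S N"
proof (rule N.submoduleI)
  fix z assume z: "z \<in> {z \<in> carrier N. tn x z \<in> W}"
  { fix a assume a: "a \<in> carrier S"
    show "a \<odot>\<^bsub>N\<^esub> z \<in> {z \<in> carrier N. tn x z \<in> W}"
      using a z T.sub_smult[OF W a, of "tn x z"] by (simp add: tn_smult) }
  note smult = this
  have "\<ominus>\<^bsub>N\<^esub> z = (\<ominus>\<^bsub>S\<^esub> \<one>\<^bsub>S\<^esub>) \<odot>\<^bsub>N\<^esub> z" using z by (simp add: N.smult_l_minus)
  then show "\<ominus>\<^bsub>N\<^esub> z \<in> {z \<in> carrier N. tn x z \<in> W}" using smult[of "\<ominus>\<^bsub>S\<^esub> \<one>\<^bsub>S\<^esub>"] by simp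
qed (use x T.sub_zero[OF W] T.sub_add[OF W] in \<open>auto simp: tn_add_right\<close>)

lemma fin_gen_tensor:
  assumes "fin_gen_module R M" "fin_gen_module S N" shows "fin_gen_module S T"
proof -
  obtain Gm where Gm: "finite Gm" "Gm \<subseteq> carrier M" "submodule_span R M Gm = carrier M"
    using assms(1) by (auto simp: fin_gen_module_def)
  obtain Gn where Gn: "finite Gn" "Gn \<subseteq> carrier N" "submodule_span S N Gn = carrier N"
    using assms(2) by (auto simp: fin_gen_module_def)
  define G where "G = (\<lambda>(x, y). tn x y) ` (Gm \<times> Gn)"
  have G: "finite G" "G \<subseteq> carrier T" using Gm Gn by (auto simp: G_def intro!: tn_closed)
  let ?W = "submodule_span S T G"
  have W: "submodule ?W S T" by (rule T.submodule_span_submodule[OF G(2)])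
  have 1: "tn x z \<in> ?W" if x: "x \<in> Gm" and z: "z \<in> carrier N" for x z
  proof -
    have xc: "x \<in> carrier M" using x Gm(2) by blast
    have "tn x y \<in> ?W" if "y \<in> Gn" for y
      using T.submodule_span_superset[of G] x that by (auto simp: G_def)
    then have "Gn \<subseteq> {z \<in> carrier N. tn x z \<in> ?W}" using Gn(2) by blast
    then have "submodule_span S N Gn \<subseteq> {z \<in> carrier N. tn x z \<in> ?W}"
      by (rule N.submodule_span_minimal[OF submodule_tn_preimage_right[OF W xc]])
    then show ?thesis using z Gn(3) by blast
  qed
  then have "Gm \<subseteq> {x \<in> carrier M. \<forall>z\<in>carrier N. tn x z \<in> ?W}" using Gm(2) by blast
  then have "submodule_span R M Gm \<subseteq> {x \<in> carrier M. \<forall>z\<in>carrier N. tn x z \<in> ?W}"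
    by (rule M.submodule_span_minimal[OF submodule_tn_preimage[OF W]])
  then have "carrier T \<subseteq> ?W" using submodule_tensor_eq[OF W] Gm(3) by blast
  then have "?W = carrier T" using T.submodule_carrier[OF W] by blast
  then show ?thesis using G T.module_self by (auto simp: fin_gen_module_def)
qed

lemma tsub_zero: "tsub {\<zero>\<^bsub>M\<^esub>} = {\<zero>\<^bsub>T\<^esub>}"
proof
  show "tsub {\<zero>\<^bsub>M\<^esub>} \<subseteq> {\<zero>\<^bsub>T\<^esub>}" by (rule tsub_minimal[OF T.submodule_zero]) auto
  show "{\<zero>\<^bsub>T\<^esub>} \<subseteq> tsub {\<zero>\<^bsub>M\<^esub>}" using T.sub_zero[OF tsub_submodule[of "{\<zero>\<^bsub>M\<^esub>}"]] by simp
qed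

lemma smult_mem_tsub:
  assumes U: "submodule U R M" and a: "a \<in> carrier R" "\<And>x. x \<in> carrier M \<Longrightarrow> a \<odot>\<^bsub>M\<^esub> x \<in> U" and t: "t \<in> carrier T"
  shows "f a \<odot>\<^bsub>T\<^esub> t \<in> tsub U"
proof -
  have W: "submodule {t \<in> carrier T. f a \<odot>\<^bsub>T\<^esub> t \<in> tsub U} S T"
    by (rule T.submodule_preimage_mult[OF tsub_submodule[OF M.submodule_carrier[OF U]] f_closed[OF a(1)]])
  have "t \<in> {t \<in> carrier T. f a \<odot>\<^bsub>T\<^esub> t \<in> tsub U}"
  proof (rule submodule_tensor_eq[OF W _ t])
    fix x z assume xz: "x \<in> carrier M" "z \<in> carrier N"
    have "f a \<odot>\<^bsub>T\<^esub> tn x z = tn (a \<odot>\<^bsub>M\<^esub> x) z" using a(1) xz by (simp add: tn_smult tn_balanced)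
    then show "tn x z \<in> {t \<in> carrier T. f a \<odot>\<^bsub>T\<^esub> t \<in> tsub U}" using tsub_mem[OF a(2)[OF xz(1)] xz(2)] xz by simp
  qed
  then show ?thesis by simp
qed

lemma tsub_set_smult:
  assumes J: "J \<subseteq> carrier R"
  shows "tsub (set_smult R J M) = set_smult S (f ` J) T"
proof
  have fJ: "f ` J \<subseteq> carrier S" using J by auto
  let ?W = "set_smult S (f ` J) T"
  have W: "submodule ?W S T" by (rule T.set_smult_submodule[OF fJ])
  have "set_smult R J M \<subseteq> {x \<in> carrier M. \<forall>z\<in>carrier N. tn x z \<in> ?W}"
  proof (rule M.set_smult_minimal[OF submodule_tn_preimage[OF W]])
    fix a x assume ax: "a \<in> J" "x \<in> carrier M"
    have ac: "a \<in> carrier R" using ax J by blast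
    have "tn (a \<odot>\<^bsub>M\<^esub> x) z \<in> ?W" if z: "z \<in> carrier N" for z
    proof -
      have "tn (a \<odot>\<^bsub>M\<^esub> x) z = f a \<odot>\<^bsub>T\<^esub> tn x z" using ac ax z by (simp add: tn_smult tn_balanced)
      then show ?thesis using T.set_smult_mem[of "f a" "f ` J" "tn x z"] ax z by simp
    qed
    then show "a \<odot>\<^bsub>M\<^esub> x \<in> {x \<in> carrier M. \<forall>z\<in>carrier N. tn x z \<in> ?W}" using ac ax by simp
  qed
  then show "tsub (set_smult R J M) \<subseteq> ?W" by (intro tsub_minimal[OF W]) blast
  note U = M.set_smult_submodule[OF J]
  show "?W \<subseteq> tsub (set_smult R J M)"
  proof (rule T.set_smult_minimal[OF tsub_submodule[OF M.submodule_carrier[OF U]]])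
    fix b t assume "b \<in> f ` J" and t: "t \<in> carrier T"
    then obtain a where a: "a \<in> J" "b = f a" by auto
    then show "b \<odot>\<^bsub>T\<^esub> t \<in> tsub (set_smult R J M)"
      using smult_mem_tsub[OF U _ _ t, of a] M.set_smult_mem[OF a(1)] J by auto
  qed
qed

lemma tsub_carrier: "tsub (carrier M) = carrier T"
  using submodule_tensor_eq[OF tsub_submodule[OF order_refl] tsub_mem]
    T.submodule_carrier[OF tsub_submodule[OF order_refl]] by blast

lemma lin_comb_unit_vector:
  assumes y: "\<And>i. i < n \<Longrightarrow> y i \<in> carrier M" and i: "i < n"
  shows "lin_comb y n (unit_vector R i) = y i"
proof -
  have "lin_comb y n (unit_vector R i) = finsum M (\<lambda>j. if i = j then y j else \<zero>\<^bsub>M\<^esub>) {..<n}"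
    unfolding lin_comb_def using y by (intro M.M.finsum_cong') (auto simp: unit_vector_def)
  also have "\<dots> = finsum M (\<lambda>j. if i = j then (if j < n then y j else \<zero>\<^bsub>M\<^esub>) else \<zero>\<^bsub>M\<^esub>) {..<n}"
    using y by (intro M.M.finsum_cong') auto
  also have "\<dots> = y i" using M.finsum_single[of "\<lambda>j. if j < n then y j else \<zero>\<^bsub>M\<^esub>" i n] y i by simp
  finally show ?thesis .
qed

lemma fin_gen_lin_comb:
  assumes "fin_gen_module R M"
  shows "\<exists>y n. (\<forall>i<n. y i \<in> carrier M) \<and> lin_comb y n ` carrier (vectors R) = carrier M"
proof -
  obtain Y where Y: "finite Y" "Y \<subseteq> carrier M" "submodule_span R M Y = carrier M"
    using assms by (auto simp: fin_gen_module_def)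
  obtain ys where ys: "set ys = Y" using finite_list[OF Y(1)] by blast
  let ?y = "\<lambda>i. ys ! i" and ?n = "length ys"
  have y: "?y i \<in> carrier M" if "i < ?n" for i using that ys Y(2) by auto
  note hom = lin_comb_homs[of ?n ?y, OF y]
  have I: "submodule (lin_comb ?y ?n ` carrier (vectors R)) R M"
    by (rule submodule_image_hom[OF FR.module_self M.module_self hom])
  have "Y \<subseteq> lin_comb ?y ?n ` carrier (vectors R)"
  proof
    fix x assume "x \<in> Y"
    then obtain i where i: "i < ?n" "x = ?y i" using ys by (metis in_set_conv_nth)
    then have "x = lin_comb ?y ?n (unit_vector R i)" using lin_comb_unit_vector[of ?n ?y i, OF y] by simp
    then show "x \<in> lin_comb ?y ?n ` carrier (vectors R)" using unit_vector_closed(1) by blast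
  qed
  from M.submodule_span_minimal[OF I this] have "lin_comb ?y ?n ` carrier (vectors R) = carrier M"
    using M.submodule_carrier[OF I] Y(3) by blast
  then show ?thesis using y by blast
qed

text \<open>This identifies \<open>T\<close> with \<open>N\<^sup>n\<close> modulo the extension of the relations among the generators \<open>y\<close>.\<close>

lemma tens_sum_mem_tsub:
  assumes y: "\<And>i. i < n \<Longrightarrow> y i \<in> carrier M" and surj: "lin_comb y n ` carrier (vectors R) = carrier M"
    and U: "submodule U R M" and w: "w \<in> carrier (fun_module N)" and mem: "tens_sum y n w \<in> tsub U"
  shows "\<exists>w'\<in>extend_vectors S f N {v \<in> carrier (vectors R). lin_comb y n v \<in> U}. \<forall>i<n. w i = w' i"
proof -
  let ?V = "vectors R" let ?\<phi> = "lin_comb y n" let ?e = "unit_vector R"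
  let ?K = "{v \<in> carrier ?V. ?\<phi> v \<in> U}" let ?X = "extend_vectors S f N ?K"
  have \<phi>: "?\<phi> \<in> module_homs R ?V M" by (rule lin_comb_homs[OF y])
  note \<phi>D = module_homsD[OF \<phi>]
  have Kc: "?K \<subseteq> carrier ?V" by blast
  have K: "submodule ?K R ?V" by (rule submodule_preimage_hom[OF FR.module_self M.module_self \<phi> U])
  have X: "submodule ?X S (fun_module N)" by (rule extend_vectors_submodule[OF Kc])
  \<comment> \<open>The extension of the relations, up to the coordinates from \<open>n\<close> on,
    which \<open>tens_sum\<close> does not see.\<close>
  define E where "E = {w \<in> carrier (fun_module N). \<exists>w'\<in>?X. \<forall>i<n. w i = w' i}"
  have XE: "w \<in> E" if "w \<in> ?X" for w using that FN.sub_carr[OF X that] unfolding E_def by blast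
  have E: "submodule E S (fun_module N)"
  proof (rule FN.submoduleI)
    show "\<zero>\<^bsub>fun_module N\<^esub> \<in> E" by (rule XE[OF FN.sub_zero[OF X]])
    fix v assume "v \<in> E"
    then obtain v' where v: "v \<in> carrier (fun_module N)" "v' \<in> ?X" "\<forall>i<n. v i = v' i" by (auto simp: E_def)
    note v'c = FN.sub_carr[OF X v(2)]
    have "\<ominus>\<^bsub>fun_module N\<^esub> v' \<in> ?X" by (rule FN.sub_minus[OF X v(2)])
    moreover have "\<forall>i<n. (\<ominus>\<^bsub>fun_module N\<^esub> v) i = (\<ominus>\<^bsub>fun_module N\<^esub> v') i"
      unfolding N.fun_module_minus[OF v(1)] N.fun_module_minus[OF v'c] using v(3) by simp
    ultimately show "\<ominus>\<^bsub>fun_module N\<^esub> v \<in> E" using FN.M.a_inv_closed[OF v(1)] unfolding E_def by blast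
    { fix w assume "w \<in> E"
      then obtain w' where w: "w \<in> carrier (fun_module N)" "w' \<in> ?X" "\<forall>i<n. w i = w' i" by (auto simp: E_def)
      have "v' \<oplus>\<^bsub>fun_module N\<^esub> w' \<in> ?X" by (rule FN.sub_add[OF X v(2) w(2)])
      moreover have "\<forall>i<n. (v \<oplus>\<^bsub>fun_module N\<^esub> w) i = (v' \<oplus>\<^bsub>fun_module N\<^esub> w') i" using v(3) w(3) by simp
      ultimately show "v \<oplus>\<^bsub>fun_module N\<^esub> w \<in> E" using FN.M.a_closed[OF v(1) w(1)] unfolding E_def by blast }
    fix a assume a: "a \<in> carrier S"
    have "a \<odot>\<^bsub>fun_module N\<^esub> v' \<in> ?X" by (rule FN.sub_smult[OF X a v(2)])
    moreover have "\<forall>i<n. (a \<odot>\<^bsub>fun_module N\<^esub> v) i = (a \<odot>\<^bsub>fun_module N\<^esub> v') i" using v(3) by simp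
    ultimately show "a \<odot>\<^bsub>fun_module N\<^esub> v \<in> E" using FN.smult_closed[OF a v(1)] unfolding E_def by blast
  qed (unfold E_def, blast)
  define G where "G = quot_module (fun_module N) E"
  have modG: "module S G" unfolding G_def by (rule FN.module_quot[OF E])
  define c where "c w = E +>\<^bsub>fun_module N\<^esub> w" for w
  have c_hom: "c \<in> module_homs S (fun_module N) G" unfolding c_def G_def by (rule FN.coset_homs[OF E])
  note cD = module_homsD[OF c_hom]
  have c_zero: "c w = \<zero>\<^bsub>G\<^esub> \<longleftrightarrow> w \<in> E" if "w \<in> carrier (fun_module N)" for w
    using FN.coset_eq_zero_iff[OF E that] by (simp add: c_def G_def FN.quot_zero)
  define x where "x v z = (\<lambda>i :: nat. f (v i) \<odot>\<^bsub>N\<^esub> z)" for v z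
  have xc: "x v z \<in> carrier (fun_module N)" if "v \<in> carrier ?V" "z \<in> carrier N" for v z
    unfolding x_def by (rule extend_closed[OF that])
  \<comment> \<open>Two preimages of the same element of \<open>M\<close> differ by a relation, so
    the class of the extended vector depends only on that element.\<close>
  have c_eq: "c (x v z) = c (x v' z)"
    if v: "v \<in> carrier ?V" and v': "v' \<in> carrier ?V" and eq: "?\<phi> v = ?\<phi> v'" and z: "z \<in> carrier N" for v v' z
  proof -
    have neg: "(\<ominus>\<^bsub>R\<^esub> \<one>\<^bsub>R\<^esub>) \<odot>\<^bsub>?V\<^esub> v' \<in> carrier ?V" using v' by (intro FR.smult_closed) auto
    let ?d = "v \<oplus>\<^bsub>?V\<^esub> ((\<ominus>\<^bsub>R\<^esub> \<one>\<^bsub>R\<^esub>) \<odot>\<^bsub>?V\<^esub> v')"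
    have vi: "v i \<in> carrier R" "v' i \<in> carrier R" for i using v v' by auto
    have "?\<phi> ?d = ?\<phi> v \<oplus>\<^bsub>M\<^esub> (\<ominus>\<^bsub>R\<^esub> \<one>\<^bsub>R\<^esub>) \<odot>\<^bsub>M\<^esub> ?\<phi> v'"
      using \<phi>D(2)[OF v neg] \<phi>D(3)[OF _ v', of "\<ominus>\<^bsub>R\<^esub> \<one>\<^bsub>R\<^esub>"] by simp
    also have "\<dots> = \<zero>\<^bsub>M\<^esub>" using \<phi>D(1)[OF v'] eq by (simp add: M.smult_l_minus M.M.r_neg)
    finally have "?d \<in> ?K" using M.sub_zero[OF U] FR.M.a_closed[OF v neg] by auto
    then have "x ?d z \<in> E" unfolding x_def by (rule XE[OF extend_vectors_mem[OF _ z]])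
    moreover have "x ?d z = x v z \<oplus>\<^bsub>fun_module N\<^esub> (\<ominus>\<^bsub>fun_module N\<^esub> x v' z)"
      unfolding N.fun_module_minus[OF xc[OF v' z]] using vi z
      by (simp add: x_def hom_simps N.smult_l_distr N.smult_l_minus M.R.l_minus)
    ultimately show ?thesis
      unfolding c_def using FN.coset_eq_iff[OF E xc[OF v z] xc[OF v' z]] by (simp add: a_minus_def)
  qed
  \<comment> \<open>A set-theoretic section of \<open>lin_comb\<close>. It is not linear in general,
    but by \<open>c_eq\<close> the induced map into \<open>G\<close> is.\<close>
  define \<rho> where "\<rho> m = (SOME v. v \<in> carrier ?V \<and> ?\<phi> v = m)" for m
  have \<rho>: "\<rho> m \<in> carrier ?V" "?\<phi> (\<rho> m) = m" if m: "m \<in> carrier M" for m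
  proof -
    obtain v where "v \<in> carrier ?V \<and> ?\<phi> v = m" using m surj by (metis imageE)
    then have "\<rho> m \<in> carrier ?V \<and> ?\<phi> (\<rho> m) = m" unfolding \<rho>_def
      by (rule someI[of "\<lambda>v. v \<in> carrier ?V \<and> ?\<phi> v = m"])
    then show "\<rho> m \<in> carrier ?V" "?\<phi> (\<rho> m) = m" by blast+
  qed
  have "\<exists>h\<in>module_homs S T G. \<forall>m\<in>carrier M. \<forall>z\<in>carrier N. h (tn m z) = c (x (\<rho> m) z)"
  proof (rule tensor_universal[OF modG])
    show "c (x (\<rho> m) z) \<in> carrier G" if "m \<in> carrier M" "z \<in> carrier N" for m z
      by (rule cD(1)[OF xc[OF \<rho>(1)[OF that(1)] that(2)]])
    show "c (x (\<rho> m) (z \<oplus>\<^bsub>N\<^esub> z')) = c (x (\<rho> m) z) \<oplus>\<^bsub>G\<^esub> c (x (\<rho> m) z')"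
      if m: "m \<in> carrier M" and z: "z \<in> carrier N" "z' \<in> carrier N" for m z z'
    proof -
      have "x (\<rho> m) (z \<oplus>\<^bsub>N\<^esub> z') = x (\<rho> m) z \<oplus>\<^bsub>fun_module N\<^esub> x (\<rho> m) z'"
        using \<rho>(1)[OF m] z by (simp add: x_def N.smult_r_distr)
      then show ?thesis using cD(2)[OF xc[OF \<rho>(1)[OF m] z(1)] xc[OF \<rho>(1)[OF m] z(2)]] by simp
    qed
    show "c (x (\<rho> m) (s \<odot>\<^bsub>N\<^esub> z)) = s \<odot>\<^bsub>G\<^esub> c (x (\<rho> m) z)"
      if s: "s \<in> carrier S" and m: "m \<in> carrier M" and z: "z \<in> carrier N" for s m z
    proof -
      have "x (\<rho> m) (s \<odot>\<^bsub>N\<^esub> z) = s \<odot>\<^bsub>fun_module N\<^esub> x (\<rho> m) z"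
        using \<rho>(1)[OF m] z s by (simp add: x_def N.smult_commute)
      then show ?thesis using cD(3)[OF s xc[OF \<rho>(1)[OF m] z]] by simp
    qed
    show "c (x (\<rho> (m \<oplus>\<^bsub>M\<^esub> m')) z) = c (x (\<rho> m) z) \<oplus>\<^bsub>G\<^esub> c (x (\<rho> m') z)"
      if m: "m \<in> carrier M" "m' \<in> carrier M" and z: "z \<in> carrier N" for m m' z
    proof -
      have sum: "\<rho> m \<oplus>\<^bsub>?V\<^esub> \<rho> m' \<in> carrier ?V" using \<rho>(1)[OF m(1)] \<rho>(1)[OF m(2)] by (rule FR.M.a_closed)
      have mm: "m \<oplus>\<^bsub>M\<^esub> m' \<in> carrier M" using m by simp
      have "c (x (\<rho> (m \<oplus>\<^bsub>M\<^esub> m')) z) = c (x (\<rho> m \<oplus>\<^bsub>?V\<^esub> \<rho> m') z)"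
        by (rule c_eq[OF \<rho>(1)[OF mm] sum _ z])
          (simp only: \<phi>D(2)[OF \<rho>(1)[OF m(1)] \<rho>(1)[OF m(2)]] \<rho>(2)[OF m(1)] \<rho>(2)[OF m(2)] \<rho>(2)[OF mm])
      also have "x (\<rho> m \<oplus>\<^bsub>?V\<^esub> \<rho> m') z = x (\<rho> m) z \<oplus>\<^bsub>fun_module N\<^esub> x (\<rho> m') z"
        using \<rho>(1)[OF m(1)] \<rho>(1)[OF m(2)] z by (simp add: x_def hom_simps N.smult_l_distr)
      finally show ?thesis using cD(2)[OF xc[OF \<rho>(1)[OF m(1)] z] xc[OF \<rho>(1)[OF m(2)] z]] by simp
    qed
    show "c (x (\<rho> (a \<odot>\<^bsub>M\<^esub> m)) z) = c (x (\<rho> m) (f a \<odot>\<^bsub>N\<^esub> z))"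
      if a: "a \<in> carrier R" and m: "m \<in> carrier M" and z: "z \<in> carrier N" for a m z
    proof -
      have am: "a \<odot>\<^bsub>M\<^esub> m \<in> carrier M" "a \<odot>\<^bsub>?V\<^esub> \<rho> m \<in> carrier ?V"
        using a m \<rho>(1)[OF m] FR.smult_closed by auto
      have "c (x (\<rho> (a \<odot>\<^bsub>M\<^esub> m)) z) = c (x (a \<odot>\<^bsub>?V\<^esub> \<rho> m) z)"
        by (rule c_eq[OF \<rho>(1)[OF am(1)] am(2) _ z]) (simp only: \<phi>D(3)[OF a \<rho>(1)[OF m]] \<rho>(2)[OF m] \<rho>(2)[OF am(1)])
      also have "x (a \<odot>\<^bsub>?V\<^esub> \<rho> m) z = x (\<rho> m) (f a \<odot>\<^bsub>N\<^esub> z)"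
        using a \<rho>(1)[OF m] z by (simp add: x_def hom_simps N.smult_assoc1 N.smult_commute)
      finally show ?thesis .
    qed
  qed
  then obtain h where h: "h \<in> module_homs S T G"
    "\<And>m z. m \<in> carrier M \<Longrightarrow> z \<in> carrier N \<Longrightarrow> h (tn m z) = c (x (\<rho> m) z)" by blast
  have "tsub U \<subseteq> {t \<in> carrier T. h t = \<zero>\<^bsub>G\<^esub>}"
  proof (rule tsub_minimal[OF submodule_kernel_hom[OF T.module_self modG h(1)]])
    fix m z assume m: "m \<in> U" and z: "z \<in> carrier N"
    have mc: "m \<in> carrier M" by (rule M.sub_carr[OF U m])
    have "\<rho> m \<in> ?K" using \<rho>[OF mc] m by simp
    then have "x (\<rho> m) z \<in> E" unfolding x_def by (rule XE[OF extend_vectors_mem[OF _ z]])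
    then have "h (tn m z) = \<zero>\<^bsub>G\<^esub>" using h(2)[OF mc z] c_zero[OF xc[OF \<rho>(1)[OF mc] z]] by simp
    then show "tn m z \<in> {t \<in> carrier T. h t = \<zero>\<^bsub>G\<^esub>}" using tn_closed[OF mc z] by simp
  qed
  then have "h (tens_sum y n w) = \<zero>\<^bsub>G\<^esub>" using mem by blast
  have wc: "w i \<in> carrier N" for i using w by simp
  \<comment> \<open>Cutting off the coordinates from \<open>n\<close> on makes the vector a finite
    sum of extended unit vectors.\<close>
  let ?w = "\<lambda>j. if j < n then w j else \<zero>\<^bsub>N\<^esub>"
  have w'c: "?w \<in> carrier (fun_module N)" using wc by simp
  note ec = unit_vector_closed(1)
  have "h (tens_sum y n w) = finsum G (\<lambda>i. h (tn (y i) (w i))) {..<n}"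
    unfolding tens_sum_def by (rule finsum_hom[OF T.module_self modG h(1)]) (use y wc in simp)
  also have "\<dots> = finsum G (\<lambda>i. c (x (?e i) (w i))) {..<n}"
  proof (rule abelian_monoid.finsum_cong')
    show "abelian_monoid G" using modG by (simp add: module_def abelian_group_def)
    show "(\<lambda>i. c (x (?e i) (w i))) \<in> {..<n} \<rightarrow> carrier G" using cD(1)[OF xc[OF ec wc]] by blast
    fix i assume "i \<in> {..<n}"
    then have i: "i < n" by simp
    have "c (x (\<rho> (y i)) (w i)) = c (x (?e i) (w i))"
      by (rule c_eq[OF \<rho>(1)[OF y[OF i]] ec _ wc]) (simp only: \<rho>(2)[OF y[OF i]] lin_comb_unit_vector[OF y i])
    then show "h (tn (y i) (w i)) = c (x (?e i) (w i))" using h(2)[OF y[OF i] wc] by simp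
  qed simp
  also have "\<dots> = c (finsum (fun_module N) (\<lambda>i. x (?e i) (w i)) {..<n})"
    by (rule finsum_hom[OF FN.module_self modG c_hom xc[OF ec wc], symmetric])
  also have "\<dots> = c ?w" unfolding x_def finsum_extend_unit_vector[OF w] ..
  finally have "?w \<in> E" using \<open>h (tens_sum y n w) = \<zero>\<^bsub>G\<^esub>\<close> c_zero[OF w'c] by simp
  then obtain w' where "w' \<in> ?X" "\<forall>i<n. ?w i = w' i" by (auto simp: E_def)
  then show ?thesis by (intro bexI[of _ w']) auto
qed

end

section \<open>Colon identities under flat base change\<close>

locale flat_tensor = tensor_modules +
  assumes flat: "flat_over R f N" and fg: "fin_gen_module R M"
begin

text \<open>On vectors this is \<open>flat_extend_vectors\<close> for multiplication by
  \<open>r\<close> and for the preimage of \<open>U\<close> under \<open>lin_comb\<close>.\<close>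

lemma flat_colon_tsub:
  assumes U: "submodule U R M" and r: "r \<in> carrier R" and t: "t \<in> carrier T" and rt: "f r \<odot>\<^bsub>T\<^esub> t \<in> tsub U"
  shows "t \<in> tsub {x \<in> carrier M. r \<odot>\<^bsub>M\<^esub> x \<in> U}"
proof -
  let ?V = "vectors R" let ?D = "{x \<in> carrier M. r \<odot>\<^bsub>M\<^esub> x \<in> U}"
  obtain y n where y': "\<forall>i<n. y i \<in> carrier M" and surj: "lin_comb y n ` carrier ?V = carrier M"
    using fin_gen_lin_comb[OF fg] by blast
  have y: "y i \<in> carrier M" if "i < n" for i using y' that by blast
  let ?\<phi> = "lin_comb y n" let ?\<Theta> = "tens_sum y n"
  have \<phi>: "?\<phi> \<in> module_homs R ?V M" by (rule lin_comb_homs[OF y])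
  have \<Theta>: "?\<Theta> \<in> module_homs S (fun_module N) T" by (rule tens_sum_homs[OF y])
  note \<phi>D = module_homsD[OF \<phi>] and \<Theta>D = module_homsD[OF \<Theta>]
  let ?K = "{v \<in> carrier ?V. ?\<phi> v \<in> U}"
  have K: "submodule ?K R ?V" by (rule submodule_preimage_hom[OF FR.module_self M.module_self \<phi> U])
  have fr: "f r \<in> carrier S" using r by simp
  have "t \<in> ?\<Theta> ` carrier (fun_module N)"
  proof (rule submodule_tensor_eq[OF submodule_image_hom[OF FN.module_self T.module_self \<Theta>] _ t])
    fix x z assume x: "x \<in> carrier M" and z: "z \<in> carrier N"
    obtain v where v: "v \<in> carrier ?V" "x = ?\<phi> v" using x surj by blast
    show "tn x z \<in> ?\<Theta> ` carrier (fun_module N)"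
      by (rule image_eqI[OF _ extend_closed[OF v(1) z]]) (simp only: tens_sum_extend[OF y v(1) z] v(2))
  qed
  then obtain w0 where w0: "w0 \<in> carrier (fun_module N)" "t = ?\<Theta> w0" by blast
  \<comment> \<open>Truncation provides the finite support that \<open>flat_extend_vectors\<close>
    asks for, without changing the sum.\<close>
  define w where "w i = (if i < n then w0 i else \<zero>\<^bsub>N\<^esub>)" for i
  have w: "w \<in> carrier (fun_module N)" using w0(1) by (simp add: w_def)
  have tw: "t = ?\<Theta> w" unfolding w0(2) using w0(1) y by (intro tens_sum_cong) (auto simp: w_def)
  have "?\<Theta> (f r \<odot>\<^bsub>fun_module N\<^esub> w) \<in> tsub U" using rt unfolding tw \<Theta>D(3)[OF fr w] .
  then obtain w' where w': "w' \<in> extend_vectors S f N ?K" "\<forall>i<n. (f r \<odot>\<^bsub>fun_module N\<^esub> w) i = w' i"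
    using tens_sum_mem_tsub[OF y surj U FN.smult_closed[OF fr w]] by blast
  let ?W = "{v \<in> carrier ?V. r \<odot>\<^bsub>?V\<^esub> v \<in> ?K}"
  have "w \<in> extend_vectors S f N ?W"
  proof (rule flat_extend_vectors[OF M.R.is_cring N.module_self hom flat K _ _ _ _ w _ w'(1)])
    fix v assume v: "v \<in> carrier ?V" "\<And>i. i < n \<Longrightarrow> v i = \<zero>\<^bsub>R\<^esub>"
    have "?\<phi> v = finsum M (\<lambda>i. \<zero>\<^bsub>M\<^esub>) {..<n}"
      unfolding lin_comb_def using v(2) y by (intro M.M.finsum_cong') auto
    then show "v \<in> ?K" using v(1) M.sub_zero[OF U] by simp
  next
    show "(\<lambda>v. r \<odot>\<^bsub>?V\<^esub> v) \<in> module_homs R ?V ?V" by (rule module_homs_smult[OF FR.module_self r])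
    show "(\<lambda>v. f r \<odot>\<^bsub>fun_module N\<^esub> v) \<in> module_homs S (fun_module N) (fun_module N)"
      by (rule module_homs_smult[OF FN.module_self fr])
    show "f r \<odot>\<^bsub>fun_module N\<^esub> (\<lambda>i. f (v i) \<odot>\<^bsub>N\<^esub> z) = (\<lambda>i. f ((r \<odot>\<^bsub>?V\<^esub> v) i) \<odot>\<^bsub>N\<^esub> z)"
      if "v \<in> carrier ?V" "z \<in> carrier N" for v z
      using that r by (simp add: hom_simps N.smult_assoc1)
    show "w i = \<zero>\<^bsub>N\<^esub>" if "n \<le> i" for i using that by (simp add: w_def)
    show "(f r \<odot>\<^bsub>fun_module N\<^esub> w) i = w' i" if "i < n" for i using w'(2) that by blast
  qed
  moreover have Dc: "?D \<subseteq> carrier M" by blast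
  moreover have "extend_vectors S f N ?W \<subseteq> {w \<in> carrier (fun_module N). ?\<Theta> w \<in> tsub ?D}"
  proof (rule extend_vectors_minimal[OF submodule_preimage_hom[OF FN.module_self T.module_self \<Theta> tsub_submodule[OF Dc]]])
    fix k z assume k: "k \<in> ?W" and z: "z \<in> carrier N"
    have kc: "k \<in> carrier ?V" using k by blast
    have "?\<phi> k \<in> ?D" using k \<phi>D(1)[OF kc] \<phi>D(3)[OF r kc] by simp
    then show "(\<lambda>i. f (k i) \<odot>\<^bsub>N\<^esub> z) \<in> {w \<in> carrier (fun_module N). ?\<Theta> w \<in> tsub ?D}"
      using tsub_mem[OF _ z] tens_sum_extend[OF y kc z] extend_closed[OF kc z] by simp
  qed
  ultimately show ?thesis unfolding tw by blast
qed

text \<open>The kernel of \<open>a \<mapsto> a m\<close> from \<open>R\<close> to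
  \<open>M / U\<close> is \<open>(U : m)\<close>; by flatness, the kernel of
  \<open>z \<mapsto> m \<otimes> z\<close> from \<open>N\<close> to
  \<open>(M / U) \<otimes> N\<close> is \<open>(U : m) N\<close>.\<close>

lemma flat_colon_element:
  assumes U: "submodule U R M" and m: "m \<in> carrier M" and z: "z \<in> carrier N" and mem: "tn m z \<in> tsub U"
  shows "z \<in> set_smult S (f ` colon R M U {m}) N"
proof -
  let ?V = "vectors R"
  obtain y n where y': "\<forall>i<n. y i \<in> carrier M" and surj: "lin_comb y n ` carrier ?V = carrier M"
    using fin_gen_lin_comb[OF fg] by blast
  have y: "y i \<in> carrier M" if "i < n" for i using y' that by blast
  let ?\<phi> = "lin_comb y n"
  have \<phi>: "?\<phi> \<in> module_homs R ?V M" by (rule lin_comb_homs[OF y])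
  note \<phi>D = module_homsD[OF \<phi>]
  let ?K = "{v \<in> carrier ?V. ?\<phi> v \<in> U}"
  have K: "submodule ?K R ?V" by (rule submodule_preimage_hom[OF FR.module_self M.module_self \<phi> U])
  obtain v where v: "v \<in> carrier ?V" "m = ?\<phi> v" using m surj by blast
  have vc: "v i \<in> carrier R" for i using v by simp
  have "tens_sum y n (\<lambda>i. f (v i) \<odot>\<^bsub>N\<^esub> z) \<in> tsub U" using mem v tens_sum_extend[OF y v(1) z] by simp
  then obtain w' where w': "w' \<in> extend_vectors S f N ?K" "\<forall>i<n. f (v i) \<odot>\<^bsub>N\<^esub> z = w' i"
    using tens_sum_mem_tsub[OF y surj U extend_closed[OF v(1) z]] by blast
  define x where "x i = (if i = 0 then z else \<zero>\<^bsub>N\<^esub>)" for i :: nat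
  \<comment> \<open>\<open>R\<close> is placed in coordinate 0: \<open>u\<close> sends a scalar
    there to its multiple of the vector \<open>v\<close> over \<open>m\<close>, and
    \<open>u'\<close> is the corresponding map for \<open>N\<close>.\<close>
  define u where "u k = (\<lambda>i :: nat. k (0::nat) \<otimes>\<^bsub>R\<^esub> v i)" for k
  define u' where "u' k = (\<lambda>i :: nat. f (v i) \<odot>\<^bsub>N\<^esub> k (0::nat))" for k
  let ?W = "{k \<in> carrier ?V. u k \<in> ?K}"
  have "x \<in> extend_vectors S f N ?W"
  proof (rule flat_extend_vectors[OF M.R.is_cring N.module_self hom flat K _ _ _ _ _ _ w'(1)])
    fix v assume v: "v \<in> carrier ?V" "\<And>i. i < n \<Longrightarrow> v i = \<zero>\<^bsub>R\<^esub>"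
    have "?\<phi> v = finsum M (\<lambda>i. \<zero>\<^bsub>M\<^esub>) {..<n}"
      unfolding lin_comb_def using v(2) y by (intro M.M.finsum_cong') auto
    then show "v \<in> ?K" using v(1) M.sub_zero[OF U] by simp
  next
    show "u \<in> module_homs R ?V ?V"
      by (rule module_homsI) (use vc in \<open>auto simp: u_def M.R.l_distr M.R.m_assoc\<close>)
    show "u' \<in> module_homs S (fun_module N) (fun_module N)"
      by (rule module_homsI) (use vc in \<open>auto simp: u'_def N.smult_r_distr N.smult_commute\<close>)
    show "u' (\<lambda>i. f (k i) \<odot>\<^bsub>N\<^esub> z) = (\<lambda>i. f (u k i) \<odot>\<^bsub>N\<^esub> z)"
      if "k \<in> carrier ?V" "z \<in> carrier N" for k z
      using that vc by (simp add: u_def u'_def hom_simps N.smult_assoc1 N.smult_commute)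
    show "x \<in> carrier (fun_module N)" using z by (simp add: x_def)
    show "x i = \<zero>\<^bsub>N\<^esub>" if "1 \<le> i" for i using that by (simp add: x_def)
    show "u' x i = w' i" if "i < n" for i using w'(2) that by (simp add: u'_def x_def)
  qed
  moreover let ?J = "colon R M U {m}"
  have fJ: "f ` ?J \<subseteq> carrier S" by (auto simp: colon_def)
  have ev: "(\<lambda>w. w 0) \<in> module_homs S (fun_module N) N" by (rule module_homsI) auto
  have "extend_vectors S f N ?W \<subseteq> {w \<in> carrier (fun_module N). w 0 \<in> set_smult S (f ` ?J) N}"
  proof (rule extend_vectors_minimal[OF submodule_preimage_hom[OF FN.module_self N.module_self ev N.set_smult_submodule[OF fJ]]])
    fix k z assume k: "k \<in> ?W" and z: "z \<in> carrier N"
    have kc: "k \<in> carrier ?V" "k 0 \<in> carrier R" using k by auto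
    have "u k = k 0 \<odot>\<^bsub>?V\<^esub> v" by (simp add: u_def)
    then have "?\<phi> (u k) = k 0 \<odot>\<^bsub>M\<^esub> m" using \<phi>D(3)[OF kc(2) v(1)] v(2) by simp
    then have "k 0 \<in> ?J" using k kc(2) by (simp add: colon_def)
    then show "(\<lambda>i. f (k i) \<odot>\<^bsub>N\<^esub> z) \<in> {w \<in> carrier (fun_module N). w 0 \<in> set_smult S (f ` ?J) N}"
      using N.set_smult_mem[of "f (k 0)" "f ` ?J" z] extend_closed[OF kc(1) z] z by simp
  qed
  ultimately show ?thesis by (auto simp: x_def)
qed

text \<open>The analogue of \<open>flat_colon_tsub\<close> with \<open>R\<close> and
  \<open>p\<close> for \<open>M\<close> and \<open>U\<close>, where coordinate 0 of the vectors
  plays the role of \<open>R\<close>. It serves the fibers \<open>N / p N\<close>.\<close>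

lemma flat_colon_ideal:
  assumes p: "ideal p R" and r: "r \<in> carrier R" and z: "z \<in> carrier N" and mem: "f r \<odot>\<^bsub>N\<^esub> z \<in> set_smult S (f ` p) N"
  shows "z \<in> set_smult S (f ` {a \<in> carrier R. r \<otimes>\<^bsub>R\<^esub> a \<in> p}) N"
proof -
  let ?V = "vectors R" let ?J = "{a \<in> carrier R. r \<otimes>\<^bsub>R\<^esub> a \<in> p}"
  have pc: "a \<in> carrier R" if "a \<in> p" for a using ideal.Icarr[OF p that] .
  have fp: "f ` p \<subseteq> carrier S" using pc by auto
  have fJ: "f ` ?J \<subseteq> carrier S" by auto
  have fr: "f r \<in> carrier S" using r by simp
  have evR: "(\<lambda>v. v 0) \<in> module_homs R ?V (ring_module R)" by (rule module_homsI) auto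
  have ev: "(\<lambda>w. w 0) \<in> module_homs S (fun_module N) N" by (rule module_homsI) auto
  let ?K = "{v \<in> carrier ?V. v 0 \<in> p}"
  have K: "submodule ?K R ?V"
    by (rule submodule_preimage_hom[OF FR.module_self M.R.module_ring_module evR]) (use p in \<open>simp add: M.R.submodule_iff_ideal\<close>)
  have Kc: "?K \<subseteq> carrier ?V" by blast
  have "set_smult S (f ` p) N \<subseteq> (\<lambda>w. w 0) ` extend_vectors S f N ?K"
  proof (rule N.set_smult_minimal)
    have X: "submodule (extend_vectors S f N ?K) S (fun_module N)" by (rule extend_vectors_submodule[OF Kc])
    have m: "module S (fun_module N\<lparr>carrier := extend_vectors S f N ?K\<rparr>)"
      by (rule submodule.submodule_is_module[OF X FN.module_self])
    have "(\<lambda>w. w 0) \<in> module_homs S (fun_module N\<lparr>carrier := extend_vectors S f N ?K\<rparr>) N"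
      by (rule module_homsI) (use FN.sub_carr[OF X] in auto)
    from submodule_image_hom[OF m N.module_self this]
    show "submodule ((\<lambda>w. w 0) ` extend_vectors S f N ?K) S N" by simp
    fix b z assume "b \<in> f ` p" and z: "z \<in> carrier N"
    then obtain a where a: "a \<in> p" "b = f a" by auto
    have "(\<lambda>i::nat. f a \<odot>\<^bsub>N\<^esub> z) \<in> extend_vectors S f N ?K"
      using extend_vectors_mem[of "\<lambda>i. a" ?K z] a(1) pc[OF a(1)] z by simp
    then show "b \<odot>\<^bsub>N\<^esub> z \<in> (\<lambda>w. w 0) ` extend_vectors S f N ?K" unfolding a(2) by (rule image_eqI[rotated]) simp
  qed
  then obtain w' where w': "w' \<in> extend_vectors S f N ?K" "f r \<odot>\<^bsub>N\<^esub> z = w' 0" using mem by blast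
  define x where "x i = (if i = 0 then z else \<zero>\<^bsub>N\<^esub>)" for i :: nat
  let ?W = "{v \<in> carrier ?V. r \<odot>\<^bsub>?V\<^esub> v \<in> ?K}"
  have "x \<in> extend_vectors S f N ?W"
  proof (rule flat_extend_vectors[OF M.R.is_cring N.module_self hom flat K _ _ _ _ _ _ w'(1)])
    show "v \<in> ?K" if "v \<in> carrier ?V" "\<And>i. i < 1 \<Longrightarrow> v i = \<zero>\<^bsub>R\<^esub>" for v
      using that additive_subgroup.zero_closed[OF ideal.axioms(1)[OF p]] by simp
    show "(\<lambda>v. r \<odot>\<^bsub>?V\<^esub> v) \<in> module_homs R ?V ?V" by (rule module_homs_smult[OF FR.module_self r])
    show "(\<lambda>v. f r \<odot>\<^bsub>fun_module N\<^esub> v) \<in> module_homs S (fun_module N) (fun_module N)"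
      by (rule module_homs_smult[OF FN.module_self fr])
    show "f r \<odot>\<^bsub>fun_module N\<^esub> (\<lambda>i. f (v i) \<odot>\<^bsub>N\<^esub> z) = (\<lambda>i. f ((r \<odot>\<^bsub>?V\<^esub> v) i) \<odot>\<^bsub>N\<^esub> z)"
      if "v \<in> carrier ?V" "z \<in> carrier N" for v z
      using that r by (simp add: hom_simps N.smult_assoc1)
    show "x \<in> carrier (fun_module N)" using z by (simp add: x_def)
    show "x i = \<zero>\<^bsub>N\<^esub>" if "1 \<le> i" for i using that by (simp add: x_def)
    show "(f r \<odot>\<^bsub>fun_module N\<^esub> x) i = w' i" if "i < 1" for i using that w'(2) by (simp add: x_def)
  qed
  moreover have "extend_vectors S f N ?W \<subseteq> {w \<in> carrier (fun_module N). w 0 \<in> set_smult S (f ` ?J) N}"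
  proof (rule extend_vectors_minimal[OF submodule_preimage_hom[OF FN.module_self N.module_self ev N.set_smult_submodule[OF fJ]]])
    fix k z assume k: "k \<in> ?W" and z: "z \<in> carrier N"
    have kc: "k \<in> carrier ?V" using k by blast
    have "k 0 \<in> ?J" using k by simp
    then show "(\<lambda>i. f (k i) \<odot>\<^bsub>N\<^esub> z) \<in> {w \<in> carrier (fun_module N). w 0 \<in> set_smult S (f ` ?J) N}"
      using N.set_smult_mem[of "f (k 0)" "f ` ?J" z] extend_closed[OF kc z] z by simp
  qed
  ultimately show ?thesis by (auto simp: x_def)
qed

end

section \<open>Local flat base change\<close>

text \<open>A nonnegative supremum is not over the empty set, and a finite one bounds a set of
  natural numbers, which then has a maximum.\<close>

lemma dim_over_attained:
  assumes "0 \<le> dim_over A J" "dim_over A J < \<infinity>"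
  shows "\<exists>d::nat. dim_over A J = ereal (real d)"
proof -
  let ?L = "(\<lambda>ps. length ps - 1) ` prime_chains A J"
  obtain b where b: "dim_over A J = ereal b" using assms by (cases "dim_over A J") auto
  have le: "real l \<le> b" if "l \<in> ?L" for l
    using that dim_over_upper[of _ A J] b by auto
  have "l \<le> nat \<lceil>b\<rceil>" if "l \<in> ?L" for l
    using le[OF that] real_nat_ceiling_ge[of b] by linarith
  then have "?L \<subseteq> {..nat \<lceil>b\<rceil>}" by blast
  then have fin: "finite ?L" by (rule finite_subset) simp
  have ne: "?L \<noteq> {}"
  proof
    assume "?L = {}"
    then have "dim_over A J = - \<infinity>" by (simp add: dim_over_def bot_ereal_def)
    then show False using assms(1) by simp
  qed
  obtain ps where ps: "ps \<in> prime_chains A J" "Max ?L = length ps - 1" using Max_in[OF fin ne] by blast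
  have "dim_over A J = ereal (real (Max ?L))"
  proof (rule antisym)
    show "dim_over A J \<le> ereal (real (Max ?L))"
      unfolding dim_over_def by (rule SUP_least) (use fin in \<open>auto intro!: Max_ge\<close>)
    show "ereal (real (Max ?L)) \<le> dim_over A J" unfolding ps(2) by (rule dim_over_upper[OF ps(1)])
  qed
  then show ?thesis by blast
qed

lemma (in noetherian_local_ring) unit_of_not_maximal:
  assumes s: "s \<in> carrier R" "s \<notin> \<mm>" shows "\<exists>t\<in>carrier R. t \<otimes> s = \<one>"
proof -
  have "PIdl s = carrier R"
    using proper_ideal_subset[OF cgenideal_ideal[OF s(1)]] cgenideal_self[OF s(1)] s(2) by blast
  then have "\<one> \<in> PIdl s" by simp
  then show ?thesis by (auto simp: cgenideal_def)
qed

lemma (in cring) primeideal_contraction: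
  assumes S: "cring S" and f: "f \<in> ring_hom R S" and Q: "primeideal Q S"
  shows "primeideal {r \<in> carrier R. f r \<in> Q} R"
proof -
  interpret S: cring S by fact
  interpret Q: primeideal Q S by fact
  interpret h: ring_hom_ring R S f
    by (intro ring_hom_ring.intro ring_hom_ring_axioms.intro ring_axioms S.ring_axioms f)
  show ?thesis
  proof (rule primeidealI)
    show "ideal {r \<in> carrier R. f r \<in> Q} R" by (rule h.ideal_vimage[OF Q.is_ideal])
    have "\<one> \<notin> {r \<in> carrier R. f r \<in> Q}" using primeideal_one[OF Q] by simp
    then show "carrier R \<noteq> {r \<in> carrier R. f r \<in> Q}" by blast
    fix a b assume "a \<in> carrier R" "b \<in> carrier R" "a \<otimes> b \<in> {r \<in> carrier R. f r \<in> Q}"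
    then show "a \<in> {r \<in> carrier R. f r \<in> Q} \<or> b \<in> {r \<in> carrier R. f r \<in> Q}"
      using Q.I_prime[of "f a" "f b"] by auto
  qed (rule is_cring)
qed

context flat_tensor
begin

lemma tsub_add_mult:
  assumes U: "submodule U R M" and r: "r \<in> carrier R"
  shows "tsub (add_mult M U r) = add_mult T (tsub U) (f r)"
proof
  have fr: "f r \<in> carrier S" using r by simp
  have tU: "submodule (tsub U) S T" by (rule tsub_submodule[OF M.submodule_carrier[OF U]])
  have A: "submodule (add_mult M U r) R M" by (rule M.submodule_add_mult[OF U r])
  have B: "submodule (add_mult T (tsub U) (f r)) S T" by (rule T.submodule_add_mult[OF tU fr])
  have "add_mult M U r \<subseteq> {x \<in> carrier M. \<forall>z\<in>carrier N. tn x z \<in> add_mult T (tsub U) (f r)}"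
  proof (rule M.add_mult_minimal[OF submodule_tn_preimage[OF B]])
    show "U \<subseteq> {x \<in> carrier M. \<forall>z\<in>carrier N. tn x z \<in> add_mult T (tsub U) (f r)}"
    proof (intro subsetI CollectI conjI ballI)
      fix x assume x: "x \<in> U"
      show "x \<in> carrier M" by (rule M.sub_carr[OF U x])
      show "tn x z \<in> add_mult T (tsub U) (f r)" if "z \<in> carrier N" for z
        by (rule subsetD[OF T.add_mult_superset[OF tU fr] tsub_mem[OF x that]])
    qed
    fix x assume x: "x \<in> carrier M"
    have "tn (r \<odot>\<^bsub>M\<^esub> x) z \<in> add_mult T (tsub U) (f r)" if z: "z \<in> carrier N" for z
      using T.add_mult_self[OF tU fr tn_closed[OF x z]] x z r by (simp add: tn_smult tn_balanced)
    then show "r \<odot>\<^bsub>M\<^esub> x \<in> {x \<in> carrier M. \<forall>z\<in>carrier N. tn x z \<in> add_mult T (tsub U) (f r)}" using x r by simp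
  qed
  then show "tsub (add_mult M U r) \<subseteq> add_mult T (tsub U) (f r)"
    by (intro tsub_minimal[OF B]) blast
  show "add_mult T (tsub U) (f r) \<subseteq> tsub (add_mult M U r)"
  proof (rule T.add_mult_minimal[OF tsub_submodule[OF M.submodule_carrier[OF A]]])
    show "tsub U \<subseteq> tsub (add_mult M U r)"
    proof (rule tsub_minimal[OF tsub_submodule[OF M.submodule_carrier[OF A]]])
      show "tn x z \<in> tsub (add_mult M U r)" if "x \<in> U" "z \<in> carrier N" for x z
        by (rule tsub_mem[OF subsetD[OF M.add_mult_superset[OF U r] that(1)] that(2)])
    qed
    show "f r \<odot>\<^bsub>T\<^esub> t \<in> tsub (add_mult M U r)" if "t \<in> carrier T" for t
      using smult_mem_tsub[OF A r M.add_mult_self[OF U r] that] .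
  qed
qed

lemma tsub_add_mults:
  assumes "submodule U R M" "set xs \<subseteq> carrier R"
  shows "add_mults T (tsub U) (map f xs) = tsub (add_mults M U xs)"
  using assms
proof (induction xs arbitrary: U)
  case (Cons x xs)
  then have x: "x \<in> carrier R" "set xs \<subseteq> carrier R" by auto
  show ?case using Cons.IH[OF M.submodule_add_mult[OF Cons.prems(1) x(1)] x(2)]
    by (simp add: tsub_add_mult[OF Cons.prems(1) x(1)])
qed simp

text \<open>Regularity of \<open>r\<close> modulo \<open>U\<close> means \<open>(U : r) = U\<close>,
  and this colon commutes with base change.\<close>

lemma regular_mod_tsub:
  assumes U: "submodule U R M" and r: "r \<in> carrier R" "regular_mod M U r"
  shows "regular_mod T (tsub U) (f r)"
  unfolding regular_mod_def
proof (intro ballI impI)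
  fix t assume t: "t \<in> carrier T" "f r \<odot>\<^bsub>T\<^esub> t \<in> tsub U"
  have "{x \<in> carrier M. r \<odot>\<^bsub>M\<^esub> x \<in> U} = U"
  proof (intro equalityI subsetI CollectI conjI)
    show "x \<in> U" if "x \<in> {x \<in> carrier M. r \<odot>\<^bsub>M\<^esub> x \<in> U}" for x using that r(2) unfolding regular_mod_def by blast
  qed (rule M.sub_carr[OF U], assumption, rule M.sub_smult[OF U r(1)])
  then show "t \<in> tsub U" using flat_colon_tsub[OF U r(1) t] by simp
qed

lemma regular_seq_mod_tsub:
  assumes "submodule U R M" "set xs \<subseteq> carrier R" "regular_seq_mod M U xs"
  shows "regular_seq_mod T (tsub U) (map f xs)"
  using assms
proof (induction xs arbitrary: U)
  case (Cons x xs)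
  then have x: "x \<in> carrier R" "set xs \<subseteq> carrier R" "regular_mod M U x" "regular_seq_mod M (add_mult M U x) xs" by auto
  show ?case using Cons.IH[OF M.submodule_add_mult[OF Cons.prems(1) x(1)] x(2,4)] regular_mod_tsub[OF Cons.prems(1) x(1,3)]
    by (simp add: tsub_add_mult[OF Cons.prems(1) x(1)])
qed simp

end

locale local_flat_tensor = flat_tensor +
  fixes \<mm> \<nn>
  assumes local_R: "noetherian_local_ring R \<mm>" and local_S: "noetherian_local_ring S \<nn>"
    and f_local: "f ` \<mm> \<subseteq> \<nn>" and fg_N: "fin_gen_module S N" and N_nonzero: "carrier N \<noteq> {\<zero>\<^bsub>N\<^esub>}"
begin

sublocale LR: noetherian_local_ring R \<mm> by (rule local_R)
sublocale LS: noetherian_local_ring S \<nn> by (rule local_S)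
sublocale Mn: noetherian_module R M
  by (rule M.noetherian_module_of_fin_gen[OF LR.noetherian_ring_axioms fg])
sublocale Nn: noetherian_module S N
  by (rule N.noetherian_module_of_fin_gen[OF LS.noetherian_ring_axioms fg_N])
sublocale Tn: noetherian_module S T
  by (rule T.noetherian_module_of_fin_gen[OF LS.noetherian_ring_axioms fin_gen_tensor[OF fg fg_N]])

lemma ideal_extension_proper:
  assumes J: "J \<subseteq> \<mm>"
  shows "set_smult S (f ` J) N \<noteq> carrier N"
proof
  assume eq: "set_smult S (f ` J) N = carrier N"
  have "carrier N \<subseteq> {\<zero>\<^bsub>N\<^esub>}"
  proof (rule Nn.local_nakayama[OF LS.maximal_prime _ N.submodule_zero])
    show "f ` J \<subseteq> \<nn>" using J f_local by blast
    \<comment> \<open>Elements outside \<open>\<nn>\<close> are units, so saturating at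
      \<open>\<nn>\<close> changes nothing and Nakayama's lemma takes its usual form.\<close>
    show "saturation S N \<nn> {\<zero>\<^bsub>N\<^esub>} \<subseteq> {\<zero>\<^bsub>N\<^esub>}"
    proof
      fix x assume "x \<in> saturation S N \<nn> {\<zero>\<^bsub>N\<^esub>}"
      then obtain s where s: "x \<in> carrier N" "s \<in> carrier S" "s \<notin> \<nn>" "s \<odot>\<^bsub>N\<^esub> x = \<zero>\<^bsub>N\<^esub>" by (auto simp: saturation_def)
      obtain t where t: "t \<in> carrier S" "t \<otimes>\<^bsub>S\<^esub> s = \<one>\<^bsub>S\<^esub>" using LS.unit_of_not_maximal[OF s(2,3)] by blast
      have "x = (t \<otimes>\<^bsub>S\<^esub> s) \<odot>\<^bsub>N\<^esub> x" using s t by simp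
      also have "\<dots> = t \<odot>\<^bsub>N\<^esub> (s \<odot>\<^bsub>N\<^esub> x)" by (rule N.smult_assoc1[OF t(1) s(2,1)])
      also have "\<dots> = \<zero>\<^bsub>N\<^esub>" using s t by simp
      finally show "x \<in> {\<zero>\<^bsub>N\<^esub>}" by simp
    qed
    show "carrier N \<subseteq> V" if "submodule V S N" "\<And>a u. a \<in> f ` J \<Longrightarrow> u \<in> carrier N \<Longrightarrow> a \<odot>\<^bsub>N\<^esub> u \<in> V" for V
      using N.set_smult_minimal[OF that(1), of "f ` J"] that(2) eq by blast
  qed simp
  then show False using N_nonzero by auto
qed

text \<open>The dimension of \<open>N / p N\<close> over \<open>S\<close>; for \<open>\<mm>\<close>
  it is the one in condition (1).\<close>

abbreviation fiber_dim :: "'a set \<Rightarrow> ereal" where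
  "fiber_dim p \<equiv> dim_over S (colon S N (set_smult S (f ` p) N) (carrier N))"

lemma maximal_carrier: "a \<in> \<mm> \<Longrightarrow> a \<in> carrier R"
  using primeideal_carr[OF LR.maximal_prime] .

lemma image_ideal_carrier: "p \<subseteq> carrier R \<Longrightarrow> f ` p \<subseteq> carrier S"
  by auto

lemma fiber_dim_antimono:
  assumes "p \<subseteq> p'" "p' \<subseteq> carrier R" shows "fiber_dim p' \<le> fiber_dim p"
proof (rule dim_over_antimono)
  have "set_smult S (f ` p) N \<subseteq> set_smult S (f ` p') N"
    by (rule N.set_smult_mono[OF image_mono[OF assms(1)] image_ideal_carrier[OF assms(2)]])
  then show "colon S N (set_smult S (f ` p) N) (carrier N) \<subseteq> colon S N (set_smult S (f ` p') N) (carrier N)"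
    by (auto simp: colon_def)
qed

text \<open>This replaces the going-down theorem: by flatness, an element of \<open>p' - p\<close> is regular on \<open>N / p N\<close>.\<close>

lemma fiber_dim_step:
  assumes p: "primeideal p R" "primeideal p' R" "p \<subset> p'"
  shows "fiber_dim p' + 1 \<le> fiber_dim p"
proof -
  obtain x where x: "x \<in> p'" "x \<notin> p" using p(3) by blast
  have pc: "p \<subseteq> carrier R" "p' \<subseteq> carrier R"
    using primeideal_carr[OF p(1)] primeideal_carr[OF p(2)] by blast+
  have xc: "x \<in> carrier R" using x pc by blast
  have fx: "f x \<in> carrier S" using xc by simp
  have id: "ideal p R" using p(1) primeideal.axioms(1) by blast
  let ?P = "set_smult S (f ` p) N"
  have P: "submodule ?P S N" by (rule N.set_smult_submodule[OF image_ideal_carrier[OF pc(1)]])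
  have P': "submodule (set_smult S (f ` p') N) S N" by (rule N.set_smult_submodule[OF image_ideal_carrier[OF pc(2)]])
  have "{a \<in> carrier R. x \<otimes>\<^bsub>R\<^esub> a \<in> p} = p"
    using primeideal.I_prime[OF p(1) xc] x(2) ideal.I_l_closed[OF id _ xc] pc by blast
  then have reg: "regular_mod N ?P (f x)"
    using flat_colon_ideal[OF id xc] by (auto simp: regular_mod_def)
  have sub: "add_mult N ?P (f x) \<subseteq> set_smult S (f ` p') N"
  proof (rule N.add_mult_minimal[OF P'])
    show "?P \<subseteq> set_smult S (f ` p') N"
      by (rule N.set_smult_mono[OF image_mono image_ideal_carrier[OF pc(2)]]) (use p(3) in blast)
    show "f x \<odot>\<^bsub>N\<^esub> z \<in> set_smult S (f ` p') N" if "z \<in> carrier N" for z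
      using N.set_smult_mem[of "f x" "f ` p'" z] x(1) that by simp
  qed
  have "fiber_dim p' \<le> dim_over S (colon S N (add_mult N ?P (f x)) (carrier N))"
    by (rule dim_over_antimono) (use sub in \<open>auto simp: colon_def\<close>)
  then have "fiber_dim p' + 1 \<le> dim_over S (colon S N (add_mult N ?P (f x)) (carrier N)) + 1"
    by (rule add_right_mono)
  also have "\<dots> \<le> fiber_dim p" by (rule Nn.dim_over_regular_mod[OF P fx reg])
  finally show ?thesis .
qed

text \<open>Each strict inclusion contributes 1, and the top prime lies in \<open>\<mm>\<close>,
  whose fiber has the smallest dimension.\<close>

lemma fiber_dim_chain:
  assumes "ps \<in> prime_chains R {}"
  shows "ereal (real (length ps - 1)) + fiber_dim \<mm> \<le> fiber_dim (hd ps)"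
  using assms
proof (induction ps)
  case (Cons p ps)
  have p: "primeideal p R" using Cons.prems by (simp add: prime_chains_def)
  have m: "\<mm> \<subseteq> carrier R" using maximal_carrier by blast
  show ?case
  proof (cases ps)
    case Nil
    then show ?thesis
      using fiber_dim_antimono[OF LR.prime_subset_maximal[OF p] m] by (simp add: zero_ereal_def[symmetric])
  next
    case (Cons p' qs)
    have c: "ps \<in> prime_chains R {}" "primeideal p' R" "p \<subset> p'"
      using Cons.prems Cons by (auto simp: prime_chains_def)
    have "ereal (real (length (p # ps) - 1)) + fiber_dim \<mm> = (ereal (real (length ps - 1)) + fiber_dim \<mm>) + 1"
      using Cons by (cases "fiber_dim \<mm>") auto
    also have "\<dots> \<le> fiber_dim (hd ps) + 1" by (rule add_right_mono[OF Cons.IH[OF c(1)]])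
    also have "\<dots> \<le> fiber_dim p" using fiber_dim_step[OF p c(2,3)] Cons by simp
    finally show ?thesis by simp
  qed
qed (simp add: prime_chains_def)

lemma fiber_dim_nonneg: "0 \<le> fiber_dim \<mm>"
proof (rule LS.dim_over_nonneg)
  have m: "\<mm> \<subseteq> carrier R" using maximal_carrier by blast
  have P: "submodule (set_smult S (f ` \<mm>) N) S N" by (rule N.set_smult_submodule[OF image_ideal_carrier[OF m]])
  show "ideal (colon S N (set_smult S (f ` \<mm>) N) (carrier N)) S" by (rule N.ideal_colon[OF P order_refl])
  show "colon S N (set_smult S (f ` \<mm>) N) (carrier N) \<noteq> carrier S"
  proof
    assume "colon S N (set_smult S (f ` \<mm>) N) (carrier N) = carrier S"
    then have "\<one>\<^bsub>S\<^esub> \<in> colon S N (set_smult S (f ` \<mm>) N) (carrier N)" by simp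
    then have "carrier N \<subseteq> set_smult S (f ` \<mm>) N" by (auto simp: colon_def)
    then show False using ideal_extension_proper[OF order_refl] N.submodule_carrier[OF P] by blast
  qed
qed

lemma fiber_dim_finite: "fiber_dim p < \<infinity>"
  by (rule LS.dim_over_finite)

text \<open>By \<open>prime_colon_below\<close>, a chain over the annihilator of
  \<open>M / U\<close> may start with some \<open>q = (U : x)\<close>. The tensors
  \<open>x \<otimes> z\<close> form a copy of \<open>N / q N\<close> modulo \<open>tsub U\<close>,
  so the fibers along the chain give the bound.\<close>

lemma dim_tensor_ge:
  assumes U: "submodule U R M"
  shows "dim_over R (colon R M U (carrier M)) + fiber_dim \<mm> \<le> dim_over S (colon S T (tsub U) (carrier T))"
    (is "_ \<le> ?D")
proof -
  obtain d where d: "fiber_dim \<mm> = ereal d" using fiber_dim_nonneg fiber_dim_finite by (cases "fiber_dim \<mm>") auto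
  have "dim_over R (colon R M U (carrier M)) \<le> ?D - ereal d"
    unfolding dim_over_def[of R]
  proof (rule SUP_least)
    fix ps assume ps: "ps \<in> prime_chains R (colon R M U (carrier M))"
    then obtain p qs where p: "ps = p # qs" "primeideal p R" "colon R M U (carrier M) \<subseteq> p"
      by (cases ps) (auto simp: prime_chains_def)
    obtain x where x: "x \<in> carrier M" "primeideal (colon R M U {x}) R" "colon R M U {x} \<subseteq> p"
      using Mn.prime_colon_below[OF p(2) U p(3)] by blast
    let ?q = "colon R M U {x}"
    have chain: "?q # qs \<in> prime_chains R {}"
    proof (cases "qs = []")
      case True
      then show ?thesis using prime_chains_singleton[OF x(2)] by simp
    next
      case False
      have "qs \<in> prime_chains R {}" "p \<subset> hd qs"
        using ps p(1) False by (auto simp: prime_chains_def)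
      then show ?thesis using x(3) by (intro prime_chains_Cons[OF _ _ x(2)]) auto
    qed
    have "colon S T (tsub U) (carrier T) \<subseteq> colon S N (set_smult S (f ` ?q) N) (carrier N)"
    proof
      fix s assume s: "s \<in> colon S T (tsub U) (carrier T)"
      then have sc: "s \<in> carrier S" by (simp add: colon_def)
      have "s \<odot>\<^bsub>N\<^esub> z \<in> set_smult S (f ` ?q) N" if z: "z \<in> carrier N" for z
      proof (rule flat_colon_element[OF U x(1)])
        show "s \<odot>\<^bsub>N\<^esub> z \<in> carrier N" using sc z by simp
        have "s \<odot>\<^bsub>T\<^esub> tn x z \<in> tsub U" using s tn_closed[OF x(1) z] by (simp add: colon_def)
        then show "tn x (s \<odot>\<^bsub>N\<^esub> z) \<in> tsub U" by (simp add: tn_smult[OF sc])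
      qed
      then show "s \<in> colon S N (set_smult S (f ` ?q) N) (carrier N)" using sc by (simp add: colon_def)
    qed
    then have "fiber_dim ?q \<le> ?D" by (rule dim_over_antimono)
    then have "ereal (real (length ps - 1)) + ereal d \<le> ?D"
      using order_trans[OF fiber_dim_chain[OF chain]] d p(1) by simp
    then show "ereal (real (length ps - 1)) \<le> ?D - ereal d" by (simp add: ereal_le_minus)
  qed
  then show ?thesis unfolding d by (simp add: ereal_le_minus)
qed

text \<open>A system of parameters \<open>xs\<close> of \<open>M / U\<close> becomes one of its tensor product with \<open>N\<close>: a prime \<open>Q\<close>
  over the annihilator and over \<open>xs\<close> contracts to \<open>\<mm>\<close>, and by Nakayama's lemma at \<open>Q\<close> it contains the
  annihilator of the fiber \<open>N / \<mm> N\<close>.\<close>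

lemma dim_tensor_le:
  assumes U: "submodule U R M" "U \<noteq> carrier M" and fib: "fiber_dim \<mm> = 0"
  shows "dim_over S (colon S T (tsub U) (carrier T)) \<le> dim_over R (colon R M U (carrier M))"
proof -
  let ?J = "colon R M U (carrier M)" let ?JT = "colon S T (tsub U) (carrier T)"
  have m: "\<mm> \<subseteq> carrier R" using maximal_carrier by blast
  let ?mN = "set_smult S (f ` \<mm>) N"
  have mN: "submodule ?mN S N" by (rule N.set_smult_submodule[OF image_ideal_carrier[OF m]])
  have tU: "submodule (tsub U) S T" by (rule tsub_submodule[OF M.submodule_carrier[OF U(1)]])
  have J: "ideal ?J R" by (rule M.ideal_colon[OF U(1) order_refl])
  have "?J \<noteq> carrier R"
  proof
    assume "?J = carrier R"
    then have "\<one>\<^bsub>R\<^esub> \<in> ?J" by simp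
    then have "carrier M \<subseteq> U" by (auto simp: colon_def)
    then show False using U(2) M.submodule_carrier[OF U(1)] by blast
  qed
  then obtain d :: nat where d: "dim_over R ?J = ereal (real d)"
    using dim_over_attained[OF LR.dim_over_nonneg[OF J] LR.dim_over_finite] by blast
  obtain xs where xs: "length xs \<le> d" "set xs \<subseteq> \<mm>"
    "\<And>P. primeideal P R \<Longrightarrow> ?J \<union> set xs \<subseteq> P \<Longrightarrow> P = \<mm>"
    using LR.system_of_parameters[OF J, of d] d by auto
  have "dim_over S ?JT \<le> ereal (real (length (map f xs)))"
  proof (rule LS.dim_over_le_length)
    show "set (map f xs) \<subseteq> \<nn>" using xs(2) f_local by auto
    fix Q assume Q: "primeideal Q S" "?JT \<union> set (map f xs) \<subseteq> Q"
    let ?P = "{r \<in> carrier R. f r \<in> Q}"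
    have "?P = \<mm>"
    proof (rule xs(3)[OF M.R.primeideal_contraction[OF N.R.is_cring hom Q(1)]])
      have "f a \<in> Q" if "a \<in> ?J" for a
      proof -
        have a: "a \<in> carrier R" "\<And>x. x \<in> carrier M \<Longrightarrow> a \<odot>\<^bsub>M\<^esub> x \<in> U" using that by (auto simp: colon_def)
        have "f a \<in> ?JT" using smult_mem_tsub[OF U(1) a] a(1) by (simp add: colon_def)
        then show ?thesis using Q(2) by blast
      qed
      then show "?J \<union> set xs \<subseteq> ?P" using Q(2) xs(2) m by (auto simp: colon_def)
    qed
    then have mQ: "f ` \<mm> \<subseteq> Q" by blast
    have "colon S N ?mN (carrier N) \<subseteq> Q"
    proof (rule subsetI, rule ccontr)
      fix s assume s: "s \<in> colon S N ?mN (carrier N)" and sQ: "s \<notin> Q"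
      then have sc: "s \<in> carrier S" and sN: "\<And>z. z \<in> carrier N \<Longrightarrow> s \<odot>\<^bsub>N\<^esub> z \<in> ?mN" by (auto simp: colon_def)
      \<comment> \<open>\<open>s\<close> is invertible at \<open>Q\<close> and carries
        \<open>N\<close> into \<open>\<mm> N\<close>, so \<open>T = \<mm> T\<close> locally. As
        \<open>\<mm>\<close> maps into \<open>Q\<close>, Nakayama's lemma makes the quotient by
        \<open>tsub U\<close> vanish at \<open>Q\<close>, although its annihilator lies in
        \<open>Q\<close>.\<close>
      have "carrier T \<subseteq> saturation S T Q (tsub U)"
      proof (rule Tn.local_nakayama[OF Q(1) mQ T.submodule_saturation[OF Q(1) tU] T.saturation_idem[OF Q(1)] order_refl])
        fix V assume V: "submodule V S T" "saturation S T Q V \<subseteq> V"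
          and mV: "\<And>a u. a \<in> f ` \<mm> \<Longrightarrow> u \<in> carrier T \<Longrightarrow> a \<odot>\<^bsub>T\<^esub> u \<in> V"
        have tnV: "tn x z \<in> V" if x: "x \<in> carrier M" and z: "z \<in> ?mN" for x z
        proof -
          have "?mN \<subseteq> {z \<in> carrier N. tn x z \<in> V}"
          proof (rule N.set_smult_minimal[OF submodule_tn_preimage_right[OF V(1) x]])
            fix a z assume a: "a \<in> f ` \<mm>" and z: "z \<in> carrier N"
            have ac: "a \<in> carrier S" using a image_ideal_carrier[OF m] by blast
            have "tn x (a \<odot>\<^bsub>N\<^esub> z) = a \<odot>\<^bsub>T\<^esub> tn x z" by (simp add: tn_smult[OF ac])
            then show "a \<odot>\<^bsub>N\<^esub> z \<in> {z \<in> carrier N. tn x z \<in> V}" using mV[OF a tn_closed[OF x z]] ac z by simp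
          qed
          then show ?thesis using z by blast
        qed
        have "carrier T \<subseteq> {t \<in> carrier T. s \<odot>\<^bsub>T\<^esub> t \<in> V}"
          by (rule subsetI, rule submodule_tensor_eq[OF T.submodule_preimage_mult[OF V(1) sc]])
             (use tnV sN tn_smult[OF sc] tn_closed in simp_all)
        then have "carrier T \<subseteq> saturation S T Q V" using sc sQ by (auto simp: saturation_def)
        then show "carrier T \<subseteq> V" using V(2) by (rule order_trans)
      qed
      then have "\<exists>s\<in>carrier S - Q. s \<odot>\<^bsub>T\<^esub> t \<in> tsub U" if "t \<in> carrier T" for t
        using that by (auto simp: saturation_def)
      from Tn.annihilated_locally[OF Q(1) tU this] obtain s' where "s' \<in> carrier S - Q" "s' \<in> ?JT"
        by (auto simp: colon_def)
      then show False using Q(2) by blast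
    qed
    show "Q = \<nn>"
    proof (rule ccontr)
      assume "Q \<noteq> \<nn>"
      \<comment> \<open>A prime strictly below \<open>\<nn>\<close> over the annihilator of the
        fiber would give the fiber dimension at least 1.\<close>
      then have "[Q] @ [\<nn>] \<in> prime_chains S (colon S N ?mN (carrier N))"
        using LS.prime_subset_maximal[OF Q(1)] \<open>colon S N ?mN (carrier N) \<subseteq> Q\<close>
        by (intro prime_chains_snoc prime_chains_singleton Q LS.maximal_prime) auto
      from dim_over_upper[OF this] show False using fib by simp
    qed
  qed
  also have "\<dots> \<le> dim_over R ?J" using xs(1) d by simp
  finally show ?thesis .
qed

text \<open>Each entry lowers the dimension by at least 1, and \<open>J M \<noteq> M\<close> keeps
  it nonnegative; so the lengths of regular sequences in \<open>J\<close> are bounded, and a longest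
  one is maximal.\<close>

lemma maximal_regular_seq_mod_exists:
  assumes J: "J \<subseteq> carrier R" and proper: "set_smult R J M \<noteq> carrier M"
  shows "\<exists>xs. maximal_regular_seq_mod J M {\<zero>\<^bsub>M\<^esub>} xs"
proof -
  have Z: "submodule {\<zero>\<^bsub>M\<^esub>} R M" by (rule M.submodule_zero)
  let ?D = "\<lambda>xs. dim_over R (colon R M (add_mults M {\<zero>\<^bsub>M\<^esub>} xs) (carrier M))"
  have nonneg: "0 \<le> ?D xs" if xs: "set xs \<subseteq> J" for xs
  proof (rule LR.dim_over_nonneg)
    have xc: "set xs \<subseteq> carrier R" using xs J by blast
    note S = M.submodule_add_mults[OF Z xc]
    show "ideal (colon R M (add_mults M {\<zero>\<^bsub>M\<^esub>} xs) (carrier M)) R" by (rule M.ideal_colon[OF S order_refl])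
    show "colon R M (add_mults M {\<zero>\<^bsub>M\<^esub>} xs) (carrier M) \<noteq> carrier R"
    proof
      assume "colon R M (add_mults M {\<zero>\<^bsub>M\<^esub>} xs) (carrier M) = carrier R"
      then have "\<one>\<^bsub>R\<^esub> \<in> colon R M (add_mults M {\<zero>\<^bsub>M\<^esub>} xs) (carrier M)" by simp
      then have "carrier M \<subseteq> add_mults M {\<zero>\<^bsub>M\<^esub>} xs" by (auto simp: colon_def)
      also have "\<dots> \<subseteq> set_smult R J M"
        unfolding M.set_smult_list[OF xc, symmetric] by (rule M.set_smult_mono[OF xs J])
      finally show False using proper M.submodule_carrier[OF M.set_smult_submodule[OF J]] by blast
    qed
  qed
  obtain d :: nat where d: "?D [] = ereal (real d)"
    using dim_over_attained[OF nonneg[of "[]"] LR.dim_over_finite] by auto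
  let ?P = "\<lambda>n. \<exists>xs. set xs \<subseteq> J \<and> regular_seq_mod M {\<zero>\<^bsub>M\<^esub>} xs \<and> length xs = n"
  have bound: "n \<le> d" if "?P n" for n
  proof -
    obtain xs where xs: "set xs \<subseteq> J" "regular_seq_mod M {\<zero>\<^bsub>M\<^esub>} xs" "length xs = n" using \<open>?P n\<close> by blast
    have "set xs \<subseteq> carrier R" using xs(1) J by blast
    from Mn.dim_over_regular_seq_mod[OF Z this xs(2)] have "?D xs + ereal (real n) \<le> ereal (real d)"
      using d xs(3) by simp
    moreover have "0 + ereal (real n) \<le> ?D xs + ereal (real n)" by (rule add_right_mono[OF nonneg[OF xs(1)]])
    ultimately have "0 + ereal (real n) \<le> ereal (real d)" by (rule order_trans[rotated])
    then show ?thesis by simp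
  qed
  have "?P 0" by (intro exI[of _ "[]"]) simp
  from GreatestI_nat[of ?P, OF this bound] obtain xs where
    xs: "set xs \<subseteq> J" "regular_seq_mod M {\<zero>\<^bsub>M\<^esub>} xs" "length xs = (GREATEST n. ?P n)" by blast
  have "\<not> regular_mod M (add_mults M {\<zero>\<^bsub>M\<^esub>} xs) z" if z: "z \<in> J" for z
  proof
    assume "regular_mod M (add_mults M {\<zero>\<^bsub>M\<^esub>} xs) z"
    then have "?P (Suc (length xs))" using xs z by (intro exI[of _ "xs @ [z]"]) (simp add: regular_seq_mod_append)
    then have "Suc (length xs) \<le> (GREATEST n. ?P n)" by (rule Greatest_le_nat[OF _ bound])
    then show False using xs(3) by simp
  qed
  then show ?thesis using xs by (auto simp: maximal_regular_seq_mod_def)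
qed

lemma maximal_regular_seq_mod_tensor:
  assumes J: "ideal J R" and xs: "maximal_regular_seq_mod J M {\<zero>\<^bsub>M\<^esub>} xs"
  shows "maximal_regular_seq_mod (Idl\<^bsub>S\<^esub> (f ` J)) T {\<zero>\<^bsub>T\<^esub>} (map f xs)"
proof -
  have Jc: "J \<subseteq> carrier R" using ideal.Icarr[OF J] by blast
  have fJ: "f ` J \<subseteq> carrier S" by (rule image_ideal_carrier[OF Jc])
  have xJ: "set xs \<subseteq> J" and reg: "regular_seq_mod M {\<zero>\<^bsub>M\<^esub>} xs"
    and max: "\<And>z. z \<in> J \<Longrightarrow> \<not> regular_mod M (add_mults M {\<zero>\<^bsub>M\<^esub>} xs) z"
    using xs by (auto simp: maximal_regular_seq_mod_def)
  have xc: "set xs \<subseteq> carrier R" using xJ Jc by blast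
  let ?U = "add_mults M {\<zero>\<^bsub>M\<^esub>} xs"
  have U: "submodule ?U R M" by (rule M.submodule_add_mults[OF M.submodule_zero xc])
  have tU: "submodule (tsub ?U) S T" by (rule tsub_submodule[OF M.submodule_carrier[OF U]])
  have adds: "add_mults T {\<zero>\<^bsub>T\<^esub>} (map f xs) = tsub ?U"
    using tsub_add_mults[OF M.submodule_zero xc] by (simp add: tsub_zero)
  obtain u where u: "u \<in> carrier M" "u \<notin> ?U" "\<And>a. a \<in> J \<Longrightarrow> a \<odot>\<^bsub>M\<^esub> u \<in> ?U"
    using Mn.annihilated_element_of_zero_divisors[OF U J max] by blast
  have "colon R M ?U {u} \<noteq> carrier R"
  proof
    assume "colon R M ?U {u} = carrier R"
    then have "\<one>\<^bsub>R\<^esub> \<in> colon R M ?U {u}" by simp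
    then show False using u by (simp add: colon_def)
  qed
  \<comment> \<open>By \<open>flat_colon_element\<close>, \<open>u \<otimes> z\<close> is nonzero
    modulo \<open>tsub ?U\<close> once \<open>z\<close> is outside \<open>(?U : u) N\<close>; such a
    \<open>z\<close> exists because the proper ideal \<open>(?U : u)\<close> lies in
    \<open>\<mm>\<close>.\<close>
  then have "colon R M ?U {u} \<subseteq> \<mm>" by (rule LR.proper_ideal_subset[OF M.ideal_colon_elem[OF U u(1)]])
  note proper = ideal_extension_proper[OF this]
  have cs: "set_smult S (f ` colon R M ?U {u}) N \<subseteq> carrier N"
    by (intro N.submodule_carrier N.set_smult_submodule) (auto simp: colon_def)
  then obtain z where z: "z \<in> carrier N" "z \<notin> set_smult S (f ` colon R M ?U {u}) N" using proper by blast
  have t: "tn u z \<in> carrier T" "tn u z \<notin> tsub ?U"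
    using tn_closed[OF u(1) z(1)] flat_colon_element[OF U u(1) z(1)] z(2) by blast+
  \<comment> \<open>The annihilator of \<open>u \<otimes> z\<close> is an ideal of \<open>S\<close>,
    so it suffices that it contains the images of the elements of \<open>J\<close>.\<close>
  have "Idl\<^bsub>S\<^esub> (f ` J) \<subseteq> colon S T (tsub ?U) {tn u z}"
  proof (rule N.R.genideal_minimal[OF T.ideal_colon_elem[OF tU t(1)]])
    have "f a \<odot>\<^bsub>T\<^esub> tn u z \<in> tsub ?U" if a: "a \<in> J" for a
      using tsub_mem[OF u(3)[OF a] z(1)] a Jc u(1) z(1) by (simp add: tn_smult tn_balanced subset_iff)
    then show "f ` J \<subseteq> colon S T (tsub ?U) {tn u z}" using fJ by (auto simp: colon_def)
  qed
  then have "\<not> regular_mod T (tsub ?U) b" if "b \<in> Idl\<^bsub>S\<^esub> (f ` J)" for b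
    using that t by (auto simp: regular_mod_def colon_def)
  moreover have "set (map f xs) \<subseteq> Idl\<^bsub>S\<^esub> (f ` J)" using N.R.genideal_self[OF fJ] xJ by auto
  moreover have "regular_seq_mod T {\<zero>\<^bsub>T\<^esub>} (map f xs)"
    using regular_seq_mod_tsub[OF M.submodule_zero xc reg] by (simp add: tsub_zero)
  ultimately show ?thesis unfolding maximal_regular_seq_mod_def adds by blast
qed

end

theorem theorem2p7:
  fixes R :: "('a, 'r) ring_scheme" and S :: "('b, 's) ring_scheme"
    and \<mm> :: "'a set" and \<nn> :: "'b set" and f :: "'a \<Rightarrow> 'b"
    and M :: "('a, 'm, 'k) module_scheme" and N :: "('b, 'n, 'j) module_scheme"
    and I :: "'a set"
  assumes "noetherian_local_ring R \<mm>" and "noetherian_local_ring S \<nn>"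
    and "f \<in> ring_hom R S" and "f ` \<mm> \<subseteq> \<nn>"
    and "fin_gen_module S N" and "carrier N \<noteq> {\<zero>\<^bsub>N\<^esub>}" and "flat_over R f N"
    and "ideal I R" and "I \<noteq> carrier R"
    and "fin_gen_module R M" and "carrier M \<noteq> {\<zero>\<^bsub>M\<^esub>}"
    and "carrier (tensor R f M N) \<noteq> set_smult S (f ` I) (tensor R f M N)"
  shows "let T = tensor R f M N; IS = Idl\<^bsub>S\<^esub> (f ` I);
      c1 = (relative_CM R I M \<and>
        module_dim S (quot_module N (set_smult S (f ` \<mm>) N)) = 0);
      c2 = (relative_CM S IS T \<and> grade R I M = grade S IS T \<and>
        module_dim R (quot_module M (set_smult R I M)) =
          module_dim S (quot_module T (set_smult S (f ` I) T)));
      c3 = (relative_CM S IS T \<and> grade R I M = grade S IS T \<and>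
        module_dim R M = module_dim S T)
    in (c1 \<longleftrightarrow> c2) \<and> (c2 \<longleftrightarrow> c3)"
proof -
  have modules: "module R M" "module S N" using assms(5,10) by (auto simp: fin_gen_module_def)
  interpret local_flat_tensor R M S N f \<mm> \<nn>
    by (intro local_flat_tensor.intro local_flat_tensor_axioms.intro flat_tensor.intro flat_tensor_axioms.intro
        tensor_modules.intro tensor_modules_axioms.intro modules assms)
  have Ic: "I \<subseteq> carrier R" using ideal.Icarr[OF assms(8)] by blast
  have fI: "f ` I \<subseteq> carrier S" by (rule image_ideal_carrier[OF Ic])
  let ?IS = "Idl\<^bsub>S\<^esub> (f ` I)" let ?IM = "set_smult R I M" let ?IT = "set_smult S (f ` I) T"
  have IM: "submodule ?IM R M" by (rule M.set_smult_submodule[OF Ic])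
  have IT: "submodule ?IT S T" by (rule T.set_smult_submodule[OF fI])
  have IS: "ideal ?IS S" by (rule N.R.genideal_ideal[OF fI])
  have IT_eq: "set_smult S ?IS T = ?IT" by (rule T.set_smult_genideal[OF fI])
  have t_IM: "tsub ?IM = ?IT" by (rule tsub_set_smult[OF Ic])
  have IM_proper: "?IM \<noteq> carrier M"
  proof
    assume "?IM = carrier M"
    then have "?IT = carrier T" using t_IM tsub_carrier by simp
    then show False using assms(12) by simp
  qed
  have M_proper: "{\<zero>\<^bsub>M\<^esub>} \<noteq> carrier M" using assms(11) by blast
  have m: "\<mm> \<subseteq> carrier R" using maximal_carrier by blast
  define a where "a = dim_over R (colon R M {\<zero>\<^bsub>M\<^esub>} (carrier M))"
  define b where "b = dim_over R (colon R M ?IM (carrier M))"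
  define a' where "a' = dim_over S (colon S T {\<zero>\<^bsub>T\<^esub>} (carrier T))"
  define b' where "b' = dim_over S (colon S T ?IT (carrier T))"
  define d where "d = fiber_dim \<mm>"
  have dims: "module_dim R M = a" "module_dim R (quot_module M ?IM) = b" "module_dim S T = a'"
    "module_dim S (quot_module T ?IT) = b'" "module_dim S (quot_module N (set_smult S (f ` \<mm>) N)) = d"
    unfolding module_dim_def a_def b_def a'_def b'_def d_def
      M.annihilator_eq T.annihilator_eq M.annihilator_quot[OF IM] T.annihilator_quot[OF IT]
      N.annihilator_quot[OF N.set_smult_submodule[OF image_ideal_carrier[OF m]]]
    by (intro M.R.krull_dim_quot N.R.krull_dim_quot M.ideal_colon T.ideal_colon N.ideal_colon order_refl
        M.submodule_zero T.submodule_zero IM IT N.set_smult_submodule[OF image_ideal_carrier[OF m]])+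
  obtain xs where xs: "maximal_regular_seq_mod I M {\<zero>\<^bsub>M\<^esub>} xs"
    using maximal_regular_seq_mod_exists[OF Ic IM_proper] by blast
  define g where "g = length xs"
  have gM: "grade R I M = g" unfolding g_def by (rule Mn.grade_eq_length[OF assms(8) IM_proper xs])
  have gT: "grade S ?IS T = g"
    using Tn.grade_eq_length[OF IS _ maximal_regular_seq_mod_tensor[OF assms(8) xs]] assms(12)
    unfolding IT_eq g_def by auto
  have bound: "ereal (real g) + b \<le> a"
  proof -
    have xI: "set xs \<subseteq> I" and reg: "regular_seq_mod M {\<zero>\<^bsub>M\<^esub>} xs"
      using xs by (auto simp: maximal_regular_seq_mod_def)
    have xc: "set xs \<subseteq> carrier R" using xI Ic by blast
    have "add_mults M {\<zero>\<^bsub>M\<^esub>} xs \<subseteq> ?IM"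
      unfolding M.set_smult_list[OF xc, symmetric] by (rule M.set_smult_mono[OF xI Ic])
    then have "b \<le> dim_over R (colon R M (add_mults M {\<zero>\<^bsub>M\<^esub>} xs) (carrier M))"
      unfolding b_def by (intro dim_over_antimono) (auto simp: colon_def)
    then have "b + ereal (real g) \<le> dim_over R (colon R M (add_mults M {\<zero>\<^bsub>M\<^esub>} xs) (carrier M)) + ereal (real g)"
      by (rule add_right_mono)
    also have "\<dots> \<le> a" unfolding a_def g_def by (rule Mn.dim_over_regular_seq_mod[OF M.submodule_zero xc reg])
    finally show ?thesis by (simp add: add.commute)
  qed
  have ge: "a + d \<le> a'" "b + d \<le> b'"
    using dim_tensor_ge[OF M.submodule_zero] dim_tensor_ge[OF IM]
    unfolding a_def b_def a'_def b'_def d_def tsub_zero t_IM by auto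
  have le: "a' \<le> a" "b' \<le> b" if "d = 0"
    using dim_tensor_le[OF M.submodule_zero M_proper] dim_tensor_le[OF IM IM_proper] that
    unfolding a_def b_def a'_def b'_def d_def tsub_zero t_IM by auto
  have d0: "0 \<le> d" "d < \<infinity>" unfolding d_def by (rule fiber_dim_nonneg, rule fiber_dim_finite)
  have nonneg: "0 \<le> dim_over R (colon R M U (carrier M))" if U: "submodule U R M" "U \<noteq> carrier M" for U
  proof (rule LR.dim_over_nonneg[OF M.ideal_colon[OF U(1) order_refl]])
    show "colon R M U (carrier M) \<noteq> carrier R"
    proof
      assume "colon R M U (carrier M) = carrier R"
      then have "\<one>\<^bsub>R\<^esub> \<in> colon R M U (carrier M)" by simp
      then have "carrier M \<subseteq> U" by (auto simp: colon_def)
      then show False using U(2) M.submodule_carrier[OF U(1)] by blast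
    qed
  qed
  have ab: "0 \<le> a" "a < \<infinity>" "0 \<le> b" "b < \<infinity>"
    unfolding a_def b_def using nonneg[OF M.submodule_zero M_proper] nonneg[OF IM IM_proper] LR.dim_over_finite by auto
  have ab': "a' < \<infinity>" "b' < \<infinity>" unfolding a'_def b'_def by (rule LS.dim_over_finite)+
  \<comment> \<open>From here on all dimensions are real numbers and summands may be cancelled; the
    primed ones are kept away from \<open>- \<infinity>\<close> by \<open>ge\<close>.\<close>
  obtain ra rb rd where r: "a = ereal ra" "b = ereal rb" "d = ereal rd"
    using ab d0 by (cases a; cases b; cases d) auto
  obtain ra' rb' where r': "a' = ereal ra'" "b' = ereal rb'"
    using ab' ge r by (cases a'; cases b') auto
  have eqs: "relative_CM R I M \<longleftrightarrow> real g + rb = ra" "relative_CM S ?IS T \<longleftrightarrow> real g + rb' = ra'"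
    unfolding relative_CM_def IT_eq dims gM gT r r' by simp_all
  have ineqs: "real g + rb \<le> ra" "ra + rd \<le> ra'" "rb + rd \<le> rb'" "0 \<le> rd"
    using bound ge d0 r r' by auto
  have ineqs0: "rd = 0 \<Longrightarrow> ra' \<le> ra" "rd = 0 \<Longrightarrow> rb' \<le> rb"
    using le r r' by (auto simp: zero_ereal_def)
  \<comment> \<open>For \<open>rd = 0\<close> the inequalities give \<open>ra' = ra\<close> and
    \<open>rb' = rb\<close>, and all three conditions become \<open>g + rb = ra\<close>. For
    \<open>rd > 0\<close> they give \<open>ra' > ra\<close> and \<open>rb' > rb\<close>, and all
    three fail.\<close>
  show ?thesis
    unfolding Let_def eqs dims gM gT r r' zero_ereal_def ereal.inject
    using ineqs ineqs0 by (cases "rd = 0") linarith+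
qed

end
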